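(* Let $(V,\omega,\tau)$ be fundamental algebraic data with $\dim_{\mathbb C}V=2n$, let $\gamma(u,v)=\sqrt{-1}\,\omega(u,\tau v)$, let $V=L\oplus L'$ be the Lagrangean splitting induced by a Lagrangean splitting $V^\tau=L_0\oplus L_0'$, and let $M\subset (V,\omega,\gamma)$ be a Lagrangean Kähler submanifold (resp. a Lagrangean pseudo Kähler submanifold of complex signature $(k,l)$ which is in general position with respect to $V=L\oplus L'$). Then the function $$K(\sigma)=K^M(\pi(\sigma))+g^{-1}_{\pi(\sigma)}\bigl(\sigma+\rho(\sigma),\sigma+\rho(\sigma)\bigr),\qquad \sigma\in T^*M,$$ is the Kähler potential of a hyper Kähler metric $G$ on $T^*M$ (resp. the pseudo Kähler potential of a pseudo hyper Kähler metric $G$ of complex signature $(2k,2l)$ on $T^*M$). More precisely, the standard complex symplectic structure $\Omega$ on the holomorphic cotangent bundle $T^*M$ is parallel with respect to the canonical connection of the Kähler (resp. pseudo Kähler) manifold $N=(T^*M,G)$.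
   Context: Fundamental algebraic data $(V,\omega,\tau)$: a complex symplectic vector space $(V,\omega)$ of complex dimension $2n$, together with a $\mathbb C$-antilinear involution $\tau:V\to V$ such that the restriction of $\omega$ to the fixed point set $V^\tau$ is a real symplectic structure. (Up to isomorphism $V=T^*\mathbb C^n$, $V^\tau=T^*\mathbb R^n$, $\omega=\sum dq^i\wedge dp_i$.) $\gamma(u,v)=\sqrt{-1}\,\omega(u,\tau v)$ is a Hermitian form of signature $(n,n)$ on $V$. A submanifold $M\subset V$ is Lagrangean if each $T_mM$ is a Lagrangean (maximally isotropic) complex subspace of $(V,\omega)$; such an $M$ is a complex submanifold. A complex submanifold $M\subset V$ is a pseudo Kähler submanifold of $(V,\gamma)$ if $\gamma|M$ is nondegenerate; its complex signature $(k,l)$ is that of $\gamma|T_mM$. It is a Kähler submanifold if $\gamma|T_mM$ is positive definite for all $m$. Put $g=\gamma|M$ and $K^M(u)=\gamma(u,u)$, $u\in M$. A Lagrangean splitting $V^\tau=L_0\oplus L_0'$ is a decomposition into two Lagrangean subspaces; it induces $V=L\oplus L'$ with $L=\tau L$, $L'=\tau L'$, $L_0=L^\tau$, $L_0'=(L')^\tau$. A Lagrangean submanifold $M$ is in general position with respect to $V=L\oplus L'$ if the projection $p:V\to L$ along $L'$ induces an isomorphism of $M$ onto its image. In both cases of the claim $dp:T_mM\to L$ is an isomorphism for all $m\in M$ (if $M$ is Kähler this is automatic, since $\gamma$ vanishes on $L'$). Canonical real structure: $\rho'$ on $T_mM$ is the $\mathbb C$-antilinear involution whose fixed point set $(T_mM)^{\rho'}$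 satisfies $dp\,(T_mM)^{\rho'}=L_0$; $\rho$ is the dual real structure on $T^*_mM$. $g^{-1}_m$ is the Hermitian metric on $T^*_mM$ inverse to $g_m$, and $\pi:T^*M\to M$ is the projection. In local holomorphic coordinates: choosing linear coordinates of $L_0\cong\mathbb R^n$, $M$ is locally given by $p_i=\partial F/\partial q^i$ with $F$ holomorphic; with $z^i=q^i|M$ and induced coordinates $(z^i,w_i)$ on $T^*M$, one has $g_{ij}=\sqrt{-1}(\overline{F}_{ij}-F_{ij})$ with $F_{ij}=\partial^2F/\partial z^i\partial z^j$, and $K=K^M+\sum_{ij}g^{ij}(w_i+\overline w_i)(w_j+\overline w_j)$, where $(g^{ij})=(g_{ij})^{-1}$. A function $K$ is a (pseudo) Kähler potential of $G$ if $G_{IJ}=\partial^2K/\partial z^I\partial\overline z^J$ in holomorphic coordinates. A complex symplectic structure on a complex manifold is a holomorphic, closed, nondegenerate 2-form. A (pseudo) Kähler manifold is called (pseudo) hyper Kähler if it admits a parallel complex symplectic structure; its metric is then called a (pseudo) hyper Kähler metric. *)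

theory Defs
  imports "HOL-Analysis.Analysis"
begin

section \<open>Forms on complex vector spaces\<close>

definition isotropic :: "('a \<Rightarrow> 'a \<Rightarrow> complex) \<Rightarrow> 'a set \<Rightarrow> bool" where
  "isotropic \<omega> S \<longleftrightarrow> (\<forall>u\<in>S. \<forall>v\<in>S. \<omega> u v = 0)"

text \<open>Lagrangean means maximally isotropic.  The predicate \<open>sub\<close> selects the subspaces that are
  considered: \<open>vec.subspace\<close> for complex ones, \<open>subspace\<close> for real ones.\<close>

definition lagrangean_in ::
  "('a set \<Rightarrow> bool) \<Rightarrow> ('a \<Rightarrow> 'a \<Rightarrow> complex) \<Rightarrow> 'a set \<Rightarrow> 'a set \<Rightarrow> bool" where
  "lagrangean_in sub \<omega> W S \<longleftrightarrow>
     sub S \<and> S \<subseteq> W \<and> isotropic \<omega> S \<and>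
     (\<forall>S'. sub S' \<and> S' \<subseteq> W \<and> isotropic \<omega> S' \<and> S \<subseteq> S' \<longrightarrow> S' = S)"

definition nondegenerate_on :: "('a::zero) set \<Rightarrow> ('a \<Rightarrow> 'a \<Rightarrow> complex) \<Rightarrow> bool" where
  "nondegenerate_on S h \<longleftrightarrow> (\<forall>u\<in>S. (\<forall>v\<in>S. h u v = 0) \<longrightarrow> u = 0)"

definition complex_bilinear :: "(complex^'v \<Rightarrow> complex^'v \<Rightarrow> complex) \<Rightarrow> bool" where
  "complex_bilinear B \<longleftrightarrow>
     (\<forall>u. Vector_Spaces.linear (*s) (*) (\<lambda>v. B u v)) \<and>
     (\<forall>v. Vector_Spaces.linear (*s) (*) (\<lambda>u. B u v))"

definition complex_symplectic_form :: "(complex^'v \<Rightarrow> complex^'v \<Rightarrow> complex) \<Rightarrow> bool" where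
  "complex_symplectic_form \<omega> \<longleftrightarrow>
     complex_bilinear \<omega> \<and> (\<forall>u. \<omega> u u = 0) \<and> nondegenerate_on UNIV \<omega>"

definition hermitian_form :: "(complex^'v \<Rightarrow> complex^'v \<Rightarrow> complex) \<Rightarrow> bool" where
  "hermitian_form h \<longleftrightarrow>
     (\<forall>v. Vector_Spaces.linear (*s) (*) (\<lambda>u. h u v)) \<and> (\<forall>u v. h v u = cnj (h u v))"

definition positive_definite_on ::
  "(complex^'v) set \<Rightarrow> (complex^'v \<Rightarrow> complex^'v \<Rightarrow> complex) \<Rightarrow> bool" where
  "positive_definite_on S h \<longleftrightarrow> (\<forall>u\<in>S. u \<noteq> 0 \<longrightarrow> h u u \<in> \<real> \<and> 0 < Re (h u u))"

definition has_signature ::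
  "(complex^'v) set \<Rightarrow> (complex^'v \<Rightarrow> complex^'v \<Rightarrow> complex) \<Rightarrow> nat \<Rightarrow> nat \<Rightarrow> bool" where
  "has_signature S h k l \<longleftrightarrow>
     (\<exists>P N. vec.subspace P \<and> vec.subspace N \<and> S = {u + v |u v. u \<in> P \<and> v \<in> N} \<and> P \<inter> N = {0} \<and>
        (\<forall>u\<in>P. \<forall>v\<in>N. h u v = 0) \<and>
        positive_definite_on P h \<and> positive_definite_on N (\<lambda>u v. - h u v) \<and>
        vec.dim P = k \<and> vec.dim N = l)"

definition fixed_points :: "('a \<Rightarrow> 'a) \<Rightarrow> 'a set" where
  "fixed_points \<tau> = {u. \<tau> u = u}"

definition antilinear_involution_on :: "(complex^'v) set \<Rightarrow> (complex^'v \<Rightarrow> complex^'v) \<Rightarrow> bool" where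
  "antilinear_involution_on S \<tau> \<longleftrightarrow>
     (\<forall>u\<in>S. \<tau> u \<in> S \<and> \<tau> (\<tau> u) = u) \<and>
     (\<forall>u\<in>S. \<forall>v\<in>S. \<tau> (u + v) = \<tau> u + \<tau> v) \<and>
     (\<forall>c. \<forall>u\<in>S. \<tau> (c *s u) = cnj c *s \<tau> u)"

text \<open>The dimension of \<open>V = complex^'v\<close> is prescribed separately as \<open>CARD('v)\<close>.\<close>

definition fundamental_data ::
  "(complex^'v \<Rightarrow> complex^'v \<Rightarrow> complex) \<Rightarrow> (complex^'v \<Rightarrow> complex^'v) \<Rightarrow> bool" where
  "fundamental_data \<omega> \<tau> \<longleftrightarrow>
     complex_symplectic_form \<omega> \<and> antilinear_involution_on UNIV \<tau> \<and>
     (\<forall>u\<in>fixed_points \<tau>. \<forall>v\<in>fixed_points \<tau>. \<omega> u v \<in> \<real>) \<and>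
     nondegenerate_on (fixed_points \<tau>) \<omega>"

definition gamma_form ::
  "(complex^'v \<Rightarrow> complex^'v \<Rightarrow> complex) \<Rightarrow> (complex^'v \<Rightarrow> complex^'v) \<Rightarrow>
   complex^'v \<Rightarrow> complex^'v \<Rightarrow> complex" where
  "gamma_form \<omega> \<tau> u v = \<i> * \<omega> u (\<tau> v)"

text \<open>The induced splitting of \<open>V\<close> is \<open>L = vec.span L\<^sub>0\<close>, \<open>L' = vec.span L\<^sub>0'\<close>.\<close>

definition lagrangean_splitting ::
  "(complex^'v \<Rightarrow> complex^'v \<Rightarrow> complex) \<Rightarrow> (complex^'v \<Rightarrow> complex^'v) \<Rightarrow>
   (complex^'v) set \<Rightarrow> (complex^'v) set \<Rightarrow> bool" where
  "lagrangean_splitting \<omega> \<tau> L\<^sub>0 L\<^sub>0' \<longleftrightarrow>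
     lagrangean_in subspace \<omega> (fixed_points \<tau>) L\<^sub>0 \<and>
     lagrangean_in subspace \<omega> (fixed_points \<tau>) L\<^sub>0' \<and>
     L\<^sub>0 \<inter> L\<^sub>0' = {0} \<and> fixed_points \<tau> = {u + v |u v. u \<in> L\<^sub>0 \<and> v \<in> L\<^sub>0'}"

definition projection_along :: "('a::ab_group_add) set \<Rightarrow> 'a set \<Rightarrow> 'a \<Rightarrow> 'a" where
  "projection_along L L' v = (THE a. a \<in> L \<and> v - a \<in> L')"


section \<open>Holomorphic and smooth maps\<close>

definition holomorphic_fun_on :: "(complex^'k \<Rightarrow> complex) \<Rightarrow> (complex^'k) set \<Rightarrow> bool" where
  "holomorphic_fun_on f D \<longleftrightarrow>
     (\<forall>z\<in>D. \<exists>f'. (f has_derivative f') (at z) \<and> Vector_Spaces.linear (*s) (*) f')"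

definition holomorphic_map_on :: "(complex^'k \<Rightarrow> complex^'m) \<Rightarrow> (complex^'k) set \<Rightarrow> bool" where
  "holomorphic_map_on f D \<longleftrightarrow> (\<forall>i. holomorphic_fun_on (\<lambda>z. f z $ i) D)"

abbreviation deriv_at :: "('a::real_normed_vector \<Rightarrow> 'b::real_normed_vector) \<Rightarrow> 'a \<Rightarrow> 'a \<Rightarrow> 'b" where
  "deriv_at f z \<equiv> frechet_derivative f (at z)"

primrec Ck_on :: "nat \<Rightarrow> ('a::real_normed_vector \<Rightarrow> 'b::real_normed_vector) \<Rightarrow> 'a set \<Rightarrow> bool" where
  "Ck_on 0 f D \<longleftrightarrow> continuous_on D f"
| "Ck_on (Suc k) f D \<longleftrightarrow>
     (\<forall>z\<in>D. f differentiable (at z)) \<and> (\<forall>v. Ck_on k (\<lambda>z. deriv_at f z v) D)"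

definition smooth_on :: "('a::real_normed_vector \<Rightarrow> 'b::real_normed_vector) \<Rightarrow> 'a set \<Rightarrow> bool" where
  "smooth_on f D \<longleftrightarrow> (\<forall>k. Ck_on k f D)"

text \<open>The Wirtinger derivatives \<open>\<partial>f/\<partial>z\<^sup>I\<close> and \<open>\<partial>f/\<partial>cnj z\<^sup>J\<close>.\<close>

definition wirtinger :: "'k \<Rightarrow> (complex^'k \<Rightarrow> complex) \<Rightarrow> complex^'k \<Rightarrow> complex" where
  "wirtinger I f z = (deriv_at f z (axis I 1) - \<i> * deriv_at f z (axis I \<i>)) / 2"

definition wirtinger_bar :: "'k \<Rightarrow> (complex^'k \<Rightarrow> complex) \<Rightarrow> complex^'k \<Rightarrow> complex" where
  "wirtinger_bar J f z = (deriv_at f z (axis J 1) + \<i> * deriv_at f z (axis J \<i>)) / 2"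


section \<open>Complex manifolds and tensor fields\<close>

text \<open>A chart is given by its inverse, a parametrization \<open>\<psi>\<close> of a piece of the manifold by an
  open set \<open>D\<close> of the coordinate space.\<close>

type_synonym ('k, 'x) chart = "(complex^'k) set \<times> (complex^'k \<Rightarrow> 'x)"

definition overlap :: "('k, 'x) chart \<Rightarrow> ('k, 'x) chart \<Rightarrow> (complex^'k) set" where
  "overlap c c' = {z \<in> fst c. snd c z \<in> snd c' ` fst c'}"

definition transition :: "('k, 'x) chart \<Rightarrow> ('k, 'x) chart \<Rightarrow> complex^'k \<Rightarrow> complex^'k" where
  "transition c c' = inv_into (fst c') (snd c') \<circ> snd c"

definition complex_atlas :: "'x set \<Rightarrow> ('k::finite, 'x) chart set \<Rightarrow> bool" where
  "complex_atlas X A \<longleftrightarrow>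
     (\<forall>(D, \<psi>)\<in>A. open D \<and> inj_on \<psi> D) \<and>
     X = (\<Union>(D, \<psi>)\<in>A. \<psi> ` D) \<and>
     (\<forall>c\<in>A. \<forall>c'\<in>A. open (overlap c c') \<and> holomorphic_map_on (transition c c') (overlap c c'))"

definition manifold_topology :: "'x set \<Rightarrow> ('k::finite, 'x) chart set \<Rightarrow> 'x topology" where
  "manifold_topology X A = topology (\<lambda>U. U \<subseteq> X \<and> (\<forall>(D, \<psi>)\<in>A. open {z \<in> D. \<psi> z \<in> U}))"

definition complex_manifold :: "'x set \<Rightarrow> ('k::finite, 'x) chart set \<Rightarrow> bool" where
  "complex_manifold X A \<longleftrightarrow>
     complex_atlas X A \<and>
     Hausdorff_space (manifold_topology X A) \<and> second_countable (manifold_topology X A)"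

text \<open>A field \<open>B\<close> of complex valued, real bilinear forms on the tangent spaces is given by its
  expressions in the charts: \<open>B c z u v\<close> is the value, in the chart \<open>c\<close> and at the point with
  coordinates \<open>z\<close>, on the tangent vectors with components \<open>u\<close> and \<open>v\<close>.\<close>

type_synonym ('k, 'x) form_field =
  "('k, 'x) chart \<Rightarrow> complex^'k \<Rightarrow> complex^'k \<Rightarrow> complex^'k \<Rightarrow> complex"

definition tensor_field :: "('k::finite, 'x) chart set \<Rightarrow> ('k, 'x) form_field \<Rightarrow> bool" where
  "tensor_field A B \<longleftrightarrow>
     (\<forall>c\<in>A. \<forall>c'\<in>A. \<forall>z\<in>overlap c c'. \<forall>u v.
        B c z u v = B c' (transition c c' z)
                      (deriv_at (transition c c') z u) (deriv_at (transition c c') z v))"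

definition closed_2form_on ::
  "'a set \<Rightarrow> ('a::real_normed_vector \<Rightarrow> 'a \<Rightarrow> 'a \<Rightarrow> 'b::real_normed_vector) \<Rightarrow> bool" where
  "closed_2form_on D \<alpha> \<longleftrightarrow>
     (\<forall>z\<in>D. \<forall>u v w. deriv_at (\<lambda>x. \<alpha> x v w) z u + deriv_at (\<lambda>x. \<alpha> x w u) z v
                    + deriv_at (\<lambda>x. \<alpha> x u v) z w = 0)"

definition pseudo_hermitian_metric :: "('k::finite, 'x) chart set \<Rightarrow> ('k, 'x) form_field \<Rightarrow> bool" where
  "pseudo_hermitian_metric A G \<longleftrightarrow>
     tensor_field A G \<and>
     (\<forall>c\<in>A. (\<forall>z\<in>fst c. hermitian_form (G c z) \<and> nondegenerate_on UNIV (G c z)) \<and>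
            (\<forall>u v. smooth_on (\<lambda>z. G c z u v) (fst c)))"

text \<open>The underlying pseudo Riemannian metric is \<open>Re G\<close>, and \<open>Re (G (\<i> u) v)\<close> is the
  fundamental form.\<close>

definition pseudo_kaehler_metric ::
  "'x set \<Rightarrow> ('k::finite, 'x) chart set \<Rightarrow> ('k, 'x) form_field \<Rightarrow> bool" where
  "pseudo_kaehler_metric X A G \<longleftrightarrow>
     complex_manifold X A \<and> pseudo_hermitian_metric A G \<and>
     (\<forall>c\<in>A. closed_2form_on (fst c) (\<lambda>z u v. Re (G c z (\<i> *s u) v)))"

definition kaehler_metric ::
  "'x set \<Rightarrow> ('k::finite, 'x) chart set \<Rightarrow> ('k, 'x) form_field \<Rightarrow> bool" where
  "kaehler_metric X A G \<longleftrightarrow>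
     pseudo_kaehler_metric X A G \<and> (\<forall>c\<in>A. \<forall>z\<in>fst c. positive_definite_on UNIV (G c z))"

definition metric_signature ::
  "('k::finite, 'x) chart set \<Rightarrow> ('k, 'x) form_field \<Rightarrow> nat \<Rightarrow> nat \<Rightarrow> bool" where
  "metric_signature A G k l \<longleftrightarrow> (\<forall>c\<in>A. \<forall>z\<in>fst c. has_signature UNIV (G c z) k l)"

text \<open>\<open>\<Gamma> z\<close> is the Christoffel map of a connection on \<open>D\<close>: the covariant derivative of the
  constant vector field \<open>v\<close> in direction \<open>u\<close> is \<open>\<Gamma> z u v\<close>.  The Levi-Civita connection is the
  torsion free connection for which the metric is parallel; it is unique as the metric is
  nondegenerate, so that the expressions in different charts define a single connection.\<close>

definition levi_civita ::
  "'a set \<Rightarrow> ('a::real_normed_vector \<Rightarrow> 'a \<Rightarrow> 'a \<Rightarrow> real) \<Rightarrow> ('a \<Rightarrow> 'a \<Rightarrow> 'a \<Rightarrow> 'a) \<Rightarrow> bool" where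
  "levi_civita D g \<Gamma> \<longleftrightarrow>
     (\<forall>z\<in>D. bilinear (\<Gamma> z) \<and> (\<forall>u v. \<Gamma> z u v = \<Gamma> z v u) \<and>
        (\<forall>w u v. deriv_at (\<lambda>x. g x u v) z w = g z (\<Gamma> z w u) v + g z u (\<Gamma> z w v)))"

definition parallel_on ::
  "'a set \<Rightarrow> ('a::real_normed_vector \<Rightarrow> 'a \<Rightarrow> 'a \<Rightarrow> 'a) \<Rightarrow>
   ('a \<Rightarrow> 'a \<Rightarrow> 'a \<Rightarrow> 'b::real_normed_vector) \<Rightarrow> bool" where
  "parallel_on D \<Gamma> \<alpha> \<longleftrightarrow>
     (\<forall>z\<in>D. \<forall>w u v. deriv_at (\<lambda>x. \<alpha> x u v) z w = \<alpha> z (\<Gamma> z w u) v + \<alpha> z u (\<Gamma> z w v))"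

definition parallel ::
  "('k::finite, 'x) chart set \<Rightarrow> ('k, 'x) form_field \<Rightarrow> ('k, 'x) form_field \<Rightarrow> bool" where
  "parallel A G \<Omega> \<longleftrightarrow>
     (\<forall>c\<in>A. \<exists>\<Gamma>. levi_civita (fst c) (\<lambda>z u v. Re (G c z u v)) \<Gamma> \<and> parallel_on (fst c) \<Gamma> (\<Omega> c))"

definition complex_symplectic_structure ::
  "('k::finite, 'x) chart set \<Rightarrow> ('k, 'x) form_field \<Rightarrow> bool" where
  "complex_symplectic_structure A \<Omega> \<longleftrightarrow>
     tensor_field A \<Omega> \<and>
     (\<forall>c\<in>A. (\<forall>z\<in>fst c. complex_symplectic_form (\<Omega> c z)) \<and>
            (\<forall>u v. holomorphic_fun_on (\<lambda>z. \<Omega> c z u v) (fst c)) \<and>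
            closed_2form_on (fst c) (\<Omega> c))"

definition pseudo_hyper_kaehler_metric ::
  "'x set \<Rightarrow> ('k::finite, 'x) chart set \<Rightarrow> ('k, 'x) form_field \<Rightarrow> bool" where
  "pseudo_hyper_kaehler_metric X A G \<longleftrightarrow>
     pseudo_kaehler_metric X A G \<and> (\<exists>\<Omega>. complex_symplectic_structure A \<Omega> \<and> parallel A G \<Omega>)"

definition hyper_kaehler_metric ::
  "'x set \<Rightarrow> ('k::finite, 'x) chart set \<Rightarrow> ('k, 'x) form_field \<Rightarrow> bool" where
  "hyper_kaehler_metric X A G \<longleftrightarrow>
     kaehler_metric X A G \<and> (\<exists>\<Omega>. complex_symplectic_structure A \<Omega> \<and> parallel A G \<Omega>)"

definition kaehler_potential ::
  "'x set \<Rightarrow> ('k::finite, 'x) chart set \<Rightarrow> ('x \<Rightarrow> complex) \<Rightarrow> ('k, 'x) form_field \<Rightarrow> bool" where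
  "kaehler_potential X A K G \<longleftrightarrow>
     (\<forall>x\<in>X. K x \<in> \<real>) \<and>
     (\<forall>(D, \<psi>)\<in>A. smooth_on (K \<circ> \<psi>) D \<and>
        (\<forall>z\<in>D. \<forall>I J. G (D, \<psi>) z (axis I 1) (axis J 1) = wirtinger I (wirtinger_bar J (K \<circ> \<psi>)) z))"


section \<open>Submanifolds of a complex vector space\<close>

text \<open>The inverse charts of a (locally closed, embedded) complex submanifold: holomorphic
  immersions that are homeomorphisms onto relatively open subsets.\<close>

definition submanifold_charts :: "'n itself \<Rightarrow> (complex^'v) set \<Rightarrow> ('n::finite, complex^'v) chart set" where
  "submanifold_charts T M =
     {(D, \<phi>). open D \<and> holomorphic_map_on \<phi> D \<and> (\<forall>z\<in>D. inj (deriv_at \<phi> z)) \<and>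
        openin (top_of_set M) (\<phi> ` D) \<and> (\<exists>\<phi>'. homeomorphism D (\<phi> ` D) \<phi> \<phi>')}"

definition complex_submanifold :: "'n::finite itself \<Rightarrow> (complex^'v) set \<Rightarrow> bool" where
  "complex_submanifold T M \<longleftrightarrow> (\<forall>m\<in>M. \<exists>(D, \<phi>)\<in>submanifold_charts T M. m \<in> \<phi> ` D)"

definition tangent_space :: "('a::real_normed_vector) set \<Rightarrow> 'a \<Rightarrow> 'a set" where
  "tangent_space M m =
     {v. \<exists>c. (\<forall>t::real. c t \<in> M) \<and> c 0 = m \<and> (c has_vector_derivative v) (at 0)}"

definition lagrangean_submanifold ::
  "'n::finite itself \<Rightarrow> (complex^'v \<Rightarrow> complex^'v \<Rightarrow> complex) \<Rightarrow> (complex^'v) set \<Rightarrow> bool" where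
  "lagrangean_submanifold T \<omega> M \<longleftrightarrow>
     complex_submanifold T M \<and> (\<forall>m\<in>M. lagrangean_in vec.subspace \<omega> UNIV (tangent_space M m))"

definition kaehler_submanifold ::
  "'n::finite itself \<Rightarrow> (complex^'v \<Rightarrow> complex^'v \<Rightarrow> complex) \<Rightarrow> (complex^'v) set \<Rightarrow> bool" where
  "kaehler_submanifold T h M \<longleftrightarrow>
     complex_submanifold T M \<and> (\<forall>m\<in>M. positive_definite_on (tangent_space M m) h)"

definition pseudo_kaehler_submanifold ::
  "'n::finite itself \<Rightarrow> (complex^'v \<Rightarrow> complex^'v \<Rightarrow> complex) \<Rightarrow> (complex^'v) set \<Rightarrow> nat \<Rightarrow> nat \<Rightarrow> bool" where
  "pseudo_kaehler_submanifold T h M k l \<longleftrightarrow>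
     complex_submanifold T M \<and>
     (\<forall>m\<in>M. nondegenerate_on (tangent_space M m) h \<and> has_signature (tangent_space M m) h k l)"

definition holomorphic_on_submanifold ::
  "'n::finite itself \<Rightarrow> (complex^'v) set \<Rightarrow> (complex^'v \<Rightarrow> complex^'w) \<Rightarrow> bool" where
  "holomorphic_on_submanifold T M f \<longleftrightarrow>
     (\<forall>(D, \<phi>)\<in>submanifold_charts T M. holomorphic_map_on (f \<circ> \<phi>) D)"

definition isomorphism_onto_image ::
  "'n::finite itself \<Rightarrow> (complex^'v) set \<Rightarrow> (complex^'v \<Rightarrow> complex^'w) \<Rightarrow> bool" where
  "isomorphism_onto_image T M f \<longleftrightarrow>
     complex_submanifold T (f ` M) \<and> inj_on f M \<and>
     holomorphic_on_submanifold T M f \<and> holomorphic_on_submanifold T (f ` M) (inv_into M f)"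

definition general_position ::
  "'n::finite itself \<Rightarrow> (complex^'v) set \<Rightarrow> (complex^'v) set \<Rightarrow> (complex^'v) set \<Rightarrow> bool" where
  "general_position T L L' M \<longleftrightarrow> isomorphism_onto_image T M (projection_along L L')"


section \<open>The holomorphic cotangent bundle\<close>

text \<open>Covectors are extended by zero outside the tangent space.\<close>

definition cotangent_space :: "(complex^'v) set \<Rightarrow> complex^'v \<Rightarrow> (complex^'v \<Rightarrow> complex) set" where
  "cotangent_space M m =
     {\<sigma>. (\<forall>u\<in>tangent_space M m. \<forall>v\<in>tangent_space M m. \<sigma> (u + v) = \<sigma> u + \<sigma> v) \<and>
         (\<forall>a. \<forall>u\<in>tangent_space M m. \<sigma> (a *s u) = a * \<sigma> u) \<and>
         (\<forall>u. u \<notin> tangent_space M m \<longrightarrow> \<sigma> u = 0)}"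

type_synonym 'v covector = "(complex^'v) \<times> (complex^'v \<Rightarrow> complex)"

definition cotangent_bundle :: "(complex^'v) set \<Rightarrow> 'v covector set" where
  "cotangent_bundle M = Sigma M (cotangent_space M)"

text \<open>A chart with coordinates \<open>z\<^sup>i\<close> on \<open>M\<close> induces coordinates \<open>(z\<^sup>i, w\<^sub>i)\<close> on the cotangent
  bundle, where \<open>w\<^sub>i\<close> is the value of the covector on the \<open>i\<close>-th coordinate vector; \<open>z\<^sup>i\<close> and
  \<open>w\<^sub>i\<close> are the components at \<open>Inl i\<close> and \<open>Inr i\<close>.\<close>

definition base_coord :: "complex^('n::finite + 'n) \<Rightarrow> complex^'n" where
  "base_coord x = (\<chi> i. x $ Inl i)"

definition fibre_coord :: "complex^('n::finite + 'n) \<Rightarrow> complex^'n" where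
  "fibre_coord x = (\<chi> i. x $ Inr i)"

definition cotangent_param ::
  "(complex^'v) set \<Rightarrow> (complex^'n::finite \<Rightarrow> complex^'v) \<Rightarrow> complex^('n + 'n) \<Rightarrow> 'v covector" where
  "cotangent_param M \<phi> x =
     (\<phi> (base_coord x),
      THE \<sigma>. \<sigma> \<in> cotangent_space M (\<phi> (base_coord x)) \<and>
             (\<forall>i. \<sigma> (deriv_at \<phi> (base_coord x) (axis i 1)) = fibre_coord x $ i))"

definition cotangent_atlas ::
  "'n::finite itself \<Rightarrow> (complex^'v) set \<Rightarrow> ('n + 'n, 'v covector) chart set" where
  "cotangent_atlas T M =
     (\<lambda>(D, \<phi>). ({x. base_coord x \<in> D}, cotangent_param M \<phi>)) ` submanifold_charts T M"

text \<open>The standard symplectic structure, \<open>\<Sum>i. dz\<^sup>i \<and> dw\<^sub>i\<close> in every induced chart.\<close>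

definition standard_symplectic :: "('n::finite + 'n, 'x) form_field" where
  "standard_symplectic c x u v = (\<Sum>i\<in>UNIV. u $ Inl i * v $ Inr i - u $ Inr i * v $ Inl i)"


section \<open>The potential\<close>

text \<open>\<open>sharp\<close> is the antilinear isomorphism from the dual of \<open>T\<close> to \<open>T\<close> given by the Hermitian
  form \<open>h\<close>, which is linear in the first argument.  In terms of a basis of \<open>T\<close>, the inverse
  metric is given by the inverse of the Gram matrix of \<open>h\<close>.\<close>

definition sharp ::
  "(complex^'v) set \<Rightarrow> (complex^'v \<Rightarrow> complex^'v \<Rightarrow> complex) \<Rightarrow> (complex^'v \<Rightarrow> complex) \<Rightarrow> complex^'v" where
  "sharp T h \<sigma> = (THE s. s \<in> T \<and> (\<forall>v\<in>T. \<sigma> v = h v s))"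

definition inverse_metric ::
  "(complex^'v) set \<Rightarrow> (complex^'v \<Rightarrow> complex^'v \<Rightarrow> complex) \<Rightarrow>
   (complex^'v \<Rightarrow> complex) \<Rightarrow> (complex^'v \<Rightarrow> complex) \<Rightarrow> complex" where
  "inverse_metric T h \<sigma> \<sigma>' = h (sharp T h \<sigma>') (sharp T h \<sigma>)"

text \<open>The canonical real structure on the tangent space \<open>T\<close>, extended by zero.\<close>

definition canonical_real_structure ::
  "(complex^'v \<Rightarrow> complex^'v) \<Rightarrow> (complex^'v) set \<Rightarrow> (complex^'v) set \<Rightarrow> complex^'v \<Rightarrow> complex^'v" where
  "canonical_real_structure p L\<^sub>0 T =
     (THE \<rho>. antilinear_involution_on T \<rho> \<and> p ` {v \<in> T. \<rho> v = v} = L\<^sub>0 \<and> (\<forall>v. v \<notin> T \<longrightarrow> \<rho> v = 0))"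

definition dual_real_structure ::
  "(complex^'v \<Rightarrow> complex^'v) \<Rightarrow> (complex^'v \<Rightarrow> complex) \<Rightarrow> complex^'v \<Rightarrow> complex" where
  "dual_real_structure \<rho> \<sigma> v = cnj (\<sigma> (\<rho> v))"

definition cotangent_potential ::
  "(complex^'v \<Rightarrow> complex^'v \<Rightarrow> complex) \<Rightarrow> (complex^'v \<Rightarrow> complex^'v) \<Rightarrow>
   (complex^'v) set \<Rightarrow> (complex^'v) set \<Rightarrow> (complex^'v) set \<Rightarrow> 'v covector \<Rightarrow> complex" where
  "cotangent_potential \<omega> \<tau> L\<^sub>0 L\<^sub>0' M = (\<lambda>(m, \<sigma>).
     let \<gamma> = gamma_form \<omega> \<tau>;
         p = projection_along (vec.span L\<^sub>0) (vec.span L\<^sub>0');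
         T = tangent_space M m;
         \<rho> = dual_real_structure (canonical_real_structure p L\<^sub>0 T)
     in \<gamma> m m + inverse_metric T \<gamma> (\<lambda>v. \<sigma> v + \<rho> \<sigma> v) (\<lambda>v. \<sigma> v + \<rho> \<sigma> v))"

end

theory Submission
  imports Defs "HOL-Complex_Analysis.Cauchy_Integral_Formula"
begin

text \<open>In Darboux coordinates \<open>(Q, P)\<close> adapted to the splitting, the tangent spaces of \<open>M\<close> are graphs
  \<open>P = S Q\<close> of symmetric matrices \<open>S = (F\<^sub>i\<^sub>j)\<close>, and \<open>\<gamma>|M\<close> has the real Gram matrix
  \<open>Y = \<i> (cnj S - S)\<close> in the frame \<open>q = Q|M\<close>.  Writing a covector as \<open>\<sigma> = \<eta> \<cdot> Q\<close> on the tangent space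
  and solving \<open>Y s = \<eta> + cnj \<eta>\<close> for the real vector \<open>s\<close>, the potential is
  \<open>K = \<gamma>(m, m) + (\<eta> + cnj \<eta>) \<cdot> s\<close>.  As \<open>Y\<close> and \<open>\<eta> + cnj \<eta>\<close> are pluriharmonic, its complex Hessian is
  \<open>G(u, v) = Y(\<partial>\<^sub>u q, \<partial>\<^sub>v q) + 2 Y(\<partial>\<^sub>u s, \<partial>\<^sub>v s)\<close>, while the symmetry of the third derivatives of \<open>F\<close> turns
  \<open>\<Omega> = \<Sum> dq \<and> d\<eta>\<close> into \<open>\<Omega>(u, v) = Y(\<partial>\<^sub>u q, cnj \<partial>\<^sub>v s) - Y(\<partial>\<^sub>u s, cnj \<partial>\<^sub>v q)\<close>.  Hence the matrix of \<open>G\<close> is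
  symplectic up to a constant factor, and differentiating this identity shows that \<open>\<Omega>\<close> is parallel for
  the connection \<open>G\<^sup>-\<^sup>1 \<partial>G\<close>.  All the functions involved are defined on the whole bundle, and \<open>\<eta>\<close>
  trivializes it globally, so no special charts are needed.\<close>

section \<open>Smooth functions\<close>

text \<open>The factor 2 in \<open>G\<close> is that of a quadratic form. Put t = \<eta> + cnj
  \<eta>. Since Y and t are pluriharmonic, the complex Hessian of t \<cdot> Y^-1 t is 2 Y^-1
  evaluated on \<partial>t - (\<partial>Y) s and its conjugate, and \<partial>t - (\<partial>Y) s =
  Y \<partial>s by differentiating Y s = t; as s is real, its antiholomorphic derivative is the
  conjugate of \<partial>s. The antilinear map matching \<open>G\<close> with \<open>Omega\<close>
  must then halve one of the two blocks. So it squares to -1/2, and the matrix of \<open>G\<close>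
  scales \<open>Omega\<close> by 2.

  A complex Hessian has symmetric third derivatives; hence G^-1 \<partial>G is torsion free and is
  the Levi-Civita connection. Being complex linear, it can be handled with holomorphic derivatives
  alone.

  In the Kaehler case q need not be injective on M, but its differential is bijective on each
  tangent space. This suffices: the claims reduce to linear algebra at a point once slope and
  momentum are known to be holomorphic in every chart, which follows from Cramer's rule.\<close>

lemma deriv_at_cong:
  assumes "open D" "z \<in> D" "\<And>x. x \<in> D \<Longrightarrow> f x = g x"
  shows "deriv_at f z = deriv_at g z"
proof -
  \<comment> \<open>\<open>frechet_derivative\<close> is a choice among the admissible derivatives,
    so it agrees for both functions as soon as the admissible derivatives do, even at points where
    there are none.\<close>
  have "(f has_derivative f') (at z) \<longleftrightarrow> (g has_derivative f') (at z)" for f'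
    using has_derivative_transform_within_open[of f f' z UNIV D g]
      has_derivative_transform_within_open[of g f' z UNIV D f] assms by auto
  then show ?thesis
    by (simp add: frechet_derivative_def)
qed

lemma differentiable_cong:
  assumes "open D" "z \<in> D" "\<And>x. x \<in> D \<Longrightarrow> f x = g x" "f differentiable (at z)"
  shows "g differentiable (at z)"
  using assms has_derivative_transform_within_open[of f _ z UNIV D g]
  unfolding differentiable_def by blast

lemma has_derivative_deriv_at: "f differentiable (at z) \<Longrightarrow> (f has_derivative deriv_at f z) (at z)"
  using frechet_derivative_works by blast

lemma deriv_at_eqI: "(f has_derivative f') (at z) \<Longrightarrow> deriv_at f z = f'"
  using frechet_derivative_at by metis

lemma Ck_on_cong:
  assumes "open D" "\<And>x. x \<in> D \<Longrightarrow> f x = g x" "Ck_on k f D"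
  shows "Ck_on k g D"
  using assms(2,3)
proof (induction k arbitrary: f g)
  case 0
  then show ?case by (simp cong: continuous_on_cong)
next
  case (Suc k)
  have "deriv_at f z = deriv_at g z" if "z \<in> D" for z
    using deriv_at_cong[OF assms(1) that] Suc by blast
  then show ?case
    using Suc.prems(2) differentiable_cong[OF assms(1) _ Suc.prems(1)]
      Suc.IH[of "\<lambda>z. deriv_at f z v" "\<lambda>z. deriv_at g z v" for v] by auto
qed

lemma Ck_on_SucD: "Ck_on (Suc k) f D \<Longrightarrow> Ck_on k f D"
proof (induction k arbitrary: f)
  case 0
  then show ?case
    by (simp add: continuous_at_imp_continuous_on differentiable_imp_continuous_within)
qed auto

text \<open>Lets the derivative be given by a formula known on \<open>D\<close> alone; the
  inductions for sums, products and inverses work with such formulas.\<close>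

lemma Ck_on_SucI:
  assumes "open D" "\<And>z. z \<in> D \<Longrightarrow> (f has_derivative f' z) (at z)"
    and "\<And>v. Ck_on k (\<lambda>z. f' z v) D"
  shows "Ck_on (Suc k) f D"
proof -
  have "f' z = deriv_at f z" if "z \<in> D" for z
    using deriv_at_eqI assms(2) that by metis
  then show ?thesis
    using assms(2) Ck_on_cong[OF assms(1) _ assms(3)]
    by (auto intro: differentiableI)
qed

lemma Ck_on_SucE:
  assumes "Ck_on (Suc k) f D" "z \<in> D"
  shows "(f has_derivative deriv_at f z) (at z)"
  using assms has_derivative_deriv_at by auto

lemma Ck_on_const: "open D \<Longrightarrow> Ck_on k (\<lambda>_. c) D"
proof (induction k arbitrary: c)
  case (Suc k)
  then show ?case
    by (intro Ck_on_SucI[where f' = "\<lambda>_ _. 0"]) auto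
qed auto

lemma Ck_on_add:
  assumes "open D"
  shows "Ck_on k f D \<Longrightarrow> Ck_on k g D \<Longrightarrow> Ck_on k (\<lambda>z. f z + g z) D"
proof (induction k arbitrary: f g)
  case (Suc k)
  show ?case
    by (rule Ck_on_SucI[OF assms, where f' = "\<lambda>z v. deriv_at f z v + deriv_at g z v"])
      (use Suc in \<open>auto intro!: has_derivative_add has_derivative_deriv_at\<close>)
qed (auto intro: continuous_intros)

lemma Ck_on_bounded_linear:
  assumes "open D" "bounded_linear h"
  shows "Ck_on k f D \<Longrightarrow> Ck_on k (\<lambda>z. h (f z)) D"
proof (induction k arbitrary: f)
  case 0
  then show ?case
    using assms(2) by (simp add: bounded_linear.continuous_on)
next
  case (Suc k)
  show ?case
    by (rule Ck_on_SucI[OF assms(1), where f' = "\<lambda>z v. h (deriv_at f z v)"])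
      (use Suc in \<open>auto intro!: bounded_linear.has_derivative[OF assms(2)] has_derivative_deriv_at\<close>)
qed

lemma Ck_on_mult:
  fixes f g :: "'a::real_normed_vector \<Rightarrow> 'b::real_normed_algebra"
  assumes "open D"
  shows "Ck_on k f D \<Longrightarrow> Ck_on k g D \<Longrightarrow> Ck_on k (\<lambda>z. f z * g z) D"
proof (induction k arbitrary: f g)
  case (Suc k)
  show ?case
    by (rule Ck_on_SucI[OF assms, where f' = "\<lambda>z v. f z * deriv_at g z v + deriv_at f z v * g z"])
      (use Suc Ck_on_SucD[OF Suc.prems(1)] Ck_on_SucD[OF Suc.prems(2)] in
        \<open>auto intro!: has_derivative_mult Ck_on_SucE Ck_on_add[OF assms]\<close>)
qed (auto intro: continuous_intros)

lemma Ck_on_inverse: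
  fixes f :: "'a::real_normed_vector \<Rightarrow> 'b::real_normed_field"
  assumes "open D" "\<And>z. z \<in> D \<Longrightarrow> f z \<noteq> 0"
  shows "Ck_on k f D \<Longrightarrow> Ck_on k (\<lambda>z. inverse (f z)) D"
proof (induction k)
  case 0
  then show ?case
    using assms(2) by (auto intro: continuous_intros)
next
  case (Suc k)
  have "Ck_on k (\<lambda>z. - (inverse (f z) * deriv_at f z v * inverse (f z))) D" for v
    using Suc Ck_on_SucD[OF Suc.prems]
    by (intro Ck_on_mult[OF assms(1)] Ck_on_bounded_linear[OF assms(1), of uminus])
      (auto intro: bounded_linear_minus[OF bounded_linear_ident])
  then show ?case
    by (intro Ck_on_SucI[OF assms(1), where f' = "\<lambda>z v.
      - (inverse (f z) * deriv_at f z v * inverse (f z))"]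
        Deriv.has_derivative_inverse Ck_on_SucE[OF Suc.prems])
      (auto simp: assms(2))
qed

lemma smooth_on_const [intro]: "open D \<Longrightarrow> smooth_on (\<lambda>_. c) D"
  by (simp add: smooth_on_def Ck_on_const)

lemma smooth_on_add: "open D \<Longrightarrow> smooth_on f D \<Longrightarrow> smooth_on g D \<Longrightarrow> smooth_on (\<lambda>z. f z + g z) D"
  by (simp add: smooth_on_def Ck_on_add)

lemma smooth_on_mult:
  fixes f g :: "'a::real_normed_vector \<Rightarrow> 'b::real_normed_algebra"
  shows "open D \<Longrightarrow> smooth_on f D \<Longrightarrow> smooth_on g D \<Longrightarrow> smooth_on (\<lambda>z. f z * g z) D"
  by (simp add: smooth_on_def Ck_on_mult)

lemma smooth_on_inverse:
  fixes f :: "'a::real_normed_vector \<Rightarrow> 'b::real_normed_field"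
  shows "open D \<Longrightarrow> smooth_on f D \<Longrightarrow> (\<And>z. z \<in> D \<Longrightarrow> f z \<noteq> 0) \<Longrightarrow> smooth_on (\<lambda>z. inverse (f z)) D"
  by (simp add: smooth_on_def Ck_on_inverse)

lemma smooth_on_bounded_linear:
  "open D \<Longrightarrow> bounded_linear h \<Longrightarrow> smooth_on f D \<Longrightarrow> smooth_on (\<lambda>z. h (f z)) D"
  by (simp add: smooth_on_def Ck_on_bounded_linear)

lemma smooth_on_cnj: "open D \<Longrightarrow> smooth_on f D \<Longrightarrow> smooth_on (\<lambda>z. cnj (f z)) D"
  using smooth_on_bounded_linear bounded_linear_cnj by blast

lemma smooth_on_minus: "open D \<Longrightarrow> smooth_on f D \<Longrightarrow> smooth_on (\<lambda>z. - f z) D"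
  using smooth_on_bounded_linear[of D uminus] bounded_linear_minus[OF bounded_linear_ident] by blast

lemma smooth_on_diff: "open D \<Longrightarrow> smooth_on f D \<Longrightarrow> smooth_on g D \<Longrightarrow> smooth_on (\<lambda>z. f z - g z) D"
  using smooth_on_add[of D f "\<lambda>z. - g z"] smooth_on_minus by auto

lemma smooth_on_sum:
  assumes "open D" "\<And>i. i \<in> I \<Longrightarrow> smooth_on (f i) D"
  shows "smooth_on (\<lambda>z. \<Sum>i\<in>I. f i z) D"
  using assms(2) by (induction I rule: infinite_finite_induct) (auto simp: assms(1) smooth_on_add)

lemma smooth_on_prod:
  fixes f :: "'i \<Rightarrow> 'a::real_normed_vector \<Rightarrow> 'b::{real_normed_algebra, comm_ring_1}"
  assumes "open D" "\<And>i. i \<in> I \<Longrightarrow> smooth_on (f i) D"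
  shows "smooth_on (\<lambda>z. \<Prod>i\<in>I. f i z) D"
  using assms(2) by (induction I rule: infinite_finite_induct) (auto simp: assms(1) smooth_on_mult)

lemma smooth_on_cong:
  "open D \<Longrightarrow> (\<And>x. x \<in> D \<Longrightarrow> f x = g x) \<Longrightarrow> smooth_on f D \<Longrightarrow> smooth_on g D"
  using Ck_on_cong unfolding smooth_on_def by blast

lemma smooth_on_differentiable: "smooth_on f D \<Longrightarrow> z \<in> D \<Longrightarrow> f differentiable (at z)"
  unfolding smooth_on_def by (metis Ck_on.simps(2))

lemma smooth_on_deriv_at: "smooth_on f D \<Longrightarrow> smooth_on (\<lambda>z. deriv_at f z v) D"
  unfolding smooth_on_def by (metis Ck_on.simps(2))

text \<open>The second difference is an increment, in direction \<open>u\<close>, of a first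
  difference in direction \<open>v\<close>. One mean value theorem in each direction turns it into a
  mixed derivative at an intermediate point.\<close>

lemma second_difference_mean_value:
  fixes f :: "'a::real_normed_vector \<Rightarrow> real"
  assumes h: "0 < h" and D: "\<And>s t. 0 \<le> s \<Longrightarrow> s \<le> h \<Longrightarrow> 0 \<le> t \<Longrightarrow> t \<le> h \<Longrightarrow> z + s *\<^sub>R u + t *\<^sub>R v \<in> D"
    and f: "\<And>x. x \<in> D \<Longrightarrow> f differentiable (at x)"
    and f': "\<And>x. x \<in> D \<Longrightarrow> (\<lambda>x. deriv_at f x u) differentiable (at x)"
  obtains s t where "0 < s" "s < h" "0 < t" "t < h"
    "f (z + h *\<^sub>R u + h *\<^sub>R v) - f (z + h *\<^sub>R u) - f (z + h *\<^sub>R v) + f z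
      = h * h * deriv_at (\<lambda>x. deriv_at f x u) (z + s *\<^sub>R u + t *\<^sub>R v) v"
proof -
  have lin: "deriv_at f x (c *\<^sub>R u) = c * deriv_at f x u" if "x \<in> D" for x c
    using has_derivative_linear[OF has_derivative_deriv_at[OF f[OF that]]] linear_cmul by fastforce
  have "((\<lambda>s. f (z + s *\<^sub>R u + t *\<^sub>R v)) has_real_derivative deriv_at f (z + s *\<^sub>R u
    + t *\<^sub>R v) u) (at s)"
    if "0 \<le> s" "s \<le> h" "0 \<le> t" "t \<le> h" for s t
  proof -
    note x = D[OF that]
    have "((\<lambda>s. f (z + s *\<^sub>R u + t *\<^sub>R v)) has_derivative
        (\<lambda>c. deriv_at f (z + s *\<^sub>R u + t *\<^sub>R v) (c *\<^sub>R u))) (at s)"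
      by (rule has_derivative_compose[where g = f]) 
        (auto intro!: derivative_eq_intros has_derivative_deriv_at f x)
    then show ?thesis
      by (simp add: lin[OF x] has_field_derivative_def mult.commute[of _ "deriv_at f _ u"]
        mult_commute_abs)
  qed
  note 1 = this
  \<comment> \<open>The term \<open>0 *\<^sub>R v\<close> is kept so that both summands are
    instances of \<open>1\<close>, and so that the second mean value theorem can start at t =
    0.\<close>
  let ?g = "\<lambda>s. f (z + s *\<^sub>R u + h *\<^sub>R v) - f (z + s *\<^sub>R u + 0 *\<^sub>R v)"
  have "\<exists>s>0. s < h \<and> ?g h - ?g 0 =
      (h - 0) * (deriv_at f (z + s *\<^sub>R u + h *\<^sub>R v) u - deriv_at f (z + s *\<^sub>R u + 0 *\<^sub>R v) u)"
    by (rule MVT2[OF h]) (use h in \<open>auto intro!: DERIV_diff 1[of _ h] 1[of _ 0, simplified]\<close>)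
  then obtain s where s: "0 < s" "s < h" "?g h - ?g 0 =
      h * (deriv_at f (z + s *\<^sub>R u + h *\<^sub>R v) u - deriv_at f (z + s *\<^sub>R u + 0 *\<^sub>R v) u)"
    by auto
  let ?d = "\<lambda>x. deriv_at f x u"
  have 2: "((\<lambda>t. ?d (z + s *\<^sub>R u + t *\<^sub>R v)) has_real_derivative deriv_at ?d (z + s *\<^sub>R u
    + t *\<^sub>R v) v) (at t)"
    if "0 \<le> t" "t \<le> h" for t
  proof -
    have x: "z + s *\<^sub>R u + t *\<^sub>R v \<in> D"
      using D s that by simp
    have "((\<lambda>t. ?d (z + s *\<^sub>R u + t *\<^sub>R v)) has_derivative
        (\<lambda>c. deriv_at ?d (z + s *\<^sub>R u + t *\<^sub>R v) (c *\<^sub>R v))) (at t)"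
      by (rule has_derivative_compose[where g = ?d])
        (auto intro!: derivative_eq_intros has_derivative_deriv_at f' x)
    moreover have "deriv_at ?d (z + s *\<^sub>R u + t *\<^sub>R v) (c *\<^sub>R v) = c * deriv_at ?d (z + s *\<^sub>R u
      + t *\<^sub>R v) v" for c
      using has_derivative_linear[OF has_derivative_deriv_at[OF f'[OF x]]] linear_cmul by fastforce
    ultimately show ?thesis
      by (simp add: has_field_derivative_def mult_commute_abs)
  qed
  have "\<exists>t>0. t < h \<and> ?d (z + s *\<^sub>R u + h *\<^sub>R v) - ?d (z + s *\<^sub>R u + 0 *\<^sub>R v)
      = (h - 0) * deriv_at ?d (z + s *\<^sub>R u + t *\<^sub>R v) v"
    by (rule MVT2[OF h]) (auto intro!: 2)
  then obtain t where "0 < t" "t < h" "?d (z + s *\<^sub>R u + h *\<^sub>R v) - ?d (z + s *\<^sub>R u + 0 *\<^sub>R v)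
      = h * deriv_at ?d (z + s *\<^sub>R u + t *\<^sub>R v) v"
    by auto
  with s show thesis
    by (intro that[of s t]) (auto simp: algebra_simps)
qed

text \<open>The second difference is symmetric in \<open>u\<close> and \<open>v\<close>. So the two
  mixed derivatives share a value at points arbitrarily close to \<open>z\<close>, and both are
  continuous there.\<close>

lemma second_deriv_at_symmetric_real:
  fixes f :: "'a::real_normed_vector \<Rightarrow> real"
  assumes "open D" "z \<in> D" "Ck_on 2 f D"
  shows "deriv_at (\<lambda>x. deriv_at f x u) z v = deriv_at (\<lambda>x. deriv_at f x v) z u"
proof -
  have f: "f differentiable (at x)" "(\<lambda>x. deriv_at f x w) differentiable (at x)" if "x \<in> D" for x w
    using assms(3) that by (auto simp: numeral_2_eq_2)
  define A where "A \<equiv> \<lambda>x. deriv_at (\<lambda>x. deriv_at f x u) x v"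
  define B where "B \<equiv> \<lambda>x. deriv_at (\<lambda>x. deriv_at f x v) x u"
  have cont: "isCont A z" "isCont B z"
    using assms unfolding A_def B_def by (auto simp: numeral_2_eq_2 continuous_on_eq_continuous_at)
  have less: "\<bar>A z - B z\<bar> < e" if "e > 0" for e
  proof -
    obtain d where d: "d > 0" "ball z d \<subseteq> D" "\<And>x. x \<in> ball z d \<Longrightarrow> \<bar>A x - A z\<bar> < e / 2"
      "\<And>x. x \<in> ball z d \<Longrightarrow> \<bar>B x - B z\<bar> < e / 2"
    proof -
      obtain d1 where "d1 > 0" "ball z d1 \<subseteq> D"
        using assms openE by blast
      moreover obtain d2 where "d2 > 0" "\<And>x. dist x z < d2 \<Longrightarrow> \<bar>A x - A z\<bar> < e / 2"
        using cont(1) \<open>e > 0\<close> unfolding continuous_at_eps_delta by (metis dist_real_def half_gt_zero)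
      moreover obtain d3 where "d3 > 0" "\<And>x. dist x z < d3 \<Longrightarrow> \<bar>B x - B z\<bar> < e / 2"
        using cont(2) \<open>e > 0\<close> unfolding continuous_at_eps_delta by (metis dist_real_def half_gt_zero)
      ultimately show thesis
        by (intro that[of "min d1 (min d2 d3)"]) (auto simp: dist_commute)
    qed
    \<comment> \<open>The parallelogram with sides h u and h v has to fit into the ball of radius
      \<open>d\<close>; the summand 1 covers the case u = v = 0.\<close>
    define h where "h = d / (2 * (norm u + norm v + 1))"
    have h: "h > 0"
      using d(1) by (simp add: h_def add_nonneg_pos)
    have bd: "z + s *\<^sub>R u + t *\<^sub>R v \<in> ball z d" if "0 \<le> s" "s \<le> h" "0 \<le> t" "t \<le> h" for s t
    proof -
      have "norm (s *\<^sub>R u + t *\<^sub>R v) \<le> s * norm u + t * norm v"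
        using norm_triangle_ineq[of "s *\<^sub>R u" "t *\<^sub>R v"] that by simp
      also have "\<dots> \<le> h * norm u + h * norm v"
        using that by (intro add_mono mult_right_mono) auto
      also have "\<dots> < h * (2 * (norm u + norm v + 1))"
        using h by (simp add: algebra_simps add_strict_increasing2 add_nonneg_pos)
      also have "\<dots> = d"
        using add_nonneg_nonneg[of "norm u" "norm v"] by (simp add: h_def del: add_nonneg_nonneg)
      finally show ?thesis
        unfolding mem_ball dist_commute[of z] by (simp add: dist_norm add.assoc)
    qed
    obtain s t where st: "0 < s" "s < h" "0 < t" "t < h"
      "f (z + h *\<^sub>R u + h *\<^sub>R v) - f (z + h *\<^sub>R u) - f (z + h *\<^sub>R v) + f z
        = h * h * A (z + s *\<^sub>R u + t *\<^sub>R v)"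
      unfolding A_def
      by (rule second_difference_mean_value[OF h, of z u v D f]) (use d(2) bd f in auto)
    have bd': "z + t *\<^sub>R v + s *\<^sub>R u \<in> ball z d" if "0 \<le> s" "s \<le> h" "0 \<le> t" "t \<le> h" for s t
      using bd[OF that] by (simp add: add.commute add.left_commute)
    obtain s' t' where st': "0 < s'" "s' < h" "0 < t'" "t' < h"
      "f (z + h *\<^sub>R v + h *\<^sub>R u) - f (z + h *\<^sub>R v) - f (z + h *\<^sub>R u) + f z
        = h * h * B (z + s' *\<^sub>R v + t' *\<^sub>R u)"
      unfolding B_def
      by (rule second_difference_mean_value[OF h, of z v u D f]) (use d(2) bd' f in auto)
    have "h * h * A (z + s *\<^sub>R u + t *\<^sub>R v) = h * h * B (z + s' *\<^sub>R v + t' *\<^sub>R u)"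
      using st(5) st'(5) unfolding add.assoc add.commute[of "h *\<^sub>R v"] by linarith
    then have "A (z + s *\<^sub>R u + t *\<^sub>R v) = B (z + s' *\<^sub>R v + t' *\<^sub>R u)"
      using h by simp
    moreover have "\<bar>A (z + s *\<^sub>R u + t *\<^sub>R v) - A z\<bar> < e / 2"
      using d(3) bd st by simp
    moreover have "\<bar>B (z + s' *\<^sub>R v + t' *\<^sub>R u) - B z\<bar> < e / 2"
      using d(4) bd' st' by simp
    ultimately show ?thesis
      by linarith
  qed
  have "A z = B z"
  proof (rule ccontr)
    assume "A z \<noteq> B z"
    then show False
      using less[of "\<bar>A z - B z\<bar>"] by simp
  qed
  then show ?thesis
    by (simp add: A_def B_def)
qed

lemma deriv_at_bounded_linear:
  assumes "bounded_linear h" "f differentiable (at z)"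
  shows "deriv_at (\<lambda>x. h (f x)) z v = h (deriv_at f z v)"
  using deriv_at_eqI[OF bounded_linear.has_derivative[OF assms(1) has_derivative_deriv_at[OF assms(2)]]]
  by simp

lemma second_deriv_at_symmetric:
  fixes f :: "'a::real_normed_vector \<Rightarrow> complex"
  assumes "open D" "z \<in> D" "smooth_on f D"
  shows "deriv_at (\<lambda>x. deriv_at f x u) z v = deriv_at (\<lambda>x. deriv_at f x v) z u"
proof -
  have *: "h (deriv_at (\<lambda>x. deriv_at f x u) z v) = deriv_at (\<lambda>x. deriv_at (\<lambda>x. h (f x)) x u) z v"
    if "bounded_linear h" for h :: "complex \<Rightarrow> real" and u v
  proof -
    have "deriv_at (\<lambda>x. deriv_at (\<lambda>x. h (f x)) x u) z = deriv_at (\<lambda>x. h (deriv_at f x u)) z"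
      by (rule deriv_at_cong[OF assms(1,2)])
        (use deriv_at_bounded_linear[OF that] smooth_on_differentiable[OF assms(3)] in auto)
    then show ?thesis
      using deriv_at_bounded_linear[OF that smooth_on_differentiable[OF smooth_on_deriv_at[OF
        assms(3)] assms(2)]]
      by simp
  qed
  have "Ck_on 2 (\<lambda>x. h (f x)) D" if "bounded_linear h" for h :: "complex \<Rightarrow> real"
    using smooth_on_bounded_linear[OF assms(1) that assms(3)] by (simp add: smooth_on_def)
  from this[THEN second_deriv_at_symmetric_real[OF assms(1,2)]] show ?thesis
    using * bounded_linear_Re bounded_linear_Im by (simp add: complex_eq_iff)
qed

section \<open>Holomorphic functions of several variables\<close>

lemma clinear_iff:
  fixes f :: "complex^'k \<Rightarrow> complex"
  shows "Vector_Spaces.linear (*s) (*) f \<longleftrightarrow>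
    (\<forall>u v. f (u + v) = f u + f v) \<and> (\<forall>c u. f (c *s u) = c * f u)"
proof -
  have "vector_space ((*) :: complex \<Rightarrow> complex \<Rightarrow> complex)"
    by unfold_locales (auto simp: algebra_simps)
  then show ?thesis
    using vec.vector_space_axioms by (auto simp: Vector_Spaces.linear_iff)
qed

lemma scaleR_eq_smult: "c *\<^sub>R (v :: complex^'k) = complex_of_real c *s v"
  by (simp add: vec_eq_iff flip: scaleR_conv_of_real)

lemma norm_smult: "norm (c *s (v :: complex^'k)) = cmod c * norm v"
  by (simp add: norm_vec_def L2_set_def norm_mult power_mult_distrib real_sqrt_mult flip:
    sum_distrib_left)

lemma bounded_linear_smult_left: "bounded_linear (\<lambda>c. c *s (v :: complex^'k))"
  by (rule bounded_linear_intro[of _ "norm v"])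
    (auto simp: vec_eq_iff algebra_simps norm_smult)

lemma holomorphic_fun_onI:
  assumes "\<And>z. z \<in> D \<Longrightarrow> (f has_derivative f' z) (at z)"
    and "\<And>z c u. z \<in> D \<Longrightarrow> f' z (c *s u) = c * f' z u"
  shows "holomorphic_fun_on f D"
  unfolding holomorphic_fun_on_def clinear_iff
proof
  fix z assume z: "z \<in> D"
  show "\<exists>f'. (f has_derivative f') (at z) \<and> (\<forall>u v. f' (u + v) = f' u + f' v) \<and> (\<forall>c u. f' (c *s u)
    = c * f' u)"
    using assms(1)[OF z] linear_add[OF has_derivative_linear[OF assms(1)[OF z]]] assms(2)[OF z]
    by (intro exI[of _ "f' z"]) simp
qed

lemma holomorphic_fun_on_deriv:
  assumes "holomorphic_fun_on f D" "z \<in> D"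
  shows "(f has_derivative deriv_at f z) (at z)"
    and "deriv_at f z (c *s u) = c * deriv_at f z u"
proof -
  obtain f' where f': "(f has_derivative f') (at z)" "Vector_Spaces.linear (*s) (*) f'"
    using assms unfolding holomorphic_fun_on_def by blast
  then have "deriv_at f z = f'"
    by (simp add: deriv_at_eqI)
  with f' show "(f has_derivative deriv_at f z) (at z)" "deriv_at f z (c *s u) = c * deriv_at f z u"
    by (auto simp: clinear_iff)
qed

lemma holomorphic_fun_on_differentiable:
  "holomorphic_fun_on f D \<Longrightarrow> z \<in> D \<Longrightarrow> f differentiable (at z)"
  by (rule differentiableI[OF holomorphic_fun_on_deriv(1)])

lemma holomorphic_fun_on_continuous: "holomorphic_fun_on f D \<Longrightarrow> continuous_on D f"
  by (intro continuous_at_imp_continuous_on ballI has_derivative_continuous[OF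
    holomorphic_fun_on_deriv(1)])

lemma holomorphic_fun_on_subset: "holomorphic_fun_on f D \<Longrightarrow> D' \<subseteq> D \<Longrightarrow> holomorphic_fun_on f D'"
  by (auto simp: holomorphic_fun_on_def)

lemma holomorphic_fun_on_const: "holomorphic_fun_on (\<lambda>_. c) D"
  by (rule holomorphic_fun_onI[where f' = "\<lambda>_ _. 0"]) auto

lemma holomorphic_fun_on_add:
  "holomorphic_fun_on f D \<Longrightarrow> holomorphic_fun_on g D \<Longrightarrow> holomorphic_fun_on (\<lambda>z. f z + g z) D"
  by (rule holomorphic_fun_onI[where f' = "\<lambda>z v. deriv_at f z v
    + deriv_at g z v"], rule Deriv.has_derivative_add)
    (auto simp: holomorphic_fun_on_deriv algebra_simps)

lemma holomorphic_fun_on_mult: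
  "holomorphic_fun_on f D \<Longrightarrow> holomorphic_fun_on g D \<Longrightarrow> holomorphic_fun_on (\<lambda>z. f z * g z) D"
  by (rule holomorphic_fun_onI[where f' = "\<lambda>z v. f z * deriv_at g z v
    + deriv_at f z v * g z"], rule Deriv.has_derivative_mult)
    (auto simp: holomorphic_fun_on_deriv algebra_simps)

lemma holomorphic_fun_on_inverse:
  "holomorphic_fun_on f D \<Longrightarrow> (\<And>z. z \<in> D \<Longrightarrow> f z \<noteq> 0) \<Longrightarrow> holomorphic_fun_on (\<lambda>z. inverse (f z)) D"
  by (rule holomorphic_fun_onI[where f' = "\<lambda>z v.
    - (inverse (f z) * deriv_at f z v * inverse (f z))"], rule Deriv.has_derivative_inverse)
    (auto simp: holomorphic_fun_on_deriv algebra_simps)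

lemma holomorphic_fun_on_sum:
  "(\<And>i. i \<in> I \<Longrightarrow> holomorphic_fun_on (f i) D) \<Longrightarrow> holomorphic_fun_on (\<lambda>z. \<Sum>i\<in>I. f i z) D"
  by (induction I rule: infinite_finite_induct)
    (auto simp: holomorphic_fun_on_const holomorphic_fun_on_add)

lemma holomorphic_fun_on_prod:
  "(\<And>i. i \<in> I \<Longrightarrow> holomorphic_fun_on (f i) D) \<Longrightarrow> holomorphic_fun_on (\<lambda>z. \<Prod>i\<in>I. f i z) D"
  by (induction I rule: infinite_finite_induct)
    (auto simp: holomorphic_fun_on_const holomorphic_fun_on_mult)

lemma holomorphic_fun_on_cong:
  assumes "open D" "\<And>z. z \<in> D \<Longrightarrow> f z = g z" "holomorphic_fun_on f D"
  shows "holomorphic_fun_on g D"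
proof (rule holomorphic_fun_onI)
  fix z assume z: "z \<in> D"
  show "(g has_derivative deriv_at f z) (at z)"
    using has_derivative_transform_within_open[OF holomorphic_fun_on_deriv(1)[OF assms(3) z]
      assms(1) z] assms(2)
    by auto
qed (use holomorphic_fun_on_deriv[OF assms(3)] in auto)

lemma has_derivative_vec_nth:
  fixes f :: "'a::real_normed_vector \<Rightarrow> 'b::euclidean_space^'k"
  shows "(f has_derivative f') (at z within S) \<longleftrightarrow>
    (\<forall>i. ((\<lambda>z. f z $ i) has_derivative (\<lambda>v. f' v $ i)) (at z within S))"
  unfolding has_derivative_componentwise_within[of f] has_derivative_componentwise_within[of "\<lambda>z. f
    z $ i" for i]
  by (auto simp: Basis_vec_def inner_axis)

lemma holomorphic_map_on_deriv:
  fixes f :: "complex^'k \<Rightarrow> complex^'m"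
  assumes "holomorphic_map_on f D" "z \<in> D"
  shows "(f has_derivative deriv_at f z) (at z)"
    and "deriv_at f z (c *s u) = c *s deriv_at f z u"
    and "deriv_at f z u $ i = deriv_at (\<lambda>z. f z $ i) z u"
proof -
  have h: "holomorphic_fun_on (\<lambda>z. f z $ i) D" for i
    using assms(1) by (simp add: holomorphic_map_on_def)
  have d: "(f has_derivative (\<lambda>v. \<chi> i. deriv_at (\<lambda>z. f z $ i) z v)) (at z)"
    using holomorphic_fun_on_deriv(1)[OF h assms(2)] by (subst has_derivative_vec_nth) simp
  then have e: "deriv_at f z = (\<lambda>v. \<chi> i. deriv_at (\<lambda>z. f z $ i) z v)"
    by (rule deriv_at_eqI)
  show "(f has_derivative deriv_at f z) (at z)"
    using d e by simp
  show "deriv_at f z u $ i = deriv_at (\<lambda>z. f z $ i) z u"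
    by (simp add: e)
  show "deriv_at f z (c *s u) = c *s deriv_at f z u"
    using holomorphic_fun_on_deriv(2)[OF h assms(2)] by (simp add: e vec_eq_iff)
qed

lemma holomorphic_fun_on_compose:
  fixes f :: "complex^'m \<Rightarrow> complex" and g :: "complex^'k \<Rightarrow> complex^'m"
  assumes "holomorphic_fun_on f D'" "holomorphic_map_on g D" "\<And>z. z \<in> D \<Longrightarrow> g z \<in> D'"
  shows "holomorphic_fun_on (\<lambda>z. f (g z)) D"
proof (rule holomorphic_fun_onI)
  show "((\<lambda>z. f (g z)) has_derivative (\<lambda>v. deriv_at f (g z) (deriv_at g z v))) (at z)" if "z \<in> D" for z
    by (rule has_derivative_compose[OF holomorphic_map_on_deriv(1)[OF assms(2) that]
          holomorphic_fun_on_deriv(1)[OF assms(1) assms(3)[OF that]]])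
qed (use assms in \<open>auto simp: holomorphic_map_on_deriv holomorphic_fun_on_deriv\<close>)

text \<open>Cauchy's formula for the derivative at 0 of the restriction of \<open>f\<close> to the
  complex line through \<open>z\<close> in direction \<open>v\<close>. The velocity of the circle
  cancels the constant and one of the two powers in the denominator; the integral over the unit
  interval can then be differentiated in \<open>z\<close>.\<close>

lemma deriv_at_Cauchy:
  fixes f :: "complex^'k \<Rightarrow> complex"
  assumes f: "holomorphic_fun_on f D" and "r > 0" and D: "\<And>\<zeta>. cmod \<zeta> \<le> r \<Longrightarrow> z + \<zeta> *s v \<in> D"
  shows "deriv_at f z v =
    integral {0..1} (\<lambda>t. f (z + circlepath 0 r t *s v) / circlepath 0 r t)"
proof -
  have z: "z \<in> D"
    using D[of 0] \<open>r > 0\<close> by simp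
  have line: "((\<lambda>\<zeta>. f (z + \<zeta> *s v)) has_field_derivative deriv_at f (z + \<zeta> *s v) v) (at \<zeta>)"
    if "cmod \<zeta> \<le> r" for \<zeta>
  proof -
    have "((\<lambda>\<zeta>. z + \<zeta> *s v) has_derivative (\<lambda>c. c *s v)) (at \<zeta>)"
      by (auto intro!: derivative_eq_intros bounded_linear.has_derivative[OF bounded_linear_smult_left])
    from has_derivative_compose[OF this holomorphic_fun_on_deriv(1)[OF f D[OF that]]]
    show ?thesis
      by (simp add: has_field_derivative_def holomorphic_fun_on_deriv(2)[OF f D[OF that]]
          mult_commute_abs)
  qed
  let ?g = "\<lambda>\<zeta>. f (z + \<zeta> *s v)"
  have 1: "continuous_on (cball 0 r) ?g"
    by (rule continuous_at_imp_continuous_on) (use DERIV_isCont[OF line] in auto)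
  have 2: "?g holomorphic_on ball 0 r"
  proof (rule holomorphic_onI)
    fix \<zeta> :: complex assume "\<zeta> \<in> ball 0 r"
    then have "?g field_differentiable (at \<zeta>)"
      using line[of \<zeta>] unfolding field_differentiable_def by auto
    then show "?g field_differentiable (at \<zeta> within ball 0 r)"
      by (rule field_differentiable_at_within)
  qed
  have "(?g has_field_derivative (1 / (2 * of_real pi * \<i>) *
      contour_integral (circlepath 0 r) (\<lambda>u. ?g u / (u - 0)^2))) (at 0)"
    by (rule Cauchy_derivative_integral_circlepath(2)[OF 1 2]) (use \<open>r > 0\<close> in simp)
  from DERIV_unique[OF line[of 0] this] \<open>r > 0\<close> have "deriv_at f z v =
      1 / (2 * of_real pi * \<i>) * contour_integral (circlepath 0 r) (\<lambda>u. ?g u / u^2)"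
    by simp
  also have "\<dots> = integral {0..1} (\<lambda>t. 1 / (2 * of_real pi * \<i>) *
      (?g (circlepath 0 r t) / (circlepath 0 r t)^2 * (2 * of_real pi * \<i> * circlepath 0 r t)))"
    unfolding contour_integral_integral vector_derivative_circlepath integral_mult_right
    by (simp add: circlepath algebra_simps)
  also have "(\<lambda>t. 1 / (2 * of_real pi * \<i>) *
      (?g (circlepath 0 r t) / (circlepath 0 r t)^2 * (2 * of_real pi * \<i> * circlepath 0 r t)))
    = (\<lambda>t. ?g (circlepath 0 r t) / circlepath 0 r t)"
    using \<open>r > 0\<close> by (simp add: fun_eq_iff power2_eq_square)
  finally show ?thesis .
qed

text \<open>One radius serves all base points of the half ball, so Cauchy's formula holds with a
  fixed circle in a neighbourhood of \<open>z0\<close>.\<close>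

lemma circle_translate_in_ball:
  fixes v :: "complex^'k"
  assumes "e > 0"
  obtains r where "r > 0" "\<And>\<zeta> z. cmod \<zeta> \<le> r \<Longrightarrow> z \<in> ball z0 (e / 2) \<Longrightarrow> z + \<zeta> *s v \<in> ball z0 e"
proof
  define r where "r = e / (2 * (norm v + 1))"
  have nv: "norm v + 1 > 0"
    by (simp add: add_nonneg_pos)
  with assms show "r > 0"
    by (simp add: r_def)
  show "z + \<zeta> *s v \<in> ball z0 e" if "cmod \<zeta> \<le> r" "z \<in> ball z0 (e / 2)" for \<zeta> z
  proof -
    have "norm (\<zeta> *s v) \<le> r * norm v"
      using that(1) by (simp add: norm_smult mult_right_mono)
    also have "\<dots> \<le> r * (norm v + 1)"
      using \<open>r > 0\<close> by simp
    also have "\<dots> = e / 2"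
      using nv by (simp add: r_def field_simps)
    finally have "norm (\<zeta> *s v) \<le> e / 2" .
    moreover have "dist z0 (z + \<zeta> *s v) \<le> dist z0 z + norm (\<zeta> *s v)"
      using dist_triangle[of z0 "z + \<zeta> *s v" z] by (simp add: dist_norm)
    ultimately show ?thesis
      using that(2) by simp
  qed
qed

lemma continuous_on_circle_quotient:
  fixes h :: "complex^'k \<Rightarrow> 'b::real_normed_field" and v :: "complex^'k"
  assumes "continuous_on D h" "r > 0" "\<And>\<zeta> z. cmod \<zeta> \<le> r \<Longrightarrow> z \<in> U \<Longrightarrow> z + \<zeta> *s v \<in> D"
  shows "continuous_on (U \<times> cbox 0 1) (\<lambda>(z, t). h (z + circlepath 0 r t *s v))"
proof -
  have "continuous_on (U \<times> cbox 0 1) (\<lambda>p. fst p + circlepath 0 r (snd p) *s v)"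
    unfolding circlepath
    by (intro continuous_intros bounded_linear.continuous_on[OF bounded_linear_smult_left])
  moreover have "(\<lambda>p. fst p + circlepath 0 r (snd p) *s v) ` (U \<times> cbox 0 1) \<subseteq> D"
    using assms(2) by (auto intro!: assms(3) simp: circlepath norm_mult)
  ultimately show ?thesis
    using continuous_on_compose2[OF assms(1)] by (auto simp: case_prod_beta)
qed

text \<open>Holomorphy is defined by a derivative at each point; its continuity comes from that of a
  parameter integral. The Leibniz rule used for the next lemma requires it.\<close>

lemma continuous_on_deriv_at_holomorphic:
  fixes f :: "complex^'k \<Rightarrow> complex"
  assumes "open D" "holomorphic_fun_on f D"
  shows "continuous_on D (\<lambda>z. deriv_at f z v)"
proof (rule continuous_at_imp_continuous_on, rule ballI)
  fix z0 assume "z0 \<in> D"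
  then obtain e where e: "e > 0" "ball z0 e \<subseteq> D"
    using assms(1) openE by blast
  obtain r where r: "r > 0" "\<And>\<zeta> z. cmod \<zeta> \<le> r \<Longrightarrow> z \<in> ball z0 (e / 2) \<Longrightarrow> z + \<zeta> *s v \<in> ball z0 e"
    using circle_translate_in_ball[OF e(1)] by metis
  let ?U = "ball z0 (e / 2)"
  have "continuous_on ?U (\<lambda>z. integral (cbox 0 1) (\<lambda>t. f (z
    + circlepath 0 r t *s v) / circlepath 0 r t))"
  proof (rule integral_continuous_on_param)
    have "continuous_on (?U \<times> cbox 0 1) (\<lambda>(z, t). f (z + circlepath 0 r t *s v))"
      by (rule continuous_on_circle_quotient[OF holomorphic_fun_on_continuous[OF assms(2)] r(1)])
        (use r e in auto)
    then show "continuous_on (?U \<times> cbox 0 1) (\<lambda>(z, t). f (z + circlepath 0 r t *s v) / circlepath 0 r t)"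
      using r(1) unfolding case_prod_beta circlepath by (auto intro!: continuous_intros)
  qed
  then have "continuous_on ?U (\<lambda>z. deriv_at f z v)"
  proof (rule continuous_on_eq)
    fix z assume "z \<in> ?U"
    then have "deriv_at f z v = integral (cbox 0 1) (\<lambda>t. f (z
      + circlepath 0 r t *s v) / circlepath 0 r t)"
      using deriv_at_Cauchy[OF assms(2) r(1), of z v] r(2) e(2) by (auto simp: subset_iff)
    then show "integral (cbox 0 1) (\<lambda>t. f (z + circlepath 0 r t *s v) / circlepath 0 r t)
      = deriv_at f z v"
      by (rule sym)
  qed
  then show "isCont (\<lambda>z. deriv_at f z v) z0"
    using e(1) by (simp add: continuous_on_eq_continuous_at)
qed

text \<open>By differentiation under the integral sign in Cauchy's formula.\<close>

lemma holomorphic_fun_on_deriv_at: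
  fixes f :: "complex^'k \<Rightarrow> complex"
  assumes "open D" "holomorphic_fun_on f D"
  shows "holomorphic_fun_on (\<lambda>z. deriv_at f z v) D"
  unfolding holomorphic_fun_on_def
proof
  fix z0 assume "z0 \<in> D"
  then obtain e where e: "e > 0" "ball z0 e \<subseteq> D"
    using assms(1) openE by blast
  obtain r where r: "r > 0" "\<And>\<zeta> z. cmod \<zeta> \<le> r \<Longrightarrow> z \<in> ball z0 (e / 2) \<Longrightarrow> z + \<zeta> *s v \<in> ball z0 e"
    using circle_translate_in_ball[OF e(1)] by metis
  let ?U = "ball z0 (e / 2)" and ?c = "circlepath 0 r"
  have D: "z + \<zeta> *s v \<in> D" if "z \<in> ?U" "cmod \<zeta> \<le> r" for z \<zeta>
    using r(2) that e(2) by blast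
  have c: "cmod (?c t) = r" for t
    using r(1) by (simp add: circlepath norm_mult)
  \<comment> \<open>The Leibniz rule asks for the derivative as a continuous map into bounded linear
    operators; in finite dimension continuity can be tested on each direction.\<close>
  define f' where "f' = (\<lambda>z. Blinfun (deriv_at f z))"
  have f': "blinfun_apply (f' z) = deriv_at f z" if "z \<in> D" for z
    unfolding f'_def
    by (rule bounded_linear_Blinfun_apply)
      (rule has_derivative_bounded_linear[OF holomorphic_fun_on_deriv(1)[OF assms(2) that]])
  have contf': "continuous_on D f'"
  proof (rule continuous_at_imp_continuous_on, rule ballI, rule continuous_blinfun_componentwiseI1)
    fix z i assume "z \<in> D"
    have "continuous_on D (\<lambda>x. blinfun_apply (f' x) i)"
      using continuous_on_deriv_at_holomorphic[OF assms, of i] f' by (simp cong: continuous_on_cong)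
    then show "isCont (\<lambda>x. blinfun_apply (f' x) i) z"
      using assms(1) \<open>z \<in> D\<close> by (simp add: continuous_on_eq_continuous_at)
  qed
  define F' where "F' = (\<lambda>z t. blinfun_mult_right (inverse (?c t)) o\<^sub>L f' (z + ?c t *s v))"
  have F': "blinfun_apply (F' z t) u = deriv_at f (z + ?c t *s v) u / ?c t" if "z \<in> ?U" for z t u
    unfolding F'_def using f'[OF D[OF that]] c[of t] by (simp add: field_simps)
  have contF': "continuous_on (?U \<times> cbox 0 1) (\<lambda>(z, t). F' z t)"
  proof -
    have "continuous_on (?U \<times> cbox 0 1) (\<lambda>p. fst p + ?c (snd p) *s v)"
      unfolding circlepath
      by (intro continuous_intros bounded_linear.continuous_on[OF bounded_linear_smult_left])
    moreover have "(\<lambda>p. fst p + ?c (snd p) *s v) ` (?U \<times> cbox 0 1) \<subseteq> D"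
      using c by (auto intro!: D)
    ultimately have "continuous_on (?U \<times> cbox 0 1) (\<lambda>p. f' (fst p + ?c (snd p) *s v))"
      using continuous_on_compose2[OF contf'] by blast
    then show ?thesis
      unfolding F'_def case_prod_beta using r(1)
      by (auto intro!: continuous_intros bounded_linear.continuous_on[OF
        bounded_linear_blinfun_mult_right]
          simp: circlepath)
  qed
  have z0: "z0 \<in> ?U"
    using e(1) by simp
  have der: "((\<lambda>z. integral (cbox 0 1) (\<lambda>t. f (z + ?c t *s v) / ?c t)) has_derivative
      integral (cbox 0 1) (F' z0)) (at z0 within ?U)"
  proof (rule leibniz_rule[OF _ _ contF' z0 convex_ball])
    fix z t assume zt: "z \<in> ?U" "t \<in> cbox 0 (1::real)"
    have "((\<lambda>z. f (z + ?c t *s v)) has_derivative deriv_at f (z + ?c t *s v)) (at z)"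
      by (rule has_derivative_compose[of "\<lambda>z. z + ?c t *s v" id _ _ f, simplified])
        (auto intro!: derivative_eq_intros holomorphic_fun_on_deriv(1)[OF assms(2)] D zt simp: c)
    then have "((\<lambda>z. f (z + ?c t *s v) / ?c t) has_derivative (\<lambda>u. deriv_at f (z
      + ?c t *s v) u / ?c t)) (at z)"
      using r(1) by (auto intro!: derivative_eq_intros simp: circlepath)
    then show "((\<lambda>z. f (z + ?c t *s v) / ?c t) has_derivative F' z t) (at z within ?U)"
      unfolding F'[OF zt(1), abs_def] by (rule has_derivative_at_withinI)
  next
    fix z assume z: "z \<in> ?U"
    have "continuous_on (cbox 0 1) (\<lambda>t. z + ?c t *s v)"
      unfolding circlepath
      by (intro continuous_intros bounded_linear.continuous_on[OF bounded_linear_smult_left])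
    then have "continuous_on (cbox 0 1) (\<lambda>t. f (z + ?c t *s v))"
      by (rule continuous_on_compose2[OF holomorphic_fun_on_continuous[OF assms(2)]])
        (use D[OF z] c in auto)
    then show "(\<lambda>t. f (z + ?c t *s v) / ?c t) integrable_on cbox 0 1"
      using r(1) by (intro integrable_continuous) (auto intro!: continuous_intros simp: circlepath)
  qed
  have "((\<lambda>z. deriv_at f z v) has_derivative integral (cbox 0 1) (F' z0)) (at z0)"
  proof (rule has_derivative_transform_within_open[of _ _ _ UNIV ?U])
    show "((\<lambda>z. integral (cbox 0 1) (\<lambda>t. f (z + ?c t *s v) / ?c t)) has_derivative
      integral (cbox 0 1) (F' z0)) (at z0)"
      using der at_within_open[OF z0 open_ball] by simp
  qed (use z0 deriv_at_Cauchy[OF assms(2) r(1) D] in auto)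
  \<comment> \<open>The integrand is complex linear in the direction, and this survives integration;
    hence the new derivative is that of a holomorphic function.\<close>
  moreover have "blinfun_apply (integral (cbox 0 1) (F' z0)) (a *s u)
      = a * blinfun_apply (integral (cbox 0 1) (F' z0)) u" for a u
  proof -
    have "continuous_on (cbox 0 1) (F' z0)"
      using continuous_on_compose2[OF contF', of "cbox 0 1" "\<lambda>t. (z0, t)"] z0
      by (auto simp: continuous_on_Pair image_subset_iff)
    then have int: "F' z0 integrable_on cbox 0 1"
      by (rule integrable_continuous)
    have "F' z0 t (a *s u) = a * F' z0 t u" for t
      unfolding F'[OF z0] using holomorphic_fun_on_deriv(2)[OF assms(2) D[OF z0, of "?c t"]] c by simp
    then show ?thesis
      unfolding blinfun_apply_integral[OF int] by simp
  qed
  ultimately show "\<exists>f'. ((\<lambda>z. deriv_at f z v) has_derivative f') (at z0)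
    \<and> Vector_Spaces.linear (*s) (*) f'"
    unfolding clinear_iff by (metis blinfun.add_right)
qed

lemma holomorphic_fun_on_Ck: "open D \<Longrightarrow> holomorphic_fun_on f D \<Longrightarrow> Ck_on k f D"
proof (induction k arbitrary: f)
  case 0
  then show ?case
    by (simp add: holomorphic_fun_on_continuous)
next
  case (Suc k)
  then show ?case
    using holomorphic_fun_on_differentiable[OF Suc.prems(2)] holomorphic_fun_on_deriv_at[OF
      Suc.prems] by simp
qed

lemma holomorphic_fun_on_smooth: "open D \<Longrightarrow> holomorphic_fun_on f D \<Longrightarrow> smooth_on f D"
  by (simp add: smooth_on_def holomorphic_fun_on_Ck)

section \<open>Determinants and linear systems with smooth or holomorphic coefficients\<close>

lemma smooth_on_det:
  fixes A :: "'a::real_normed_vector \<Rightarrow> complex^'n^'n"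
  assumes "open D" "\<And>i j. smooth_on (\<lambda>x. A x $ i $ j) D"
  shows "smooth_on (\<lambda>x. det (A x)) D"
  unfolding det_def
  by (intro smooth_on_sum smooth_on_mult smooth_on_prod smooth_on_const assms)

lemma holomorphic_fun_on_det:
  fixes A :: "complex^'k \<Rightarrow> complex^'n^'n"
  assumes "\<And>i j. holomorphic_fun_on (\<lambda>x. A x $ i $ j) D"
  shows "holomorphic_fun_on (\<lambda>x. det (A x)) D"
  unfolding det_def
  by (intro holomorphic_fun_on_sum holomorphic_fun_on_mult holomorphic_fun_on_prod
      holomorphic_fun_on_const assms)

text \<open>Cramer's rule exhibits the solution of a linear system as a rational function of its data.\<close>

definition linear_solve :: "complex^'n^'n \<Rightarrow> complex^'n \<Rightarrow> complex^'n" where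
  "linear_solve A b = (\<chi> k. det (\<chi> i j. if j = k then b $ i else A $ i $ j) * inverse (det A))"

lemma linear_solve: "det A \<noteq> 0 \<Longrightarrow> A *v x = b \<longleftrightarrow> x = linear_solve A b"
  unfolding linear_solve_def using cramer[of A x b] by (simp add: divide_inverse)

lemma smooth_on_linear_solve:
  fixes A :: "'a::real_normed_vector \<Rightarrow> complex^'n^'n"
  assumes "open D" "\<And>i j. smooth_on (\<lambda>x. A x $ i $ j) D" "\<And>i. smooth_on (\<lambda>x. b x $ i) D"
    and "\<And>x. x \<in> D \<Longrightarrow> det (A x) \<noteq> 0"
  shows "smooth_on (\<lambda>x. linear_solve (A x) (b x) $ k) D"
  unfolding linear_solve_def vec_lambda_beta
proof (intro smooth_on_mult smooth_on_inverse smooth_on_det assms)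
  show "smooth_on (\<lambda>x. (\<chi> i j. if j = k then b x $ i else A x $ i $ j) $ i $ j) D" for i j
    using assms by (cases "j = k") auto
qed

lemma holomorphic_fun_on_linear_solve:
  fixes A :: "complex^'k \<Rightarrow> complex^'n^'n"
  assumes "\<And>i j. holomorphic_fun_on (\<lambda>x. A x $ i $ j) D" "\<And>i. holomorphic_fun_on (\<lambda>x. b x $ i) D"
    and "\<And>x. x \<in> D \<Longrightarrow> det (A x) \<noteq> 0"
  shows "holomorphic_fun_on (\<lambda>x. linear_solve (A x) (b x) $ k) D"
  unfolding linear_solve_def vec_lambda_beta
proof (intro holomorphic_fun_on_mult holomorphic_fun_on_inverse holomorphic_fun_on_det assms)
  show "holomorphic_fun_on (\<lambda>x. (\<chi> i j. if j = k then b x $ i else A x $ i $ j) $ i $ j) D" for i j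
    using assms by (cases "j = k") auto
qed


section \<open>Wirtinger derivatives in arbitrary directions\<close>

text \<open>The complex linear and the antilinear part of the real derivative. Allowing every
  direction makes holomorphic changes of coordinates act by the chain rule, without sums over a
  basis.\<close>

definition wirt :: "(complex^'k \<Rightarrow> complex) \<Rightarrow> complex^'k \<Rightarrow> complex^'k \<Rightarrow> complex" where
  "wirt f z u = (deriv_at f z u - \<i> * deriv_at f z (\<i> *s u)) / 2"

definition wirt_bar :: "(complex^'k \<Rightarrow> complex) \<Rightarrow> complex^'k \<Rightarrow> complex^'k \<Rightarrow> complex" where
  "wirt_bar f z u = (deriv_at f z u + \<i> * deriv_at f z (\<i> *s u)) / 2"

lemma smult_axis: "c *s axis I d = (axis I (c * d) :: complex^'k)"
  by (simp add: vec_eq_iff axis_def)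

lemma wirtinger_eq_wirt: "wirtinger I f z = wirt f z (axis I 1)"
  by (simp add: wirtinger_def wirt_def smult_axis)

lemma wirtinger_bar_eq_wirt_bar: "wirtinger_bar I f z = wirt_bar f z (axis I 1)"
  by (simp add: wirtinger_bar_def wirt_bar_def smult_axis)

lemma deriv_at_eq_wirt: "deriv_at f z u = wirt f z u + wirt_bar f z u"
  by (simp add: wirt_def wirt_bar_def field_simps)

lemma wirt_cong: "open D \<Longrightarrow> z \<in> D \<Longrightarrow> (\<And>x. x \<in> D \<Longrightarrow> f x = g x) \<Longrightarrow> wirt f z = wirt g z"
  by (simp add: fun_eq_iff wirt_def deriv_at_cong[of D z f g])

lemma wirt_bar_cong: "open D \<Longrightarrow> z \<in> D \<Longrightarrow> (\<And>x. x \<in> D \<Longrightarrow> f x = g x) \<Longrightarrow> wirt_bar f z = wirt_bar g z"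
  by (simp add: fun_eq_iff wirt_bar_def deriv_at_cong[of D z f g])

lemma deriv_at_add:
  assumes "f differentiable (at z)" "g differentiable (at z)"
  shows "deriv_at (\<lambda>x. f x + g x) z u = deriv_at f z u + deriv_at g z u"
  using deriv_at_eqI[OF has_derivative_add[OF assms[THEN has_derivative_deriv_at]]] by simp

lemma deriv_at_mult:
  fixes f g :: "'a::real_normed_vector \<Rightarrow> complex"
  assumes "f differentiable (at z)" "g differentiable (at z)"
  shows "deriv_at (\<lambda>x. f x * g x) z u = f z * deriv_at g z u + deriv_at f z u * g z"
  using deriv_at_eqI[OF has_derivative_mult[OF assms[THEN has_derivative_deriv_at]]] by simp

lemma deriv_at_cnj: "f differentiable (at z) \<Longrightarrow> deriv_at (\<lambda>x. cnj (f x)) z u = cnj (deriv_at f z u)"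
  by (rule deriv_at_bounded_linear[OF bounded_linear_cnj])

lemma differentiable_cnj: "f differentiable (at z) \<Longrightarrow> (\<lambda>x. cnj (f x)) differentiable (at z)"
  unfolding differentiable_def using bounded_linear.has_derivative[OF bounded_linear_cnj] by blast

lemma wirt_const: "wirt (\<lambda>_. c) z u = 0" "wirt_bar (\<lambda>_. c) z u = 0"
  by (simp_all add: wirt_def wirt_bar_def)

lemma wirt_add:
  assumes "f differentiable (at z)" "g differentiable (at z)"
  shows "wirt (\<lambda>x. f x + g x) z u = wirt f z u + wirt g z u"
    and "wirt_bar (\<lambda>x. f x + g x) z u = wirt_bar f z u + wirt_bar g z u"
  using assms by (simp_all add: wirt_def wirt_bar_def deriv_at_add field_simps)

lemma wirt_mult:
  assumes "f differentiable (at z)" "g differentiable (at z)"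
  shows "wirt (\<lambda>x. f x * g x) z u = f z * wirt g z u + wirt f z u * g z"
    and "wirt_bar (\<lambda>x. f x * g x) z u = f z * wirt_bar g z u + wirt_bar f z u * g z"
  using assms by (simp_all add: wirt_def wirt_bar_def deriv_at_mult field_simps)

lemma wirt_cnj:
  assumes "f differentiable (at z)"
  shows "wirt (\<lambda>x. cnj (f x)) z u = cnj (wirt_bar f z u)"
    and "wirt_bar (\<lambda>x. cnj (f x)) z u = cnj (wirt f z u)"
  using assms by (simp_all add: wirt_def wirt_bar_def deriv_at_cnj)

lemma wirt_cmult:
  assumes "f differentiable (at z)"
  shows "wirt (\<lambda>x. c * f x) z u = c * wirt f z u" "wirt_bar (\<lambda>x. c * f x) z u = c * wirt_bar f z u"
  using wirt_mult[of "\<lambda>_. c" z f u] assms by (simp_all add: wirt_const)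

lemma wirt_minus:
  assumes "f differentiable (at z)"
  shows "wirt (\<lambda>x. - f x) z u = - wirt f z u" "wirt_bar (\<lambda>x. - f x) z u = - wirt_bar f z u"
  using wirt_cmult[OF assms, of "-1" u] by simp_all

lemma wirt_diff:
  assumes "f differentiable (at z)" "g differentiable (at z)"
  shows "wirt (\<lambda>x. f x - g x) z u = wirt f z u - wirt g z u"
    and "wirt_bar (\<lambda>x. f x - g x) z u = wirt_bar f z u - wirt_bar g z u"
  using wirt_add[of f z "\<lambda>x. - g x" u] assms by (simp_all add: wirt_minus)

lemma wirt_sum:
  assumes "\<And>i. i \<in> I \<Longrightarrow> f i differentiable (at z)"
  shows "wirt (\<lambda>x. \<Sum>i\<in>I. f i x) z u = (\<Sum>i\<in>I. wirt (f i) z u)"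
    and "wirt_bar (\<lambda>x. \<Sum>i\<in>I. f i x) z u = (\<Sum>i\<in>I. wirt_bar (f i) z u)"
  using assms by (induction I rule: infinite_finite_induct)
    (simp_all add: wirt_const wirt_add differentiable_sum)

lemma wirt_holomorphic:
  assumes "holomorphic_fun_on f D" "z \<in> D"
  shows "wirt f z u = deriv_at f z u" "wirt_bar f z u = 0"
  using holomorphic_fun_on_deriv(2)[OF assms, of \<i> u] by (simp_all add: wirt_def wirt_bar_def)

lemma deriv_at_linear:
  assumes "f differentiable (at z)"
  shows "deriv_at f z (u + v) = deriv_at f z u + deriv_at f z v"
    and "deriv_at f z (c *\<^sub>R u) = c *\<^sub>R deriv_at f z u"
  using linear_add[OF has_derivative_linear[OF has_derivative_deriv_at[OF assms]]]
    linear_cmul[OF has_derivative_linear[OF has_derivative_deriv_at[OF assms]]] by simp_all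

lemma deriv_at_smult:
  fixes f :: "complex^'k \<Rightarrow> complex"
  assumes "f differentiable (at z)"
  shows "deriv_at f z (c *s u) = Re c * deriv_at f z u + Im c * deriv_at f z (\<i> *s u)"
proof -
  have "c *s u = Re c *\<^sub>R u + Im c *\<^sub>R (\<i> *s u)"
    by (simp add: vec_eq_iff complex_eq_iff)
  then have "deriv_at f z (c *s u) = Re c *\<^sub>R deriv_at f z u + Im c *\<^sub>R deriv_at f z (\<i> *s u)"
    by (simp only: deriv_at_linear[OF assms])
  then show ?thesis
    by (simp add: scaleR_conv_of_real)
qed

lemma wirt_linear:
  assumes "f differentiable (at z)"
  shows "wirt f z (u + v) = wirt f z u + wirt f z v" "wirt f z (c *s u) = c * wirt f z u"
    and "wirt_bar f z (u + v) = wirt_bar f z u + wirt_bar f z v"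
    and "wirt_bar f z (c *s u) = cnj c * wirt_bar f z u"
proof -
  have i: "\<i> *s (c *s u) = (\<i> * c) *s u"
    by simp
  show "wirt f z (u + v) = wirt f z u + wirt f z v"
    "wirt_bar f z (u + v) = wirt_bar f z u + wirt_bar f z v"
    using assms by (simp_all add: wirt_def wirt_bar_def vec.scale_right_distrib deriv_at_linear
      field_simps)
  show "wirt f z (c *s u) = c * wirt f z u" "wirt_bar f z (c *s u) = cnj c * wirt_bar f z u"
    unfolding wirt_def wirt_bar_def i deriv_at_smult[OF assms, of c] deriv_at_smult[OF assms, of "\<i> * c"]
    by (simp_all add: complex_eq_iff algebra_simps)
qed

lemma smooth_on_wirt:
  assumes "open D" "smooth_on f D"
  shows "smooth_on (\<lambda>z. wirt f z u) D" "smooth_on (\<lambda>z. wirt_bar f z u) D"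
  unfolding wirt_def wirt_bar_def divide_inverse
  by (intro smooth_on_mult smooth_on_diff smooth_on_add smooth_on_const smooth_on_deriv_at assms)+

text \<open>Both sides expand into real second derivatives, which commute. As \<open>f\<close> is
  merely smooth, this applies to derivatives of the potential as well as to holomorphic
  functions.\<close>

lemma wirt_commute:
  assumes "open D" "smooth_on f D" "z \<in> D"
  shows "wirt (\<lambda>x. wirt f x u) z v = wirt (\<lambda>x. wirt f x v) z u"
proof -
  have d: "(\<lambda>x. deriv_at f x w) differentiable (at z)" for w
    using smooth_on_differentiable[OF smooth_on_deriv_at[OF assms(2)] assms(3)] .
  have *: "wirt (\<lambda>x. wirt f x u) z v =
     1 / 2 * (wirt (\<lambda>x. deriv_at f x u) z v - \<i> * wirt (\<lambda>x. deriv_at f x (\<i> *s u)) z v)" for u v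
  proof -
    have "(\<lambda>x. wirt f x u) = (\<lambda>x. 1 / 2 * (deriv_at f x u - \<i> * deriv_at f x (\<i> *s u)))"
      by (simp add: wirt_def)
    moreover have "wirt (\<lambda>x. 1 / 2 * (deriv_at f x u - \<i> * deriv_at f x (\<i> *s u))) z v
        = 1 / 2 * wirt (\<lambda>x. deriv_at f x u - \<i> * deriv_at f x (\<i> *s u)) z v"
      by (rule wirt_cmult) (intro derivative_intros d)
    moreover have "wirt (\<lambda>x. deriv_at f x u - \<i> * deriv_at f x (\<i> *s u)) z v
        = wirt (\<lambda>x. deriv_at f x u) z v - wirt (\<lambda>x. \<i> * deriv_at f x (\<i> *s u)) z v"
      by (rule wirt_diff) (intro derivative_intros d)+
    ultimately show ?thesis
      by (simp only: wirt_cmult[OF d])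
  qed
  have 1: "wirt (\<lambda>x. deriv_at f x u) z v =
      (deriv_at (\<lambda>x. deriv_at f x u) z v - \<i> * deriv_at (\<lambda>x. deriv_at f x u) z (\<i> *s v)) / 2" for u v
    by (rule wirt_def)
  show ?thesis
    unfolding *[of u v] *[of v u] 1
    by (simp add: second_deriv_at_symmetric[OF assms(1,3,2), of u] 
        second_deriv_at_symmetric[OF assms(1,3,2), of "\<i> *s u"] field_simps)
qed

section \<open>Darboux coordinates adapted to a Lagrangean splitting\<close>

definition cdot :: "complex^'n \<Rightarrow> complex^'n \<Rightarrow> complex" (infixl "\<odot>" 70) where
  "a \<odot> b = (\<Sum>i\<in>UNIV. a $ i * b $ i)"

definition cvec :: "complex^'n \<Rightarrow> complex^'n" where
  "cvec a = (\<chi> i. cnj (a $ i))"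

lemma cdot_linear [simp]:
  "(a + b) \<odot> c = a \<odot> c + b \<odot> c" "a \<odot> (b + c) = a \<odot> b + a \<odot> c"
  "(a - b) \<odot> c = a \<odot> c - b \<odot> c" "a \<odot> (b - c) = a \<odot> b - a \<odot> c"
  "(k *s a) \<odot> b = k * (a \<odot> b)" "a \<odot> (k *s b) = k * (a \<odot> b)"
  "(- a) \<odot> b = - (a \<odot> b)" "a \<odot> (- b) = - (a \<odot> b)"
  "0 \<odot> b = 0" "a \<odot> 0 = 0"
  by (simp_all add: cdot_def algebra_simps sum.distrib sum_subtractf sum_distrib_left sum_negf)

lemma cdot_commute: "a \<odot> b = b \<odot> a"
  by (simp add: cdot_def mult.commute)

lemma cdot_axis [simp]: "a \<odot> axis i 1 = a $ i" "axis i 1 \<odot> a = a $ i"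
  by (simp_all add: cdot_def axis_def if_distrib[of "\<lambda>x. _ * x"] if_distrib[of "\<lambda>x. x * _"] cong:
    if_cong)

lemma cdot_eqI: "(\<And>c. a \<odot> c = b \<odot> c) \<Longrightarrow> a = b"
  by (metis cdot_axis(1) vec_eq_iff)

lemma cvec_linear [simp]:
  "cvec (a + b) = cvec a + cvec b" "cvec (a - b) = cvec a - cvec b" "cvec (k *s a) = cnj k *s cvec a"
  "cvec (- a) = - cvec a" "cvec 0 = 0" "cvec (cvec a) = a" "cvec a $ i = cnj (a $ i)"
  "cvec (axis i 1) = axis i 1"
  by (simp_all add: cvec_def vec_eq_iff axis_def)

lemma cvec_eq_0_iff [simp]: "cvec a = 0 \<longleftrightarrow> a = 0"
  by (metis cvec_linear(5,6))

lemma cnj_cdot: "cnj (a \<odot> b) = cvec a \<odot> cvec b"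
  by (simp add: cdot_def)

lemma cdot_matrix: "(A *v a) \<odot> b = a \<odot> (transpose A *v b)"
proof -
  have "(A *v a) \<odot> b = (\<Sum>i\<in>UNIV. \<Sum>j\<in>UNIV. A $ i $ j * a $ j * b $ i)"
    by (simp add: cdot_def matrix_vector_mult_def sum_distrib_right)
  also have "\<dots> = (\<Sum>j\<in>UNIV. \<Sum>i\<in>UNIV. A $ i $ j * a $ j * b $ i)"
    by (rule sum.swap)
  also have "\<dots> = a \<odot> (transpose A *v b)"
    by (simp add: cdot_def matrix_vector_mult_def transpose_def sum_distrib_left ac_simps)
  finally show ?thesis .
qed

text \<open>This is the matrix \<open>g\<^sub>i\<^sub>j\<close> when \<open>A\<close> is the matrix \<open>F\<^sub>i\<^sub>j\<close>.\<close>

definition imaginary_part :: "complex^'n^'n \<Rightarrow> complex^'n^'n" where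
  "imaginary_part A = (\<chi> i j. \<i> * (cnj (A $ i $ j) - A $ i $ j))"

text \<open>The left-hand side is the Hermitian form \<gamma> on the vectors (a, A a) and (b, A b)
  of the graph of \<open>A\<close> in Darboux coordinates. Symmetry of \<open>A\<close> moves it to
  the other factor.\<close>

lemma imaginary_part_apply:
  assumes "\<And>i j. A $ i $ j = A $ j $ i"
  shows "\<i> * (a \<odot> cvec (A *v b) - (A *v a) \<odot> cvec b) = a \<odot> (imaginary_part A *v cvec b)"
proof -
  have "transpose A = A"
    using assms by (simp add: vec_eq_iff transpose_def)
  then have "\<i> * (a \<odot> cvec (A *v b) - (A *v a) \<odot> cvec b) = \<i> * (a \<odot> (cvec (A *v b) - A *v cvec b))"
    using cdot_matrix[of A] by simp
  also have "\<dots> = a \<odot> (\<i> *s (cvec (A *v b) - A *v cvec b))"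
    by (simp only: cdot_linear)
  also have "\<i> *s (cvec (A *v b) - A *v cvec b) = imaginary_part A *v cvec b"
    by (simp add: vec_eq_iff imaginary_part_def matrix_vector_mult_def sum_distrib_left
      sum_subtractf algebra_simps)
  finally show ?thesis .
qed

text \<open>Isolates the choice of a basis: everything later sees the algebraic data through two
  linear maps that are real for \<open>\<tau>\<close>, with L' = ker Q and L = ker P.\<close>

locale darboux =
  fixes \<omega> :: "complex^'v \<Rightarrow> complex^'v \<Rightarrow> complex" and \<tau> :: "complex^'v \<Rightarrow> complex^'v"
    and L\<^sub>0 L\<^sub>0' :: "(complex^'v) set" and Q P :: "complex^'v \<Rightarrow> complex^'n"
  assumes Q_add [simp]: "Q (u + v) = Q u + Q v" and Q_smult [simp]: "Q (c *s u) = c *s Q u"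
    and P_add [simp]: "P (u + v) = P u + P v" and P_smult [simp]: "P (c *s u) = c *s P u"
    and Q_\<tau> [simp]: "Q (\<tau> u) = cvec (Q u)" and P_\<tau> [simp]: "P (\<tau> u) = cvec (P u)"
    and omega_eq: "\<omega> u v = Q u \<odot> P v - P u \<odot> Q v"
    and QP_inj: "Q u = Q v \<Longrightarrow> P u = P v \<Longrightarrow> u = v"
    and QP_surj: "\<exists>u. Q u = a \<and> P u = b"
    and L0_eq: "L\<^sub>0 = {u. \<tau> u = u \<and> P u = 0}"
    and span_L0: "vec.span L\<^sub>0 = {u. P u = 0}" and span_L0': "vec.span L\<^sub>0' = {u. Q u = 0}"

section \<open>Existence of adapted Darboux coordinates\<close>

lemma clinear_vec_iff:
  fixes f :: "complex^'k \<Rightarrow> complex^'m"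
  shows "Vector_Spaces.linear (*s) (*s) f \<longleftrightarrow>
    (\<forall>u v. f (u + v) = f u + f v) \<and> (\<forall>c u. f (c *s u) = c *s f u)"
proof -
  have "vector_space ((*s) :: complex \<Rightarrow> complex^'k \<Rightarrow> _)"
    "vector_space ((*s) :: complex \<Rightarrow> complex^'m \<Rightarrow> _)"
    by (rule vec.vector_space_axioms)+
  then show ?thesis
    by (simp add: Vector_Spaces.linear_iff)
qed

text \<open>Pairing with the members of \<open>B\<close> is injective on \<open>W\<close> and has
  card B components. Applied to the two halves of the splitting, it bounds the dimension of each by
  that of the other.\<close>

lemma dim_le_card_of_annihilator:
  fixes \<omega> :: "complex^'v \<Rightarrow> complex^'v \<Rightarrow> complex"
  assumes B: "vec.independent B" and lin: "complex_bilinear \<omega>"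
    and W: "vec.subspace W" "\<And>w. w \<in> W \<Longrightarrow> (\<And>b. b \<in> B \<Longrightarrow> \<omega> b w = 0) \<Longrightarrow> w = 0"
  shows "vec.dim W \<le> card B"
proof -
  have fin: "finite B"
    using B vec.finiteI_independent by blast
  have "card B \<le> vec.dim (UNIV :: (complex^'v) set)"
    using B vec.independent_card_le_dim by blast
  then have "card B \<le> CARD('v)"
    by (simp only: vec_dim_card)
  \<comment> \<open>The components indexed by \<open>B\<close> are placed at distinct coordinates of
    complex^'v, so that the pairing map stays within one type.\<close>
  then obtain e where e: "e ` B \<subseteq> (UNIV :: 'v set)" "inj_on e B"
    using card_le_inj[OF fin finite_class.finite_UNIV] by blast
  define f where "f w = (\<Sum>b\<in>B. \<omega> b w *s axis (e b) 1)" for w :: "complex^'v"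
  have f_nth: "f w $ e b = \<omega> b w" if "b \<in> B" for w b
  proof -
    have "f w $ e b = (\<Sum>c\<in>B. if c = b then \<omega> c w else 0)"
      unfolding f_def sum_component
      by (rule sum.cong) (use that e(2) in \<open>auto simp: axis_def inj_on_eq_iff\<close>)
    then show ?thesis
      using that fin by simp
  qed
  have add: "\<omega> b (v + w) = \<omega> b v + \<omega> b w" "\<omega> b (c *s w) = c * \<omega> b w" for b v w c
    using lin by (auto simp: complex_bilinear_def clinear_iff)
  have linf: "Vector_Spaces.linear (*s) (*s) f"
    by (simp add: clinear_vec_iff f_def add vec.scale_sum_right vec.scale_left_distrib sum.distrib)
  have "f w = 0 \<Longrightarrow> w = 0" if "w \<in> W" for w
    using W(2)[OF that] f_nth by (metis zero_index)
  then have inj: "inj_on f (vec.span W)"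
    using W(1) linf by (simp add: vec.linear_inj_on_iff_eq_0 vec.span_eq_iff[THEN iffD2]
      vec.subspace_span)
  have "vec.dim W = vec.dim (f ` W)"
    by (rule vec.dim_image_eq[OF linf inj, symmetric])
  also have "f ` W \<subseteq> vec.span ((\<lambda>b. axis (e b) 1) ` B)"
    by (auto simp: f_def intro!: vec.span_sum intro: vec.span_scale vec.span_base)
  then have "vec.dim (f ` W) \<le> card ((\<lambda>b. axis (e b) (1::complex)) ` B)"
    by (rule vec.dim_le_card) (simp add: fin)
  also have "\<dots> \<le> card B"
    by (rule card_image_le[OF fin])
  finally show ?thesis .
qed

context
  fixes \<omega> :: "complex^'v \<Rightarrow> complex^'v \<Rightarrow> complex" and \<tau> :: "complex^'v \<Rightarrow> complex^'v"
  assumes fd: "fundamental_data \<omega> \<tau>"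
begin

private lemma \<omega>_bil: "complex_bilinear \<omega>"
  using fd by (simp add: fundamental_data_def complex_symplectic_form_def)

private lemma \<omega>_linear:
  "\<omega> (u + v) w = \<omega> u w + \<omega> v w" "\<omega> (c *s u) w = c * \<omega> u w"
  "\<omega> w (u + v) = \<omega> w u + \<omega> w v" "\<omega> w (c *s u) = c * \<omega> w u"
  using \<omega>_bil by (auto simp: complex_bilinear_def clinear_iff)

private lemma \<omega>_skew: "\<omega> u v = - \<omega> v u"
proof -
  have alt: "\<omega> u u = 0" for u
    using fd by (simp add: fundamental_data_def complex_symplectic_form_def)
  have "0 = \<omega> (u + v) (u + v)"
    by (simp add: alt)
  also have "\<dots> = \<omega> u v + \<omega> v u"
    unfolding \<omega>_linear by (simp add: alt)
  finally show ?thesis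
    by (simp add: eq_neg_iff_add_eq_0)
qed

private lemma \<omega>_nondegenerate: "(\<And>v. \<omega> u v = 0) \<Longrightarrow> u = 0"
  using fd by (simp add: fundamental_data_def complex_symplectic_form_def nondegenerate_on_def)

private lemma \<tau>_linear: "\<tau> (u + v) = \<tau> u + \<tau> v" "\<tau> (c *s u) = cnj c *s \<tau> u" "\<tau> (\<tau> u) = u"
  using fd by (auto simp: fundamental_data_def antilinear_involution_on_def)

private lemma real_imaginary_parts:
  obtains a b where "\<tau> a = a" "\<tau> b = b" "u = a + \<i> *s b" "\<tau> u = a - \<i> *s b"
proof
  let ?a = "(1/2) *s (u + \<tau> u)" and ?b = "(-\<i>/2) *s u + (\<i>/2) *s \<tau> u"
  show "\<tau> ?a = ?a" "\<tau> ?b = ?b"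
    by (simp_all only: \<tau>_linear) (simp_all add: vec_eq_iff)
  show "u = ?a + \<i> *s ?b" "\<tau> u = ?a - \<i> *s ?b"
    by (simp_all add: vec_eq_iff field_simps)
qed

text \<open>The form is real on the fixed points; splitting both vectors into such real and
  imaginary parts extends this to a conjugation rule.\<close>

private lemma \<omega>_\<tau>: "\<omega> (\<tau> u) (\<tau> v) = cnj (\<omega> u v)"
proof -
  obtain a b where ab: "\<tau> a = a" "\<tau> b = b" "u = a + \<i> *s b" "\<tau> u = a - \<i> *s b"
    using real_imaginary_parts .
  obtain c d where cd: "\<tau> c = c" "\<tau> d = d" "v = c + \<i> *s d" "\<tau> v = c - \<i> *s d"
    using real_imaginary_parts .
  have real: "cnj (\<omega> x y) = \<omega> x y" if "\<tau> x = x" "\<tau> y = y" for x y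
    using fd that by (auto simp: fundamental_data_def fixed_points_def Reals_cnj_iff)
  have "\<tau> u = a + (- \<i>) *s b" "\<tau> v = c + (- \<i>) *s d"
    using ab cd by (simp_all add: vec_eq_iff)
  then show ?thesis
    unfolding ab(3) cd(3)
    by (simp only: \<omega>_linear) (simp add: real ab(1,2) cd(1,2) algebra_simps)
qed

private lemma isotropic_span:
  assumes "isotropic \<omega> S" "u \<in> vec.span S" "v \<in> vec.span S"
  shows "\<omega> u v = 0"
proof -
  have 0: "\<omega> 0 v = 0" "\<omega> v 0 = 0" for v
    using \<omega>_linear(2)[of 0 0] \<omega>_linear(4)[of v 0 0] by simp_all
  have 1: "\<omega> u v = 0" if "u \<in> S" for u
    using assms(3) by (induction rule: vec.span_induct_alt)
      (use assms(1) that 0 in \<open>auto simp: \<omega>_linear isotropic_def\<close>)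
  show ?thesis
    using assms(2) by (induction rule: vec.span_induct_alt) (auto simp: \<omega>_linear 0 1)
qed

text \<open>\<open>P\<close> is the pairing with a basis b of L taken from \<open>L\<^sub>0\<close>;
  it identifies L' with complex^'n. The preimages c of the unit vectors form the dual basis of L',
  and \<open>Q\<close> is the pairing with c. Expanding in b and c then gives the normal form of
  \<open>\<omega>\<close>.\<close>

lemma darboux_exists:
  assumes card: "CARD('v) = 2 * CARD('n::finite)" and split: "lagrangean_splitting \<omega> \<tau> L\<^sub>0 L\<^sub>0'"
  shows "\<exists>Q P :: complex^'v \<Rightarrow> complex^'n. darboux \<omega> \<tau> L\<^sub>0 L\<^sub>0' Q P"
proof -
  let ?L = "vec.span L\<^sub>0" and ?L' = "vec.span L\<^sub>0'"
  have L0: "L\<^sub>0 \<subseteq> fixed_points \<tau>" "isotropic \<omega> L\<^sub>0" and L0': "L\<^sub>0' \<subseteq> fixed_points \<tau>" "isotropic \<omega> L\<^sub>0'"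
    and sum: "fixed_points \<tau> = {u + v |u v. u \<in> L\<^sub>0 \<and> v \<in> L\<^sub>0'}"
    using split by (auto simp: lagrangean_splitting_def lagrangean_in_def)
  note iso = isotropic_span[OF L0(2)] and iso' = isotropic_span[OF L0'(2)]
  have decomp: "\<exists>l\<in>?L. \<exists>l'\<in>?L'. u = l + l'" for u
  proof -
    obtain a b where ab: "\<tau> a = a" "\<tau> b = b" "u = a + \<i> *s b"
      using real_imaginary_parts .
    then have "a \<in> fixed_points \<tau>" "b \<in> fixed_points \<tau>"
      by (auto simp: fixed_points_def)
    then obtain c c' d d' where "c \<in> L\<^sub>0" "c' \<in> L\<^sub>0'" "d \<in> L\<^sub>0" "d' \<in> L\<^sub>0'" "a = c + c'" "b = d + d'"
      unfolding sum by blast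
    then show ?thesis
      unfolding ab(3)
      by (intro bexI[of _ "c + \<i> *s d"] bexI[of _ "c' + \<i> *s d'"])
        (auto simp: vec.scale_right_distrib intro!: vec.span_add vec.span_scale intro: vec.span_base)
  qed
  have perp: "u = 0" if "\<And>l. l \<in> ?L \<Longrightarrow> \<omega> u l = 0" "\<And>l'. l' \<in> ?L' \<Longrightarrow> \<omega> u l' = 0" for u
  proof (rule \<omega>_nondegenerate)
    fix v
    obtain l l' where "l \<in> ?L" "l' \<in> ?L'" "v = l + l'"
      using decomp by blast
    then show "\<omega> u v = 0"
      using that by (simp add: \<omega>_linear)
  qed
  \<comment> \<open>The basis is independent over the complex numbers but consists of vectors of
    \<open>L\<^sub>0\<close>, so its members are fixed by \<open>\<tau>\<close>.\<close>
  obtain B where B: "B \<subseteq> L\<^sub>0" "vec.independent B" "L\<^sub>0 \<subseteq> vec.span B" "card B = vec.dim L\<^sub>0"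
    using vec.basis_exists by blast
  obtain B' where B': "B' \<subseteq> L\<^sub>0'" "vec.independent B'" "L\<^sub>0' \<subseteq> vec.span B'" "card B' = vec.dim L\<^sub>0'"
    using vec.basis_exists by blast
  have span_B: "vec.span B = ?L" "vec.span B' = ?L'"
    using B B' by (metis vec.span_mono vec.span_span subset_antisym)+
  have zero: "w = 0" if w: "w \<in> ?L'" "\<And>b. b \<in> B \<Longrightarrow> \<omega> b w = 0" for w
  proof (rule perp)
    fix l assume "l \<in> ?L"
    then have "l \<in> vec.span B"
      by (simp add: span_B)
    then have "\<omega> l w = 0"
      by (induction rule: vec.span_induct_alt) (use w(2) \<omega>_linear(2)[of 0 0] in \<open>auto simp: \<omega>_linear\<close>)
    then show "\<omega> w l = 0"
      using \<omega>_skew[of w l] by simp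
  qed (use iso' w in auto)
  have zero': "w = 0" if w: "w \<in> ?L" "\<And>b. b \<in> B' \<Longrightarrow> \<omega> b w = 0" for w
  proof (rule perp)
    fix l assume "l \<in> ?L'"
    then have "l \<in> vec.span B'"
      by (simp add: span_B)
    then have "\<omega> l w = 0"
      by (induction rule: vec.span_induct_alt) (use w(2) \<omega>_linear(2)[of 0 0] in \<open>auto simp: \<omega>_linear\<close>)
    then show "\<omega> w l = 0"
      using \<omega>_skew[of w l] by simp
  qed (use iso w in auto)
  \<comment> \<open>The two bounds force L and L' to have the same dimension; as V is their direct
    sum, it is half of CARD('v).\<close>
  have le: "vec.dim ?L' \<le> card B" "vec.dim ?L \<le> card B'"
    using dim_le_card_of_annihilator[OF B(2) \<omega>_bil vec.subspace_span zero]
      dim_le_card_of_annihilator[OF B'(2) \<omega>_bil vec.subspace_span zero'] by auto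
  have "?L \<inter> ?L' = {0}"
    using perp iso iso' vec.span_zero by fastforce
  moreover have "{x + y |x y. x \<in> ?L \<and> y \<in> ?L'} = UNIV"
    using decomp by blast
  ultimately have "CARD('v) = vec.dim ?L + vec.dim ?L'"
    using vec.dim_sums_Int[OF vec.subspace_span vec.subspace_span, of L\<^sub>0 L\<^sub>0']
    by (simp only: vec_dim_card) simp
  then have dims: "card B = CARD('n)" "vec.dim ?L' = CARD('n)"
    using le card B(4) B'(4) by (simp_all add: vec.dim_span)
  have "finite B"
    using B(2) vec.finiteI_independent by blast
  then obtain b :: "'n \<Rightarrow> _" where b: "bij_betw b UNIV B"
    using finite_same_card_bij[OF finite_class.finite_UNIV, of B] dims by auto
  define P where "P v = (\<chi> i. \<omega> (b i) v)" for v
  have P_lin: "P (u + v) = P u + P v" "P (c *s u) = c *s P u" for u v c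
    by (simp_all add: P_def vec_eq_iff \<omega>_linear)
  have bB: "b i \<in> B" for i
    using b bij_betwE by blast
  then have bL0: "b i \<in> L\<^sub>0" and b\<tau>: "\<tau> (b i) = b i" for i
    using B(1) L0(1) by (auto simp: fixed_points_def)
  note bL = vec.span_base[OF bL0]
  have P_inj: "w = 0" if "w \<in> ?L'" "P w = 0" for w
    by (rule zero[OF that(1)]) (use that(2) b in \<open>auto simp: P_def vec_eq_iff bij_betw_def\<close>)
  have linP: "Vector_Spaces.linear (*s) (*s) P"
    by (simp add: clinear_vec_iff P_lin)
  have "inj_on P (vec.span ?L')"
    using P_inj linP by (simp add: vec.linear_inj_on_iff_eq_0 vec.span_span vec.subspace_span)
  then have "vec.dim (P ` ?L') = CARD('n)"
    using vec.dim_image_eq[OF linP] dims by metis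
  then have P_surj: "P ` ?L' = UNIV"
    by (intro vec.subspace_dim_equal vec.linear_subspace_image[OF linP vec.subspace_span])
      (simp_all only: vec_dim_card subset_UNIV vec.subspace_UNIV order_refl)
  have "\<forall>j. \<exists>v\<in>?L'. P v = axis j 1"
    using P_surj by (metis UNIV_I imageE)
  then obtain c where c: "\<And>j. c j \<in> ?L'" "\<And>j. P (c j) = axis j 1"
    by metis
  have \<tau>_L': "\<tau> v \<in> ?L'" if "v \<in> ?L'" for v
    using that
  proof (induction rule: vec.span_induct_alt)
    case base
    then show ?case
      using \<tau>_linear(2)[of 0 0] vec.span_zero by simp
  next
    case (step k x y)
    moreover have "\<tau> x = x"
      using step L0'(1) by (auto simp: fixed_points_def)
    ultimately show ?case
      by (simp add: \<tau>_linear vec.span_add vec.span_scale vec.span_base)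
  qed
  have P_\<tau>: "P (\<tau> v) = cvec (P v)" for v
    using \<omega>_\<tau>[of "b i" v for i] by (simp add: P_def vec_eq_iff b\<tau>)
  have P_diff: "P (u - v) = P u - P v" for u v
    using P_lin(1)[of "u - v" v] by simp
  \<comment> \<open>\<open>\<tau>\<close> preserves L', and both vectors have the same real image
    under \<open>P\<close>, which is injective there: the dual basis is real.\<close>
  have "\<tau> (c j) - c j = 0" for j
    by (rule P_inj) (use c \<tau>_L' in \<open>auto simp: P_diff P_\<tau> intro!: vec.span_diff\<close>)
  then have c\<tau>: "\<tau> (c j) = c j" for j
    by simp
  define Q where "Q v = (\<chi> i. \<omega> v (c i))" for v
  have Q_lin: "Q (u + v) = Q u + Q v" "Q (k *s u) = k *s Q u" for u v k
    by (simp_all add: Q_def vec_eq_iff \<omega>_linear)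
  have Q_\<tau>: "Q (\<tau> v) = cvec (Q v)" for v
    using \<omega>_\<tau>[of v "c i" for i] by (simp add: Q_def vec_eq_iff c\<tau>)
  have P_L: "P l = 0" if "l \<in> ?L" for l
    using iso[OF bL that] by (simp add: P_def vec_eq_iff)
  have Q_L': "Q l = 0" if "l \<in> ?L'" for l
    using iso'[OF that c(1)] by (simp add: Q_def vec_eq_iff)
  have Qb: "Q (b i) = axis i 1" for i
    using c(2) by (simp add: Q_def P_def vec_eq_iff axis_def)
  let ?s = "\<lambda>x y. (\<Sum>i\<in>UNIV. x $ i *s b i) + (\<Sum>i\<in>UNIV. y $ i *s c i)"
  have lin0: "P 0 = 0" "Q 0 = 0"
    using P_lin(2)[of 0 0] Q_lin(2)[of 0 0] by simp_all
  have P_sum: "P (\<Sum>i\<in>I. f i) = (\<Sum>i\<in>I. P (f i))" and Q_sum: "Q (\<Sum>i\<in>I. f i) = (\<Sum>i\<in>I. Q (f i))"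
    for f :: "'n \<Rightarrow> complex^'v" and I
    by (induction I rule: infinite_finite_induct) (simp_all add: P_lin Q_lin lin0)
  have sum_axis: "(\<Sum>i\<in>UNIV. x $ i *s axis i 1) = x" for x :: "complex^'n"
    by (rule basis_expansion)
  have QP_s: "Q (?s x y) = x" "P (?s x y) = y" for x y
    by (simp_all add: P_lin Q_lin P_sum Q_sum Qb c P_L[OF bL] Q_L'[OF c(1)] sum_axis)
  have s_L: "(\<Sum>i\<in>UNIV. x $ i *s b i) \<in> ?L" "(\<Sum>i\<in>UNIV. x $ i *s c i) \<in> ?L'" for x
    using bL c(1) by (auto intro!: vec.span_sum vec.span_scale)
  have L'_eq: "v = (\<Sum>i\<in>UNIV. P v $ i *s c i)" if "v \<in> ?L'" for v
  proof -
    have "v - (\<Sum>i\<in>UNIV. P v $ i *s c i) = 0"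
    proof (rule P_inj)
      show "P (v - (\<Sum>i\<in>UNIV. P v $ i *s c i)) = 0"
        by (simp add: P_diff P_sum P_lin c sum_axis)
    qed (use s_L that in \<open>auto intro!: vec.span_diff\<close>)
    then show ?thesis
      by simp
  qed
  have Q_inj: "l = 0" if l: "l \<in> ?L" "Q l = 0" for l
  proof (rule perp)
    fix v assume "v \<in> ?L'"
    have \<omega>_sum: "\<omega> l (\<Sum>i\<in>I. f i) = (\<Sum>i\<in>I. \<omega> l (f i))" for f :: "'n \<Rightarrow> complex^'v" and I
      using \<omega>_linear(4)[of l 0 0] by (induction I rule: infinite_finite_induct) (simp_all add: \<omega>_linear)
    have "\<omega> l v = (\<Sum>i\<in>UNIV. P v $ i * \<omega> l (c i))"
      using arg_cong[OF L'_eq[OF \<open>v \<in> ?L'\<close>], of "\<omega> l"] by (simp only: \<omega>_sum \<omega>_linear)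
    then show "\<omega> l v = 0"
      using l(2) by (simp add: Q_def vec_eq_iff)
  qed (use iso l in auto)
  have inj0: "u = 0" if "Q u = 0" "P u = 0" for u
  proof -
    obtain l l' where l: "l \<in> ?L" "l' \<in> ?L'" "u = l + l'"
      using decomp by blast
    then have "l' = 0" "l = 0"
      using that P_inj[of l'] Q_inj[of l] by (auto simp: P_lin Q_lin P_L Q_L')
    then show ?thesis
      using l by simp
  qed
  have inj: "u = v" if "Q u = Q v" "P u = P v" for u v
  proof -
    have "u - v = 0"
      by (rule inj0) (use Q_lin(1)[of "u - v" v] that in \<open>simp_all add: P_diff\<close>)
    then show ?thesis
      by simp
  qed
  have expand: "u = ?s (Q u) (P u)" for u
    by (rule inj) (simp_all add: QP_s)
  have omega_eq: "\<omega> u v = Q u \<odot> P v - P u \<odot> Q v" for u v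
  proof -
    have \<omega>_sum: "\<omega> (\<Sum>i\<in>I. f i) v = (\<Sum>i\<in>I. \<omega> (f i) v)" for f :: "'n \<Rightarrow> complex^'v" and I
      using \<omega>_linear(2)[of 0 0 v] by (induction I rule: infinite_finite_induct) (simp_all add: \<omega>_linear)
    have "\<omega> u v = \<omega> (?s (Q u) (P u)) v"
      using expand by simp
    also have "\<dots> = Q u \<odot> P v + (\<Sum>i\<in>UNIV. P u $ i * \<omega> (c i) v)"
      by (simp add: \<omega>_linear \<omega>_sum cdot_def P_def)
    also have "(\<Sum>i\<in>UNIV. P u $ i * \<omega> (c i) v) = - (P u \<odot> Q v)"
      using \<omega>_skew[of "c i" v for i] by (simp add: cdot_def Q_def sum_negf)
    finally show ?thesis
      by simp
  qed
  have "darboux \<omega> \<tau> L\<^sub>0 L\<^sub>0' Q P"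
  proof
    show "\<exists>u. Q u = x \<and> P u = y" for x y
      using QP_s by blast
    show "?L = {u. P u = 0}"
    proof (intro set_eqI iffI CollectI)
      fix u assume "u \<in> {u. P u = 0}"
      then have "u = (\<Sum>i\<in>UNIV. Q u $ i *s b i)"
        using expand[of u] by simp
      then show "u \<in> ?L"
        using s_L(1) by metis
    qed (rule P_L)
    show "?L' = {u. Q u = 0}"
    proof (intro set_eqI iffI CollectI)
      fix u assume "u \<in> {u. Q u = 0}"
      then have "u = (\<Sum>i\<in>UNIV. P u $ i *s c i)"
        using expand[of u] by simp
      then show "u \<in> ?L'"
        using s_L(2) by metis
    qed (rule Q_L')
    show "L\<^sub>0 = {u. \<tau> u = u \<and> P u = 0}"
    proof (intro set_eqI iffI)
      fix u assume "u \<in> {u. \<tau> u = u \<and> P u = 0}"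
      then have u: "u \<in> fixed_points \<tau>" "P u = 0"
        by (auto simp: fixed_points_def)
      then obtain l l' where l: "l \<in> L\<^sub>0" "l' \<in> L\<^sub>0'" "u = l + l'"
        unfolding sum by blast
      then have "P l' = 0"
        using u(2) P_L[OF vec.span_base[OF l(1)]] by (simp add: P_lin)
      then have "l' = 0"
        by (rule P_inj[OF vec.span_base[OF l(2)]])
      then show "u \<in> L\<^sub>0"
        using l by simp
    qed (use L0(1) P_L vec.span_base in \<open>auto simp: fixed_points_def\<close>)
  qed (simp_all add: P_lin Q_lin P_\<tau> Q_\<tau> omega_eq inj)
  then show ?thesis
    by blast
qed

end

section \<open>Lagrangean subspaces transverse to \<open>L'\<close>\<close>

definition linear_forms :: "(complex^'v) set \<Rightarrow> (complex^'v \<Rightarrow> complex) set" where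
  "linear_forms T =
     {\<sigma>. (\<forall>u\<in>T. \<forall>v\<in>T. \<sigma> (u + v) = \<sigma> u + \<sigma> v) \<and>
         (\<forall>a. \<forall>u\<in>T. \<sigma> (a *s u) = a * \<sigma> u) \<and> (\<forall>u. u \<notin> T \<longrightarrow> \<sigma> u = 0)}"

lemma cotangent_space_eq: "cotangent_space M m = linear_forms (tangent_space M m)"
  by (simp add: cotangent_space_def linear_forms_def)

context darboux
begin

lemma QP_0 [simp]: "Q 0 = 0" "P 0 = 0"
  using Q_smult[of 0 0] P_smult[of 0 0] by simp_all

lemma QP_diff [simp]: "Q (u - v) = Q u - Q v" "P (u - v) = P u - P v"
  using Q_add[of "u - v" v] P_add[of "u - v" v] by simp_all

lemma QP_bounded_linear: "bounded_linear Q" "bounded_linear P"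
  by (auto simp: scaleR_eq_smult intro!: linear_conv_bounded_linear[THEN iffD1] linearI)

lemma gamma_eq: "gamma_form \<omega> \<tau> u v = \<i> * (Q u \<odot> cvec (P v) - P u \<odot> cvec (Q v))"
  by (simp add: gamma_form_def omega_eq)

lemma gamma_hermitian: "gamma_form \<omega> \<tau> v u = cnj (gamma_form \<omega> \<tau> u v)"
  by (simp add: gamma_eq cnj_cdot cdot_commute algebra_simps)

lemma mem_L0: "u \<in> L\<^sub>0 \<longleftrightarrow> \<tau> u = u \<and> P u = 0"
  using L0_eq by blast

abbreviation \<gamma> :: "complex^'v \<Rightarrow> complex^'v \<Rightarrow> complex" where
  "\<gamma> \<equiv> gamma_form \<omega> \<tau>"

abbreviation proj :: "complex^'v \<Rightarrow> complex^'v" where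
  "proj \<equiv> projection_along (vec.span L\<^sub>0) (vec.span L\<^sub>0')"

lemma QP_proj [simp]: "Q (proj v) = Q v" "P (proj v) = 0"
proof -
  obtain a where "Q a = Q v" "P a = 0"
    using QP_surj by blast
  then have "\<exists>!a. a \<in> vec.span L\<^sub>0 \<and> v - a \<in> vec.span L\<^sub>0'"
    unfolding span_L0 span_L0' by (intro ex1I[of _ a]) (auto intro: QP_inj)
  from theI'[OF this] have "proj v \<in> vec.span L\<^sub>0 \<and> v - proj v \<in> vec.span L\<^sub>0'"
    by (simp add: projection_along_def)
  then show "Q (proj v) = Q v" "P (proj v) = 0"
    by (auto simp: span_L0 span_L0')
qed

text \<open>Gathers what the two cases of the theorem have in common at a point; bijectivity of
  \<open>Q\<close> says that the projection to L is an isomorphism on T.\<close>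

definition transverse :: "(complex^'v) set \<Rightarrow> bool" where
  "transverse T \<longleftrightarrow> vec.subspace T \<and> isotropic \<omega> T \<and> bij_betw Q T UNIV \<and>
     nondegenerate_on T \<gamma>"

definition lift :: "(complex^'v) set \<Rightarrow> complex^'n \<Rightarrow> complex^'v" where
  "lift T = inv_into T Q"

text \<open>The matrix of second derivatives \<open>F\<^sub>i\<^sub>j\<close> of the local generating function: a transverse
  Lagrangean subspace is the graph of a symmetric map in Darboux coordinates.\<close>

definition slope :: "(complex^'v) set \<Rightarrow> complex^'n^'n" where
  "slope T = (\<chi> i j. P (lift T (axis j 1)) $ i)"

definition gram :: "(complex^'v) set \<Rightarrow> complex^'n^'n" where
  "gram T = imaginary_part (slope T)"

text \<open>The components of a covector in the coframe \<open>Q\<close>, that is, the fibre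
  coordinates that belong to the coordinates q on M.\<close>

definition momentum :: "(complex^'v) set \<Rightarrow> (complex^'v \<Rightarrow> complex) \<Rightarrow> complex^'n" where
  "momentum T \<sigma> = (\<chi> i. \<sigma> (lift T (axis i 1)))"

definition covector :: "(complex^'v) set \<Rightarrow> complex^'n \<Rightarrow> complex^'v \<Rightarrow> complex" where
  "covector T \<eta> = (\<lambda>v. if v \<in> T then \<eta> \<odot> Q v else 0)"

context
  fixes T
  assumes T: "transverse T"
begin

lemma subspace_T: "vec.subspace T"
  using T by (simp add: transverse_def)

lemma T_closed: "u \<in> T \<Longrightarrow> v \<in> T \<Longrightarrow> u + v \<in> T" "u \<in> T \<Longrightarrow> c *s u \<in> T" "0 \<in> T"
  "u \<in> T \<Longrightarrow> v \<in> T \<Longrightarrow> u - v \<in> T"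
  using subspace_T vec.subspace_add vec.subspace_scale vec.subspace_0 vec.subspace_diff by blast+

lemma Q_inj_T: "u \<in> T \<Longrightarrow> v \<in> T \<Longrightarrow> Q u = Q v \<Longrightarrow> u = v"
  using T by (auto simp: transverse_def bij_betw_def inj_on_def)

lemma lift [simp]: "lift T a \<in> T" "Q (lift T a) = a"
  using T unfolding transverse_def lift_def bij_betw_def
  by (metis UNIV_I inv_into_into, metis UNIV_I f_inv_into_f)

lemma lift_Q: "v \<in> T \<Longrightarrow> lift T (Q v) = v"
  by (rule Q_inj_T) auto

lemma lift_linear: "lift T (a + b) = lift T a + lift T b" "lift T (c *s a) = c *s lift T a"
  "lift T 0 = 0"
  by (rule Q_inj_T; simp add: T_closed)+

lemma vector_expansion:
  assumes "v \<in> T"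
  shows "v = (\<Sum>i\<in>UNIV. Q v $ i *s lift T (axis i 1))"
proof -
  have *: "lift T (\<Sum>i\<in>I. f i) = (\<Sum>i\<in>I. lift T (f i))" for f :: "'n \<Rightarrow> complex^'n" and I
    by (induction I rule: infinite_finite_induct) (simp_all add: lift_linear)
  have "v = lift T (\<Sum>i\<in>UNIV. Q v $ i *s axis i 1)"
    by (simp add: basis_expansion lift_Q assms)
  then show ?thesis
    by (simp add: * lift_linear)
qed

lemma P_eq_slope:
  assumes "v \<in> T"
  shows "P v = slope T *v Q v"
proof -
  have *: "P (\<Sum>i\<in>I. f i) = (\<Sum>i\<in>I. P (f i))" for f :: "'n \<Rightarrow> complex^'v" and I
    by (induction I rule: infinite_finite_induct) simp_all
  have "P v = (\<Sum>i\<in>UNIV. Q v $ i *s P (lift T (axis i 1)))"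
    using arg_cong[OF vector_expansion[OF assms], of P] by (simp add: *)
  then show ?thesis
    by (simp add: vec_eq_iff slope_def matrix_vector_mult_def sum_component mult.commute)
qed

lemma slope_symmetric: "slope T $ i $ j = slope T $ j $ i"
proof -
  have "\<omega> (lift T (axis i 1)) (lift T (axis j 1)) = 0"
    using T by (auto simp: transverse_def isotropic_def)
  then show ?thesis
    by (simp add: omega_eq slope_def)
qed

lemma gram_real: "cnj (gram T $ i $ j) = gram T $ i $ j"
  by (simp add: gram_def imaginary_part_def algebra_simps)

lemma cvec_gram: "cvec (gram T *v a) = gram T *v cvec a"
  by (simp add: vec_eq_iff matrix_vector_mult_def gram_real)

lemma gamma_gram:
  assumes "u \<in> T" "v \<in> T"
  shows "\<gamma> u v = Q u \<odot> (gram T *v cvec (Q v))"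
  using imaginary_part_apply[OF slope_symmetric, of "Q u" "Q v"]
  by (simp add: gamma_eq P_eq_slope assms gram_def)

lemma det_gram: "det (gram T) \<noteq> 0"
proof -
  have "x = 0" if "gram T *v x = 0" for x
  proof -
    \<comment> \<open>The matrix meets the second argument of the form through a conjugation, so a
      kernel vector is conjugated before it is lifted.\<close>
    have "\<gamma> (lift T (cvec x)) u = 0" if "u \<in> T" for u
      using gamma_hermitian[of "lift T (cvec x)" u] gamma_gram[OF that, of "lift T (cvec x)"]
      by (simp add: \<open>gram T *v x = 0\<close>)
    then have "lift T (cvec x) = 0"
      using T by (simp add: transverse_def nondegenerate_on_def)
    then show "x = 0"
      by (metis QP_0(1) cvec_eq_0_iff lift(2))
  qed
  then show ?thesis
    by (metis invertible_det_nz invertible_left_inverse matrix_left_invertible_ker)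
qed

lemma gram_solve [simp]: "gram T *v linear_solve (gram T) b = b"
  using linear_solve[OF det_gram] by blast

lemma gram_inj: "gram T *v a = gram T *v b \<Longrightarrow> a = b"
  using linear_solve[OF det_gram] by metis

lemma momentum_eq:
  assumes "\<sigma> \<in> linear_forms T" "v \<in> T"
  shows "\<sigma> v = momentum T \<sigma> \<odot> Q v"
proof -
  \<comment> \<open>Membership in \<open>T\<close> is carried through the induction because
    \<open>\<sigma>\<close> is additive only on \<open>T\<close>.\<close>
  have *: "\<sigma> (\<Sum>i\<in>I. a i *s lift T (axis i 1)) = (\<Sum>i\<in>I. a i * \<sigma> (lift T (axis i 1)))
      \<and> (\<Sum>i\<in>I. a i *s lift T (axis i 1)) \<in> T" for a :: "'n \<Rightarrow> complex" and I
  proof (induction I rule: infinite_finite_induct)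
    have "\<sigma> 0 = 0"
      using assms(1) T_closed(3) by (force simp: linear_forms_def dest: spec[of _ 0])
    then show "\<sigma> (\<Sum>i\<in>{}. a i *s lift T (axis i 1)) = (\<Sum>i\<in>{}. a i * \<sigma> (lift T (axis i 1)))
        \<and> (\<Sum>i\<in>{}. a i *s lift T (axis i 1)) \<in> T"
      "infinite I \<Longrightarrow> \<sigma> (\<Sum>i\<in>I. a i *s lift T (axis i 1)) = (\<Sum>i\<in>I. a i * \<sigma> (lift T (axis i 1)))
        \<and> (\<Sum>i\<in>I. a i *s lift T (axis i 1)) \<in> T" for I
      by (simp_all add: T_closed)
  next
    case (insert i I)
    then show ?case
      using assms(1) by (auto simp: linear_forms_def T_closed)
  qed
  show ?thesis
    using arg_cong[OF vector_expansion[OF assms(2)], of \<sigma>] *[of "\<lambda>i. Q v $ i" UNIV]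
    by (simp add: cdot_def momentum_def mult.commute)
qed

lemma covector_in: "covector T \<eta> \<in> linear_forms T"
  by (auto simp: covector_def linear_forms_def T_closed)

lemma momentum_covector [simp]: "momentum T (covector T \<eta>) = \<eta>"
  by (simp add: momentum_def covector_def vec_eq_iff)

lemma covector_momentum: "\<sigma> \<in> linear_forms T \<Longrightarrow> covector T (momentum T \<sigma>) = \<sigma>"
  using momentum_eq by (auto simp: covector_def linear_forms_def)

text \<open>The projection preserves \<open>Q\<close>, and \<open>L\<^sub>0\<close> consists of the
  vectors of L with real \<open>Q\<close>. So the real structure has to be conjugation of
  \<open>Q\<close>; this exhibits the object described by \<open>THE\<close> and shows its
  uniqueness.\<close>

lemma canonical_real_structure_eq:
  "canonical_real_structure proj L\<^sub>0 T = (\<lambda>v. if v \<in> T then lift T (cvec (Q v)) else 0)" (is "_ = ?\<rho>")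
  unfolding canonical_real_structure_def
proof (rule the_equality, safe)
  show "antilinear_involution_on T ?\<rho>"
    unfolding antilinear_involution_on_def by (simp add: T_closed lift_linear lift_Q)
next
  fix v assume v: "v \<in> T" "?\<rho> v = v"
  then have "cvec (Q v) = Q v"
    by (metis lift(2))
  then have "\<tau> (proj v) = proj v"
    by (intro QP_inj) simp_all
  then show "proj v \<in> L\<^sub>0"
    by (simp add: mem_L0)
next
  fix l assume l: "l \<in> L\<^sub>0"
  then have "cvec (Q l) = Q l"
    using Q_\<tau>[of l] by (simp add: mem_L0)
  then have "?\<rho> (lift T (Q l)) = lift T (Q l)"
    by simp
  moreover have "l = proj (lift T (Q l))"
    using l by (intro QP_inj) (simp_all add: mem_L0)
  ultimately show "l \<in> proj ` {v \<in> T. ?\<rho> v = v}"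
    by (intro image_eqI[of _ _ "lift T (Q l)"]) simp_all
next
  fix \<rho> assume \<rho>: "antilinear_involution_on T \<rho>" "proj ` {v \<in> T. \<rho> v = v} = L\<^sub>0" "\<forall>v. v \<notin> T \<longrightarrow> \<rho> v = 0"
  have \<rho>_in: "\<rho> u \<in> T" "\<rho> (\<rho> u) = u" "\<rho> (c *s u) = cnj c *s \<rho> u" if "u \<in> T" for u c
    using \<rho>(1) that by (auto simp: antilinear_involution_on_def)
  have \<rho>_add: "\<rho> (u + v) = \<rho> u + \<rho> v" if "u \<in> T" "v \<in> T" for u v
    using \<rho>(1) that by (auto simp: antilinear_involution_on_def)
  have \<rho>_diff: "\<rho> (u - v) = \<rho> u - \<rho> v" if "u \<in> T" "v \<in> T" for u v
    using \<rho>_add[of "u - v" v] that by (simp add: T_closed)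
  have fix_real: "cvec (Q u) = Q u" if "u \<in> T" "\<rho> u = u" for u
  proof -
    have "proj u \<in> L\<^sub>0"
      using \<rho>(2) that by blast
    then show ?thesis
      using Q_\<tau>[of "proj u"] by (simp add: mem_L0)
  qed
  show "\<rho> = ?\<rho>"
  proof
    fix v
    show "\<rho> v = ?\<rho> v"
    proof (cases "v \<in> T")
      case True
      \<comment> \<open>Both combinations are fixed by any admissible involution, so their
        \<open>Q\<close> components are real. Together the two conditions determine that the
        involution conjugates \<open>Q v\<close>.\<close>
      let ?a = "v + \<rho> v" and ?b = "\<i> *s v - \<i> *s \<rho> v"
      have "cvec (Q ?a) = Q ?a" "cvec (Q ?b) = Q ?b"
        by (rule fix_real; simp add: T_closed \<rho>_in \<rho>_add \<rho>_diff True add.commute)+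
      then have "cnj (Q v $ i) + cnj (Q (\<rho> v) $ i) = Q v $ i + Q (\<rho> v) $ i"
        "\<i> * cnj (Q (\<rho> v) $ i) - \<i> * cnj (Q v $ i) = \<i> * Q v $ i - \<i> * Q (\<rho> v) $ i" for i
        by (simp_all add: vec_eq_iff)
      then have "Q (\<rho> v) $ i = cnj (Q v $ i)" for i
        by (simp add: complex_eq_iff) (smt (verit) field_sum_of_halves)
      then have "Q (\<rho> v) = cvec (Q v)"
        by (simp add: vec_eq_iff)
      then have "\<rho> v = lift T (cvec (Q v))"
        using \<rho>_in(1)[OF True] by (intro Q_inj_T) auto
      then show ?thesis
        using True by simp
    qed (use \<rho>(3) in simp)
  qed
qed simp

text \<open>\<open>sharp\<close> solves for the antilinear argument of the Hermitian form; hence the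
  conjugation of the solution of the linear system.\<close>

lemma sharp_eq:
  "sharp T \<gamma> (covector T \<eta>) = lift T (cvec (linear_solve (gram T) \<eta>))"
  unfolding sharp_def
proof (rule the_equality)
  let ?s = "lift T (cvec (linear_solve (gram T) \<eta>))"
  show "?s \<in> T \<and> (\<forall>v\<in>T. covector T \<eta> v = \<gamma> v ?s)"
    by (auto simp: gamma_gram covector_def cdot_commute)
  fix s assume s: "s \<in> T \<and> (\<forall>v\<in>T. covector T \<eta> v = \<gamma> v s)"
  have "gram T *v cvec (Q s) = \<eta>"
  proof (rule cdot_eqI)
    fix c
    show "(gram T *v cvec (Q s)) \<odot> c = \<eta> \<odot> c"
      using s gamma_gram[of "lift T c" s] by (metis cdot_commute covector_def lift)
  qed
  then have "cvec (Q s) = linear_solve (gram T) \<eta>"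
    using linear_solve[OF det_gram] by blast
  then show "s = ?s"
    using s by (intro Q_inj_T) (metis, simp, metis cvec_linear(6) lift(2))
qed

lemma inverse_metric_eq:
  "inverse_metric T \<gamma> (covector T \<eta>) (covector T \<eta>)
    = cvec (linear_solve (gram T) \<eta>) \<odot> \<eta>"
  by (simp add: inverse_metric_def sharp_eq gamma_gram)

lemma real_solve:
  assumes "cvec t = t"
  shows "cvec (linear_solve (gram T) t) = linear_solve (gram T) t"
  by (rule gram_inj) (simp add: assms flip: cvec_gram)

end

lemma cotangent_potential_eq:
  assumes T: "transverse (tangent_space M m)" and \<sigma>: "\<sigma> \<in> cotangent_space M m"
  defines "t \<equiv> momentum (tangent_space M m) \<sigma> + cvec (momentum (tangent_space M m) \<sigma>)"
  shows "cotangent_potential \<omega> \<tau> L\<^sub>0 L\<^sub>0' M (m, \<sigma>)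
    = \<gamma> m m + t \<odot> linear_solve (gram (tangent_space M m)) t"
proof -
  let ?T = "tangent_space M m"
  let ?\<rho> = "canonical_real_structure proj L\<^sub>0 ?T"
  define \<eta> where "\<eta> = momentum ?T \<sigma>"
  have \<sigma>_eq: "\<sigma> = covector ?T \<eta>"
    using covector_momentum[OF T] \<sigma> by (simp add: cotangent_space_eq \<eta>_def)
  have "t = \<eta> + cvec \<eta>"
    by (simp add: t_def \<eta>_def)
  \<comment> \<open>The dual real structure conjugates the momentum, so the sum has the real
    momentum \<open>t\<close>. Off the tangent space, \<open>?\<rho>\<close> is 0, and
    \<open>\<sigma>\<close> vanishes at 0.\<close>
  then have "\<sigma> v + dual_real_structure ?\<rho> \<sigma> v = covector ?T t v" for v
    unfolding dual_real_structure_def canonical_real_structure_eq[OF T] \<sigma>_eq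
    using T_closed(3)[OF T] by (simp add: covector_def lift[OF T] cnj_cdot)
  then have "(\<lambda>v. \<sigma> v + dual_real_structure ?\<rho> \<sigma> v) = covector ?T t" ..
  moreover have "cvec t = t"
    by (simp add: t_def add.commute)
  ultimately show ?thesis
    by (simp add: cotangent_potential_def inverse_metric_eq[OF T] real_solve[OF T] cdot_commute)
qed

end

section \<open>Charts of submanifolds\<close>

text \<open>Near y a, increments of h differ from increments of y by a small multiple of the latter.
  Continuity of y makes this available along y; absorbing the error first bounds the increments of y
  linearly, then gives the derivative.\<close>

lemma has_derivative_lift:
  fixes h :: "'b::real_normed_vector \<Rightarrow> 'b" and y :: "'a::real_normed_vector \<Rightarrow> 'b"
  assumes h: "(h has_derivative (\<lambda>v. v)) (at (y a))" and y: "isCont y a"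
    and k: "((\<lambda>x. h (y x)) has_derivative g') (at a)"
  shows "(y has_derivative g') (at a)"
  unfolding has_derivative_at_alt
proof (intro conjI allI impI)
  show bl: "bounded_linear g'"
    using k by (rule has_derivative_bounded_linear)
  fix e :: real assume "e > 0"
  obtain B where B: "B > 0" "\<And>v. norm (g' v) \<le> norm v * B"
    using bounded_linear.pos_bounded[OF bl] by blast
  \<comment> \<open>The bound 1/2 allows the error to be absorbed, which yields ?Y \<le> 2 (B + 1)
    ?X; the other bound then makes the error at most e / 2 times ?X.\<close>
  define e' where "e' = min (1 / 2) (e / (4 * (B + 1)))"
  have e': "e' > 0" "e' \<le> 1 / 2" "e' * (2 * (B + 1)) \<le> e / 2"
  proof -
    show "e' > 0"
      using \<open>e > 0\<close> B(1) by (simp add: e'_def)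
    show "e' \<le> 1 / 2"
      by (simp only: e'_def min.cobounded1)
    have "e' * (2 * (B + 1)) \<le> e / (4 * (B + 1)) * (2 * (B + 1))"
      using B(1) by (intro mult_right_mono) (simp_all add: e'_def)
    also have "\<dots> = e / 2"
      using B(1) by (simp add: field_simps)
    finally show "e' * (2 * (B + 1)) \<le> e / 2" .
  qed
  obtain d1 where d1: "d1 > 0" "\<And>z. norm (z - y a) < d1 \<Longrightarrow> norm (h z - h (y a) - (z
    - y a)) \<le> e' * norm (z - y a)"
    using h e'(1) unfolding has_derivative_at_alt by blast
  obtain d2 where d2: "d2 > 0" "\<And>x. norm (x - a) < d2 \<Longrightarrow> norm (y x - y a) < d1"
    using y d1(1) unfolding continuous_at_eps_delta dist_norm by blast
  define e2 where "e2 = min 1 (e / 2)"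
  have e2: "e2 > 0" "e2 \<le> 1" "e2 \<le> e / 2"
    using \<open>e > 0\<close> by (simp_all add: e2_def)
  obtain d3 where d3: "d3 > 0" "\<And>x. norm (x - a) < d3 \<Longrightarrow> norm (h (y x) - h (y a) - g' (x
    - a)) \<le> e2 * norm (x - a)"
    using k e2(1) unfolding has_derivative_at_alt by blast
  show "\<exists>d>0. \<forall>x. norm (x - a) < d \<longrightarrow> norm (y x - y a - g' (x - a)) \<le> e * norm (x - a)"
  proof (intro exI[of _ "min d2 d3"] conjI allI impI)
    fix x assume x: "norm (x - a) < min d2 d3"
    let ?Y = "norm (y x - y a)" and ?X = "norm (x - a)"
    have 1: "norm (h (y x) - h (y a) - (y x - y a)) \<le> e' * ?Y"
      using d1(2) d2(2) x by simp
    have 2: "norm (h (y x) - h (y a) - g' (x - a)) \<le> e2 * ?X"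
      using d3(2) x by simp
    let ?p = "h (y x) - h (y a) - g' (x - a)" and ?q = "h (y x) - h (y a) - (y x - y a)"
    have "?Y = norm (g' (x - a) + ?p - ?q)"
      by (rule arg_cong[where f = norm]) simp
    also have "\<dots> \<le> norm (g' (x - a)) + norm ?p + norm ?q"
      using norm_triangle_ineq4[of "g' (x - a) + ?p" ?q] norm_triangle_ineq[of "g' (x - a)" ?p]
        by linarith
    also have "\<dots> \<le> ?X * B + 1 * ?X + 1 / 2 * ?Y"
      using B(2)[of "x - a"] 1 2 mult_right_mono[OF e2(2), of ?X] mult_right_mono[OF e'(2), of ?Y]
        by simp
    finally have Y: "?Y \<le> 2 * (B + 1) * ?X"
      by (simp add: algebra_simps)
    have "norm (y x - y a - g' (x - a)) = norm (?p - ?q)"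
      by (rule arg_cong[where f = norm]) simp
    also have "\<dots> \<le> e2 * ?X + e' * ?Y"
      using norm_triangle_ineq4[of ?p ?q] 1 2 by linarith
    also have "\<dots> \<le> e / 2 * ?X + e' * (2 * (B + 1) * ?X)"
      using e2(3) e'(1) Y by (intro add_mono mult_right_mono mult_left_mono) auto
    also have "\<dots> = e / 2 * ?X + e' * (2 * (B + 1)) * ?X"
      by simp
    also have "\<dots> \<le> e / 2 * ?X + e / 2 * ?X"
      using e'(3) by (intro add_left_mono mult_right_mono) auto
    finally show "norm (y x - y a - g' (x - a)) \<le> e * ?X"
      by simp
  qed (use d2(1) d3(1) in simp)
qed

lemma submanifold_chartsD:
  assumes "(D, \<phi>) \<in> submanifold_charts T M"
  shows "open D" "holomorphic_map_on \<phi> D" "z \<in> D \<Longrightarrow> inj (deriv_at \<phi> z)"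
    "openin (top_of_set M) (\<phi> ` D)" "inj_on \<phi> D" "continuous_on D \<phi>"
    "continuous_on (\<phi> ` D) (inv_into D \<phi>)" "\<phi> ` D \<subseteq> M"
proof -
  show "open D" "holomorphic_map_on \<phi> D" "z \<in> D \<Longrightarrow> inj (deriv_at \<phi> z)" "openin (top_of_set M) (\<phi> ` D)"
    using assms by (auto simp: submanifold_charts_def)
  then show "\<phi> ` D \<subseteq> M"
    using openin_imp_subset by blast
  obtain \<phi>' where hom: "homeomorphism D (\<phi> ` D) \<phi> \<phi>'"
    using assms by (auto simp: submanifold_charts_def)
  show inj: "inj_on \<phi> D"
    using hom by (metis homeomorphism_def inj_on_inverseI)
  show "continuous_on D \<phi>"
    using hom by (simp add: homeomorphism_def)
  have "inv_into D \<phi> x = \<phi>' x" if "x \<in> \<phi> ` D" for x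
    using hom that inj by (auto simp: homeomorphism_def)
  then show "continuous_on (\<phi> ` D) (inv_into D \<phi>)"
    using hom continuous_on_cong[of "\<phi> ` D" "\<phi> ` D"] by (simp add: homeomorphism_def)
qed

lemma chart_deriv:
  assumes "(D, \<phi>) \<in> submanifold_charts T M" "z \<in> D"
  shows "(\<phi> has_derivative deriv_at \<phi> z) (at z)" "deriv_at \<phi> z (c *s u) = c *s deriv_at \<phi> z u"
    "deriv_at \<phi> z (u + v) = deriv_at \<phi> z u + deriv_at \<phi> z v"
  using holomorphic_map_on_deriv[OF submanifold_chartsD(2)[OF assms(1)] assms(2)]
    has_derivative_linear linear_add by blast+

text \<open>Composing the chart with a left inverse of its derivative gives a map whose derivative
  at the point is the identity, so \<open>has_derivative_lift\<close> applies to the continuous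
  lift. This one lemma serves tangent spaces, transition maps and the injectivity of the
  projection.\<close>

lemma chart_lift:
  fixes f :: "'a::real_normed_vector \<Rightarrow> complex^'v"
  assumes chart: "(D, \<phi>) \<in> submanifold_charts T M"
    and f: "(f has_derivative f') (at a)" and U: "open U" "a \<in> U" "\<And>x. x \<in> U \<Longrightarrow> f x \<in> M"
    and fa: "f a \<in> \<phi> ` D"
  obtains x' W where "((\<lambda>x. inv_into D \<phi> (f x)) has_derivative x') (at a)"
    "\<And>v. deriv_at \<phi> (inv_into D \<phi> (f a)) (x' v) = f' v"
    "open W" "a \<in> W" "W \<subseteq> U" "\<And>x. x \<in> W \<Longrightarrow> f x \<in> \<phi> ` D"
proof -
  note ch = submanifold_chartsD[OF chart]
  obtain V where V: "open V" "\<phi> ` D = M \<inter> V"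
    using ch(4) by (auto simp: openin_open)
  have "isCont f a"
    using f by (rule has_derivative_continuous)
  then obtain W0 where W0: "open W0" "a \<in> W0" "\<And>x. x \<in> W0 \<Longrightarrow> f x \<in> V"
    using fa V by (metis IntD2 continuous_at_open)
  define W where "W = W0 \<inter> U"
  have W: "open W" "a \<in> W" "W \<subseteq> U" "\<And>x. x \<in> W \<Longrightarrow> f x \<in> \<phi> ` D"
    using W0 U V by (auto simp: W_def)
  define y where "y = (\<lambda>x. inv_into D \<phi> (f x))"
  have \<phi>y: "\<phi> (y x) = f x" "y x \<in> D" if "x \<in> W" for x
    using W(4)[OF that] by (auto simp: y_def f_inv_into_f inv_into_into)
  let ?A = "deriv_at \<phi> (y a)"
  note A = chart_deriv(1)[OF chart \<phi>y(2)[OF W(2)]]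
  obtain B where B: "linear B" "B \<circ> ?A = id"
    using linear_injective_left_inverse[OF has_derivative_linear[OF A] ch(3)[OF \<phi>y(2)[OF W(2)]]] by blast
  have blB: "bounded_linear B"
    using B(1) linear_conv_bounded_linear by blast
  have cont: "isCont y a"
  proof -
    have "continuous (at a within W) f"
      using \<open>isCont f a\<close> continuous_at_imp_continuous_at_within by blast
    moreover have "continuous (at (f a) within f ` W) (inv_into D \<phi>)"
      using ch(7) fa W(4) by (intro continuous_within_subset[of "f a" "\<phi> ` D" _ "f ` W"])
        (auto simp: continuous_on_eq_continuous_within simp del: imageE)
    ultimately have "continuous (at a within W) (inv_into D \<phi> \<circ> f)"
      by (rule continuous_within_compose)
    then show ?thesis
      using at_within_open[OF W(2,1)] by (simp add: y_def o_def)
  qed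
  have h: "((\<lambda>z. B (\<phi> z)) has_derivative (\<lambda>v. v)) (at (y a))"
    using bounded_linear.has_derivative[OF blB A] B(2) by (simp add: o_def fun_eq_iff)
  have k: "((\<lambda>x. B (\<phi> (y x))) has_derivative (\<lambda>v. B (f' v))) (at a)"
    by (rule has_derivative_transform_within_open[OF bounded_linear.has_derivative[OF blB f] W(1,2)])
      (simp add: \<phi>y)
  note y' = has_derivative_lift[OF h cont k]
  have "((\<lambda>x. \<phi> (y x)) has_derivative (\<lambda>v. ?A (B (f' v)))) (at a)"
    by (rule has_derivative_compose[OF y' A])
  moreover have "((\<lambda>x. \<phi> (y x)) has_derivative f') (at a)"
    by (rule has_derivative_transform_within_open[OF f W(1,2)]) (simp add: \<phi>y)
  ultimately have "(\<lambda>v. ?A (B (f' v))) = f'"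
    by (rule has_derivative_unique)
  then have "?A (B (f' v)) = f' v" for v
    by (rule fun_cong)
  then show thesis
    using that[OF y'[unfolded y_def] _ W] unfolding y_def by blast
qed

lemma tangent_space_chart:
  assumes chart: "(D, \<phi>) \<in> submanifold_charts T M" and z: "z \<in> D"
  shows "tangent_space M (\<phi> z) = range (deriv_at \<phi> z)"
proof (intro set_eqI iffI)
  fix v assume "v \<in> tangent_space M (\<phi> z)"
  then obtain c where c: "\<And>t::real. c t \<in> M" "c 0 = \<phi> z" "(c has_derivative (\<lambda>t. t *\<^sub>R v)) (at 0)"
    by (auto simp: tangent_space_def has_vector_derivative_def)
  obtain x' where "\<And>t. deriv_at \<phi> (inv_into D \<phi> (c 0)) (x' t) = t *\<^sub>R v"
    using chart_lift[OF chart c(3), of UNIV] c(1,2) z by (metis UNIV_I imageI open_UNIV)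
  from this[of 1] show "v \<in> range (deriv_at \<phi> z)"
    using c(2) z submanifold_chartsD(5)[OF chart] by (metis inv_into_f_f rangeI scaleR_one)
next
  fix v assume "v \<in> range (deriv_at \<phi> z)"
  then obtain u where u: "v = deriv_at \<phi> z u"
    by blast
  let ?l = "\<lambda>t. z + t *\<^sub>R u"
  have "open (?l -` D)"
    by (rule open_vimage[OF submanifold_chartsD(1)[OF chart]]) (intro continuous_intros)
  then have S: "open (?l -` D)" "0 \<in> ?l -` D"
    using z by simp_all
  \<comment> \<open>The curves in \<open>tangent_space\<close> have to stay in \<open>M\<close> for
    all times, so the curve is set constant where the line leaves the chart domain.\<close>
  define c where "c = (\<lambda>t. if t \<in> ?l -` D then \<phi> (?l t) else \<phi> z)"
  have "((\<lambda>t. \<phi> (?l t)) has_derivative (\<lambda>t. deriv_at \<phi> z (t *\<^sub>R u))) (at 0)"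
    using chart_deriv(1)[OF chart z]
    by (intro has_derivative_compose[where f = ?l and g = \<phi>]) (auto intro!: derivative_eq_intros)
  then have "((\<lambda>t. \<phi> (?l t)) has_derivative (\<lambda>t. t *\<^sub>R v)) (at 0)"
    using linear_cmul[OF has_derivative_linear[OF chart_deriv(1)[OF chart z]]] by (simp add: u)
  then have "(c has_derivative (\<lambda>t. t *\<^sub>R v)) (at 0)"
    by (rule has_derivative_transform_within_open[OF _ S]) (simp add: c_def)
  moreover have "c t \<in> M" for t
    using submanifold_chartsD(8)[OF chart] z by (auto simp: c_def)
  ultimately show "v \<in> tangent_space M (\<phi> z)"
    unfolding tangent_space_def has_vector_derivative_def using S(2)
    by (intro CollectI exI[of _ c]) (simp add: c_def)
qed

lemma submanifold_chart_at:
  assumes "complex_submanifold T M" "m \<in> M"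
  obtains D \<phi> z where "(D, \<phi>) \<in> submanifold_charts T M" "z \<in> D" "m = \<phi> z"
  using assms by (fastforce simp: complex_submanifold_def)

text \<open>Holomorphic transition maps between charts of \<open>M\<close> need no implicit function theorem: a
  continuous lift through an immersion is differentiable.\<close>

lemma chart_transition_holomorphic:
  fixes M :: "(complex^'v) set"
  assumes c: "(D, \<phi>) \<in> submanifold_charts T M" and c1: "(D1, \<phi>1) \<in> submanifold_charts T M"
  shows "open {z \<in> D. \<phi> z \<in> \<phi>1 ` D1}"
    and "holomorphic_map_on (\<lambda>z. inv_into D1 \<phi>1 (\<phi> z)) {z \<in> D. \<phi> z \<in> \<phi>1 ` D1}"
proof -
  have "openin (top_of_set D) (D \<inter> \<phi> -` (\<phi>1 ` D1))"
    using submanifold_chartsD(4,6,8)[OF c] submanifold_chartsD(4)[OF c1]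
    by (intro continuous_openin_preimage[of D \<phi> M]) (auto simp: image_subset_iff_funcset)
  then have "open (D \<inter> \<phi> -` (\<phi>1 ` D1))"
    using openin_open_trans submanifold_chartsD(1)[OF c] by blast
  then show "open {z \<in> D. \<phi> z \<in> \<phi>1 ` D1}"
    by (simp add: Int_def vimage_def)
  show "holomorphic_map_on (\<lambda>z. inv_into D1 \<phi>1 (\<phi> z)) {z \<in> D. \<phi> z \<in> \<phi>1 ` D1}"
    unfolding holomorphic_map_on_def holomorphic_fun_on_def
  proof (intro allI ballI)
    fix i z assume "z \<in> {z \<in> D. \<phi> z \<in> \<phi>1 ` D1}"
    then have z: "z \<in> D" "\<phi> z \<in> \<phi>1 ` D1"
      by auto
    obtain x' where x': "((\<lambda>x. inv_into D1 \<phi>1 (\<phi> x)) has_derivative x') (at z)"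
      "\<And>v. deriv_at \<phi>1 (inv_into D1 \<phi>1 (\<phi> z)) (x' v) = deriv_at \<phi> z v"
      using chart_lift[OF c1 chart_deriv(1)[OF c z(1)] submanifold_chartsD(1)[OF c] z(1) _ z(2)]
        submanifold_chartsD(8)[OF c] by (metis image_subset_iff)
    have y: "inv_into D1 \<phi>1 (\<phi> z) \<in> D1"
      using z(2) by (rule inv_into_into)
    \<comment> \<open>Both charts have complex linear derivatives and that of \<open>\<phi>1\<close>
      is injective, so complex linearity can be cancelled.\<close>
    have "x' (a *s u) = a *s x' u" for a u
      using x'(2) chart_deriv(2)[OF c z(1)] chart_deriv(2)[OF c1 y]
      by (intro injD[OF submanifold_chartsD(3)[OF c1 y]]) simp
    then show "\<exists>f'. ((\<lambda>z. inv_into D1 \<phi>1 (\<phi> z) $ i) has_derivative f') (at z)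
      \<and> Vector_Spaces.linear (*s) (*) f'"
      using has_derivative_vec_nth[THEN iffD1, OF x'(1)] linear_add[OF has_derivative_linear[OF x'(1)]]
      unfolding clinear_iff by (intro exI[of _ "\<lambda>v. x' v $ i"]) simp
  qed
qed

section \<open>Transversality of the tangent spaces in the Kaehler and the pseudo Kaehler
  case\<close>

context darboux
begin

lemma proj_bounded_linear: "bounded_linear proj"
proof -
  have "proj (u + v) = proj u + proj v" "proj (c *\<^sub>R u) = c *\<^sub>R proj u" for u v c
    by (rule QP_inj; simp add: scaleR_eq_smult)+
  then show ?thesis
    by (intro linear_conv_bounded_linear[THEN iffD1] linearI)
qed

text \<open>The tangent space is a linear image of the n-dimensional coordinate space, so
  injectivity of \<open>Q\<close> on it already gives bijectivity.\<close>

lemma transverse_tangent_space: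
  assumes M: "lagrangean_submanifold TYPE('n) \<omega> M" "m \<in> M"
    and nondeg: "nondegenerate_on (tangent_space M m) \<gamma>"
    and inj: "\<And>v. v \<in> tangent_space M m \<Longrightarrow> Q v = 0 \<Longrightarrow> v = 0"
  shows "transverse (tangent_space M m)"
proof -
  obtain D z and \<phi> :: "complex^'n \<Rightarrow> complex^'v" where
    c: "(D, \<phi>) \<in> submanifold_charts TYPE('n) M" "z \<in> D" and m: "m = \<phi> z"
    using submanifold_chart_at M unfolding lagrangean_submanifold_def by metis
  let ?A = "deriv_at \<phi> z"
  note A = chart_deriv[OF c]
  have T: "tangent_space M m = range ?A"
    using tangent_space_chart[OF c] m by simp
  have lin: "Vector_Spaces.linear (*s) (*s) (\<lambda>u. Q (?A u))"
    by (simp add: clinear_vec_iff A)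
  have lag: "lagrangean_in vec.subspace \<omega> UNIV (tangent_space M m)"
    using M by (simp add: lagrangean_submanifold_def)
  have "inj (\<lambda>u. Q (?A u))"
  proof (rule injI)
    fix u v assume "Q (?A u) = Q (?A v)"
    then have "Q (?A u - ?A v) = 0"
      by simp
    moreover have "?A u - ?A v = ?A (u - v)"
      using A(3)[of "u - v" v] by simp
    ultimately have "?A u = ?A v"
      using inj T by (metis eq_iff_diff_eq_0 rangeI)
    then show "u = v"
      using submanifold_chartsD(3)[OF c] by (simp add: inj_eq)
  qed
  moreover from this have "surj (\<lambda>u. Q (?A u))"
    by (rule vec.linear_injective_imp_surjective[OF lin]) (rule refl)
  ultimately have "bij_betw Q (range ?A) UNIV"
    by (auto simp: bij_betw_def inj_on_def image_image)
  then show ?thesis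
    using lag nondeg by (simp add: transverse_def T lagrangean_in_def)
qed

text \<open>The Hermitian form vanishes on L' = ker Q, whereas it is positive on nonzero tangent
  vectors.\<close>

lemma kaehler_transverse:
  assumes "lagrangean_submanifold TYPE('n) \<omega> M" "kaehler_submanifold TYPE('n) \<gamma> M" "m \<in> M"
  shows "transverse (tangent_space M m)"
proof (rule transverse_tangent_space[OF assms(1,3)])
  have pos: "v \<noteq> 0 \<Longrightarrow> \<gamma> v v \<noteq> 0" if "v \<in> tangent_space M m" for v
    using assms(2,3) that by (force simp: kaehler_submanifold_def positive_definite_on_def)
  show "nondegenerate_on (tangent_space M m) \<gamma>"
    using pos by (auto simp: nondegenerate_on_def)
  show "v = 0" if "v \<in> tangent_space M m" "Q v = 0" for v
    using pos[OF that(1)] that(2) by (auto simp: gamma_eq)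
qed

text \<open>If the projection killed a tangent vector, a curve with that velocity would project to a
  curve with velocity 0. The holomorphic inverse brings it back to the original curve, whose
  velocity would be 0 too.\<close>

lemma general_position_transverse:
  assumes M: "lagrangean_submanifold TYPE('n) \<omega> M"
    and pk: "pseudo_kaehler_submanifold TYPE('n) \<gamma> M k l"
    and gp: "general_position TYPE('n) (vec.span L\<^sub>0) (vec.span L\<^sub>0') M" and m: "m \<in> M"
  shows "transverse (tangent_space M m)"
proof (rule transverse_tangent_space[OF M m])
  show "nondegenerate_on (tangent_space M m) \<gamma>"
    using pk m by (simp add: pseudo_kaehler_submanifold_def)
  obtain D z and \<phi> :: "complex^'n \<Rightarrow> complex^'v" where
    c: "(D, \<phi>) \<in> submanifold_charts TYPE('n) M" "z \<in> D" and mz: "m = \<phi> z"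
    using submanifold_chart_at M m unfolding lagrangean_submanifold_def by metis
  have iso: "complex_submanifold TYPE('n) (proj ` M)" "inj_on proj M"
    "holomorphic_on_submanifold TYPE('n) (proj ` M) (inv_into M proj)"
    using gp by (auto simp: general_position_def isomorphism_onto_image_def)
  obtain D2 z2 and \<phi>2 :: "complex^'n \<Rightarrow> complex^'v" where
    c2: "(D2, \<phi>2) \<in> submanifold_charts TYPE('n) (proj ` M)" "z2 \<in> D2" and pm: "proj m = \<phi>2 z2"
    using submanifold_chart_at[OF iso(1)] m by (metis imageI)
  let ?g = "inv_into M proj \<circ> \<phi>2"
  have hol: "holomorphic_map_on ?g D2"
    using iso(3) c2(1) by (auto simp: holomorphic_on_submanifold_def)
  fix v assume v: "v \<in> tangent_space M m" "Q v = 0"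
  then obtain u where u: "v = deriv_at \<phi> z u"
    using tangent_space_chart[OF c] mz by auto
  have pv: "proj v = 0"
    using v(2) by (intro QP_inj) simp_all
  let ?l = "\<lambda>t::real. z + t *\<^sub>R u"
  have "open (?l -` D)"
    by (rule open_vimage[OF submanifold_chartsD(1)[OF c(1)]]) (intro continuous_intros)
  then have S: "open (?l -` D)" "0 \<in> ?l -` D"
    using c(2) by simp_all
  let ?d = "\<lambda>t::real. deriv_at \<phi> z (t *\<^sub>R u)"
  have line: "((\<lambda>t. \<phi> (?l t)) has_derivative ?d) (at 0)"
    using chart_deriv(1)[OF c]
    by (intro has_derivative_compose[where f = ?l and g = \<phi>]) (auto intro!: derivative_eq_intros)
  have d: "?d t = t *\<^sub>R v" for t
    using linear_cmul[OF has_derivative_linear[OF chart_deriv(1)[OF c]]] by (simp add: u)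
  note pline = bounded_linear.has_derivative[OF proj_bounded_linear line]
  have inM: "\<phi> (?l t) \<in> M" if "t \<in> ?l -` D" for t
    using submanifold_chartsD(8)[OF c(1)] that by auto
  obtain x' W where x': "((\<lambda>t. inv_into D2 \<phi>2 (proj (\<phi> (?l t)))) has_derivative x') (at 0)"
    "\<And>t. deriv_at \<phi>2 (inv_into D2 \<phi>2 (proj (\<phi> (?l 0)))) (x' t) = proj (?d t)"
    and W: "open W" "0 \<in> W" "W \<subseteq> ?l -` D" "\<And>t. t \<in> W \<Longrightarrow> proj (\<phi> (?l t)) \<in> \<phi>2 ` D2"
    by (rule chart_lift[OF c2(1) pline S]) (use inM pm mz c2(2) in auto)
  have y0: "inv_into D2 \<phi>2 (proj (\<phi> (?l 0))) = z2"
    using pm mz c2 submanifold_chartsD(5)[OF c2(1)] by simp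
  \<comment> \<open>The projected curve, read in the chart of the image, has velocity 0: the
    projection kills \<open>v\<close> and the derivative of that chart is injective.\<close>
  have "x' t = 0" for t
  proof -
    have "deriv_at \<phi>2 z2 (x' t) = deriv_at \<phi>2 z2 0"
      using x'(2)[of t] chart_deriv(2)[OF c2, of 0 0] unfolding y0 d
      by (simp add: linear_cmul[OF bounded_linear.linear[OF proj_bounded_linear]] pv)
    then show ?thesis
      using submanifold_chartsD(3)[OF c2] by (simp add: inj_eq)
  qed
  moreover have "((\<lambda>t. ?g (inv_into D2 \<phi>2 (proj (\<phi> (?l t))))) has_derivative (\<lambda>t. deriv_at ?g z2 (x'
    t))) (at 0)"
    using has_derivative_compose[OF x'(1)] holomorphic_map_on_deriv(1)[OF hol c2(2)] y0 by metis
  ultimately have "((\<lambda>t. ?g (inv_into D2 \<phi>2 (proj (\<phi> (?l t))))) has_derivative (\<lambda>t. 0)) (at 0)"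
    using linear_0[OF has_derivative_linear[OF holomorphic_map_on_deriv(1)[OF hol c2(2)]]] by simp
  \<comment> \<open>Near 0 the composite with the inverse of the projection is the original curve,
    so this zero derivative competes with the velocity \<open>v\<close> in
    \<open>line\<close>.\<close>
  then have "((\<lambda>t. \<phi> (?l t)) has_derivative (\<lambda>t. 0)) (at 0)"
  proof (rule has_derivative_transform_within_open[OF _ W(1,2)])
    fix t assume "t \<in> W"
    then show "?g (inv_into D2 \<phi>2 (proj (\<phi> (?l t)))) = \<phi> (?l t)"
      using W(3,4) inM iso(2) by (auto simp: f_inv_into_f subset_iff)
  qed
  from fun_cong[OF has_derivative_unique[OF this line], of 1] show "v = 0"
    by (simp add: u)
qed

end


section \<open>The cotangent bundle\<close>

lemma coord_linear [simp]:
  "base_coord (x + y) = base_coord x + base_coord y"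
    "fibre_coord (x + y) = fibre_coord x + fibre_coord y"
  "base_coord (c *s x) = c *s base_coord x" "fibre_coord (c *s x) = c *s fibre_coord x"
  "base_coord (r *\<^sub>R x) = r *\<^sub>R base_coord x" "fibre_coord (r *\<^sub>R x) = r *\<^sub>R fibre_coord x"
  by (simp_all add: base_coord_def fibre_coord_def vec_eq_iff)

lemma coord_bounded_linear: "bounded_linear base_coord" "bounded_linear fibre_coord"
  by (auto intro!: linear_conv_bounded_linear[THEN iffD1] linearI)

definition bundle_coord :: "complex^'n \<Rightarrow> complex^'n \<Rightarrow> complex^('n::finite + 'n)" where
  "bundle_coord z w = (\<chi> k. case k of Inl i \<Rightarrow> z $ i | Inr i \<Rightarrow> w $ i)"

lemma bundle_coord [simp]:
  "base_coord (bundle_coord z w) = z" "fibre_coord (bundle_coord z w) = w"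
  "bundle_coord (base_coord x) (fibre_coord x) = x"
  by (auto simp: bundle_coord_def base_coord_def fibre_coord_def vec_eq_iff split: sum.split)

lemma coord_eqI: "base_coord x = base_coord y \<Longrightarrow> fibre_coord x = fibre_coord y \<Longrightarrow> x = y"
  by (metis bundle_coord(3))

lemma holomorphic_fun_on_linear:
  fixes f :: "complex^'k \<Rightarrow> complex^'m" and l :: "complex^'m \<Rightarrow> complex"
  assumes "holomorphic_map_on f D" "bounded_linear l" "\<And>c u. l (c *s u) = c * l u"
  shows "holomorphic_fun_on (\<lambda>z. l (f z)) D"
  by (rule holomorphic_fun_onI[OF bounded_linear.has_derivative[OF assms(2)
    holomorphic_map_on_deriv(1)[OF assms(1)]]])
    (simp_all add: assms(3) holomorphic_map_on_deriv(2)[OF assms(1)])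

lemma holomorphic_map_on_ident: "holomorphic_map_on (\<lambda>z. z) D"
  unfolding holomorphic_map_on_def
  by (intro allI holomorphic_fun_onI[where f' = "\<lambda>_ u. u $ i" for i])
    (auto intro!: bounded_linear.has_derivative[OF bounded_linear_vec_nth])

lemma holomorphic_base_coord: "holomorphic_map_on base_coord D"
  and holomorphic_fibre_coord: "holomorphic_map_on fibre_coord D"
  unfolding holomorphic_map_on_def
  by (auto intro!: holomorphic_fun_on_linear[OF holomorphic_map_on_ident]
      bounded_linear_compose[OF bounded_linear_vec_nth coord_bounded_linear(1)]
      bounded_linear_compose[OF bounded_linear_vec_nth coord_bounded_linear(2)])

lemma holomorphic_map_on_deriv_at:
  fixes f :: "complex^'k \<Rightarrow> complex^'m"
  assumes "open D" "holomorphic_map_on f D"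
  shows "holomorphic_map_on (\<lambda>z. deriv_at f z u) D"
  unfolding holomorphic_map_on_def
proof
  fix i
  have "holomorphic_fun_on (\<lambda>z. deriv_at (\<lambda>z. f z $ i) z u) D"
    using assms by (intro holomorphic_fun_on_deriv_at) (auto simp: holomorphic_map_on_def)
  then show "holomorphic_fun_on (\<lambda>z. deriv_at f z u $ i) D"
    by (rule holomorphic_fun_on_cong[OF assms(1), rotated])
      (simp add: holomorphic_map_on_deriv(3)[OF assms(2)])
qed

lemma holomorphic_map_on_continuous: "holomorphic_map_on f D \<Longrightarrow> continuous_on D f"
  by (intro continuous_at_imp_continuous_on ballI has_derivative_continuous[OF
    holomorphic_map_on_deriv(1)])

text \<open>Both cases of the theorem are instances; they differ in how transversality is obtained
  and, at the end, in the positivity or signature of the form.\<close>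

locale lagrangean_bundle = darboux \<omega> \<tau> L\<^sub>0 L\<^sub>0' Q P
  for \<omega> :: "complex^'v \<Rightarrow> complex^'v \<Rightarrow> complex" and \<tau> L\<^sub>0 L\<^sub>0' and Q P :: "complex^'v \<Rightarrow> complex^'n" +
  fixes M :: "(complex^'v) set"
  assumes submanifold: "complex_submanifold TYPE('n) M"
    and transverse_tangent: "m \<in> M \<Longrightarrow> transverse (tangent_space M m)"
begin

abbreviation charts where "charts \<equiv> submanifold_charts TYPE('n) M"

definition eta :: "'v covector \<Rightarrow> complex^'n" where
  "eta p = momentum (tangent_space M (fst p)) (snd p)"

text \<open>The transpose of the usual Jacobian matrix of q: rows belong to the coordinate vectors
  of the chart. Applied to a momentum it therefore yields the fibre coordinates of the
  covector.\<close>

definition jac :: "(complex^'n \<Rightarrow> complex^'v) \<Rightarrow> complex^'n \<Rightarrow> complex^'n^'n" where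
  "jac \<phi> z = (\<chi> i. Q (deriv_at \<phi> z (axis i 1)))"

abbreviation dom :: "(complex^'n) set \<Rightarrow> (complex^('n + 'n)) set" where
  "dom D \<equiv> {x. base_coord x \<in> D}"

abbreviation bchart where "bchart D \<phi> \<equiv> (dom D, cotangent_param M \<phi>)"
abbreviation TM where "TM \<equiv> tangent_space M"

lemma bundle_eq: "cotangent_bundle M = {p. fst p \<in> M \<and> snd p \<in> linear_forms (TM (fst p))}"
  by (auto simp: cotangent_bundle_def cotangent_space_eq)

lemma trivialization_inj:
  assumes "p \<in> cotangent_bundle M" "p' \<in> cotangent_bundle M" "fst p = fst p'" "eta p = eta p'"
  shows "p = p'"
  using assms covector_momentum[OF transverse_tangent] unfolding bundle_eq eta_def
  by (metis (mono_tags, lifting) mem_Collect_eq prod.expand)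

lemma covector_in_bundle: "m \<in> M \<Longrightarrow> (m, covector (TM m) \<eta>) \<in> cotangent_bundle M"
  by (simp add: bundle_eq covector_in transverse_tangent)

lemma eta_covector [simp]: "m \<in> M \<Longrightarrow> eta (m, covector (TM m) \<eta>) = \<eta>"
  by (simp add: eta_def transverse_tangent)

definition chart_eta :: "(complex^'n \<Rightarrow> complex^'v) \<Rightarrow> complex^('n + 'n) \<Rightarrow> complex^'n" where
  "chart_eta \<phi> x = linear_solve (jac \<phi> (base_coord x)) (fibre_coord x)"

text \<open>The inverse of a bundle chart in the global trivialization \<open>M \<times> complex^'n\<close>.\<close>

definition chart_coord ::
  "(complex^'n) set \<Rightarrow> (complex^'n \<Rightarrow> complex^'v) \<Rightarrow> complex^'v \<Rightarrow> complex^'n \<Rightarrow> complex^('n + 'n)" where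
  "chart_coord D \<phi> m \<eta> = bundle_coord (inv_into D \<phi> m) (jac \<phi> (inv_into D \<phi> m) *v \<eta>)"

context
  fixes D \<phi>
  assumes chart: "(D, \<phi>) \<in> charts"
begin

lemma chart_in_M: "z \<in> D \<Longrightarrow> \<phi> z \<in> M"
  using submanifold_chartsD(8)[OF chart] by blast

lemma deriv_in_tangent: "z \<in> D \<Longrightarrow> deriv_at \<phi> z u \<in> TM (\<phi> z)"
  using tangent_space_chart[OF chart] by blast

lemma jac_apply: "(jac \<phi> z *v \<eta>) $ i = \<eta> \<odot> Q (deriv_at \<phi> z (axis i 1))"
  by (simp add: jac_def matrix_vector_mult_def cdot_def mult.commute)

lemma deriv_expansion:
  assumes "z \<in> D"
  shows "deriv_at \<phi> z u = (\<Sum>i\<in>UNIV. u $ i *s deriv_at \<phi> z (axis i 1))"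
proof -
  have *: "deriv_at \<phi> z (\<Sum>i\<in>I. f i) = (\<Sum>i\<in>I. deriv_at \<phi> z (f i))" for f :: "'n \<Rightarrow> complex^'n" and I
    using chart_deriv(2)[OF chart assms, of 0 0]
    by (induction I rule: infinite_finite_induct) (simp_all add: chart_deriv[OF chart assms])
  show ?thesis
    using arg_cong[OF basis_expansion[of u], of "deriv_at \<phi> z"]
    by (simp add: * chart_deriv[OF chart assms])
qed

text \<open>A vector in the kernel pairs to zero with the image under \<open>Q\<close> of every
  tangent vector, and these images fill complex^'n.\<close>

lemma det_jac:
  assumes z: "z \<in> D"
  shows "det (jac \<phi> z) \<noteq> 0"
proof -
  have "\<eta> = 0" if "jac \<phi> z *v \<eta> = 0" for \<eta>
  proof (rule cdot_eqI)
    fix c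
    let ?T = "TM (\<phi> z)"
    note T = transverse_tangent[OF chart_in_M[OF z]]
    obtain u where u: "lift ?T c = deriv_at \<phi> z u"
      using lift(1)[OF T, of c] tangent_space_chart[OF chart z] by auto
    have *: "Q (\<Sum>i\<in>I. f i) = (\<Sum>i\<in>I. Q (f i))" "\<eta> \<odot> (\<Sum>i\<in>I. g i) = (\<Sum>i\<in>I. \<eta> \<odot> g i)"
      for f :: "'n \<Rightarrow> complex^'v" and g :: "'n \<Rightarrow> complex^'n" and I
      by (induction I rule: infinite_finite_induct) simp_all
    have "c = Q (deriv_at \<phi> z u)"
      using lift(2)[OF T, of c] u by simp
    then have "\<eta> \<odot> c = (\<Sum>i\<in>UNIV. u $ i * (jac \<phi> z *v \<eta>) $ i)"
      unfolding deriv_expansion[OF z, of u] jac_apply by (simp add: *)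
    then show "\<eta> \<odot> c = 0 \<odot> c"
      by (simp add: that)
  qed
  then show ?thesis
    by (metis invertible_det_nz invertible_left_inverse matrix_left_invertible_ker)
qed

lemma fibre_coord_chart_eta: "base_coord x \<in> D \<Longrightarrow> fibre_coord x = jac \<phi> (base_coord x) *v chart_eta \<phi> x"
  unfolding chart_eta_def using linear_solve[OF det_jac] by metis

text \<open>Evaluates the \<open>THE\<close>: covectors correspond to momenta, and the prescribed
  values on coordinate vectors form an invertible linear system for the momentum.\<close>

lemma cotangent_param_eq:
  assumes x: "base_coord x \<in> D"
  shows "cotangent_param M \<phi> x
    = (\<phi> (base_coord x), covector (TM (\<phi> (base_coord x))) (chart_eta \<phi> x))"
proof -
  let ?z = "base_coord x"
  let ?T = "TM (\<phi> ?z)"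
  note T = transverse_tangent[OF chart_in_M[OF x]]
  have "(THE \<sigma>. \<sigma> \<in> cotangent_space M (\<phi> ?z) \<and>
      (\<forall>i. \<sigma> (deriv_at \<phi> ?z (axis i 1)) = fibre_coord x $ i)) = covector ?T (chart_eta \<phi> x)"
  proof (rule the_equality)
    show "covector ?T (chart_eta \<phi> x) \<in> cotangent_space M (\<phi> ?z) \<and>
      (\<forall>i. covector ?T (chart_eta \<phi> x) (deriv_at \<phi> ?z (axis i 1)) = fibre_coord x $ i)"
      unfolding fibre_coord_chart_eta[OF x] jac_apply cotangent_space_eq
      using covector_in[OF T] deriv_in_tangent[OF x] by (simp add: covector_def)
    fix \<sigma> assume \<sigma>: "\<sigma> \<in> cotangent_space M (\<phi> ?z) \<and>
      (\<forall>i. \<sigma> (deriv_at \<phi> ?z (axis i 1)) = fibre_coord x $ i)"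
    then have lf: "\<sigma> \<in> linear_forms ?T"
      by (simp add: cotangent_space_eq)
    have "jac \<phi> ?z *v momentum ?T \<sigma> = fibre_coord x"
      using \<sigma> momentum_eq[OF T lf deriv_in_tangent[OF x]] by (simp add: vec_eq_iff jac_apply)
    then have "momentum ?T \<sigma> = chart_eta \<phi> x"
      using linear_solve[OF det_jac[OF x]] by (simp add: chart_eta_def)
    then show "\<sigma> = covector ?T (chart_eta \<phi> x)"
      using covector_momentum[OF T lf] by simp
  qed
  then show ?thesis
    by (simp add: cotangent_param_def)
qed

lemma cotangent_param_facts:
  assumes x: "base_coord x \<in> D"
  shows "fst (cotangent_param M \<phi> x) = \<phi> (base_coord x)" "eta (cotangent_param M \<phi> x) = chart_eta \<phi> x"
    "cotangent_param M \<phi> x \<in> cotangent_bundle M"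
  unfolding cotangent_param_eq[OF x] using chart_in_M[OF x] by (simp_all add: covector_in_bundle)

lemma chart_coord_param:
  assumes "base_coord x \<in> D"
  shows "chart_coord D \<phi> (\<phi> (base_coord x)) (chart_eta \<phi> x) = x"
  using fibre_coord_chart_eta[OF assms] submanifold_chartsD(5)[OF chart] assms
  by (intro coord_eqI) (simp_all add: chart_coord_def)

lemma param_chart_coord:
  assumes "p \<in> cotangent_bundle M" "fst p \<in> \<phi> ` D"
  shows "base_coord (chart_coord D \<phi> (fst p) (eta p)) \<in> D"
    "cotangent_param M \<phi> (chart_coord D \<phi> (fst p) (eta p)) = p"
proof -
  let ?x = "chart_coord D \<phi> (fst p) (eta p)"
  show *: "base_coord ?x \<in> D"
    using assms(2) by (simp add: chart_coord_def inv_into_into)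
  have "chart_eta \<phi> ?x = eta p"
    using linear_solve[OF det_jac[OF *]] unfolding chart_eta_def
    by (metis chart_coord_def bundle_coord(1,2))
  moreover have "\<phi> (base_coord ?x) = fst p"
    using assms(2) by (simp add: chart_coord_def f_inv_into_f)
  ultimately show "cotangent_param M \<phi> ?x = p"
    using cotangent_param_facts[OF *] by (intro trivialization_inj assms(1)) simp_all
qed

lemma inj_on_param: "inj_on (cotangent_param M \<phi>) (dom D)"
  by (rule inj_on_inverseI[of _ "\<lambda>p. chart_coord D \<phi> (fst p) (eta p)"])
    (simp add: cotangent_param_facts chart_coord_param)

lemma image_param: "cotangent_param M \<phi> ` dom D = {p \<in> cotangent_bundle M. fst p \<in> \<phi> ` D}"
proof (intro set_eqI iffI)
  fix p assume "p \<in> {p \<in> cotangent_bundle M. fst p \<in> \<phi> ` D}"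
  then show "p \<in> cotangent_param M \<phi> ` dom D"
    using param_chart_coord[of p] by (metis (mono_tags, lifting) image_eqI mem_Collect_eq)
qed (auto simp: cotangent_param_facts)

lemma inv_param:
  assumes "p \<in> cotangent_bundle M" "fst p \<in> \<phi> ` D"
  shows "inv_into (dom D) (cotangent_param M \<phi>) p = chart_coord D \<phi> (fst p) (eta p)"
  using inv_into_f_f[OF inj_on_param, of "chart_coord D \<phi> (fst p) (eta p)"] param_chart_coord[OF
    assms] by simp

lemma open_dom: "open (dom D)"
  using open_vimage[OF submanifold_chartsD(1)[OF chart]
      bounded_linear.continuous_on[OF coord_bounded_linear(1) continuous_on_id]]
  by (simp add: vimage_def)

lemma holomorphic_jac: "holomorphic_fun_on (\<lambda>z. jac \<phi> z $ i $ j) D"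
proof -
  have "bounded_linear (\<lambda>v. Q v $ j)"
    by (rule bounded_linear_compose[OF bounded_linear_vec_nth QP_bounded_linear(1)])
  from holomorphic_fun_on_linear[OF holomorphic_map_on_deriv_at this]
  show ?thesis
    using submanifold_chartsD(1,2)[OF chart] by (simp add: jac_def)
qed

lemma holomorphic_chart_eta: "holomorphic_fun_on (\<lambda>x. chart_eta \<phi> x $ i) (dom D)"
  unfolding chart_eta_def
proof (rule holomorphic_fun_on_linear_solve)
  show "holomorphic_fun_on (\<lambda>x. jac \<phi> (base_coord x) $ i $ j) (dom D)" for i j
    by (rule holomorphic_fun_on_compose[OF holomorphic_jac holomorphic_base_coord]) simp
  show "holomorphic_fun_on (\<lambda>x. fibre_coord x $ i) (dom D)" for i
    by (simp add: holomorphic_fibre_coord[unfolded holomorphic_map_on_def])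
qed (simp add: det_jac)

lemma holomorphic_chart_base: "holomorphic_map_on (\<lambda>x. \<phi> (base_coord x)) (dom D)"
  unfolding holomorphic_map_on_def
  using submanifold_chartsD(2)[OF chart]
  by (auto intro!: holomorphic_fun_on_compose[OF _ holomorphic_base_coord] simp: holomorphic_map_on_def)

end

end

section \<open>The cotangent bundle as a complex manifold\<close>

lemma openin_manifold_topology:
  fixes A :: "('k::finite, 'x) chart set"
  assumes "complex_atlas X A"
  shows "openin (manifold_topology X A) U \<longleftrightarrow> U \<subseteq> X \<and> (\<forall>(D, \<psi>)\<in>A. open {z \<in> D. \<psi> z \<in> U})"
proof -
  have "istopology (\<lambda>U. U \<subseteq> X \<and> (\<forall>(D, \<psi>)\<in>A. open {z \<in> D. \<psi> z \<in> U}))"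
    unfolding istopology_def
  proof (intro conjI allI impI)
    fix S U assume "S \<subseteq> X \<and> (\<forall>(D, \<psi>)\<in>A. open {z \<in> D. \<psi> z \<in> S})"
      "U \<subseteq> X \<and> (\<forall>(D, \<psi>)\<in>A. open {z \<in> D. \<psi> z \<in> U})"
    moreover have "{z \<in> D. \<psi> z \<in> S \<inter> U} = {z \<in> D. \<psi> z \<in> S} \<inter> {z \<in> D. \<psi> z \<in> U}"
      for D :: "(complex^'k) set" and \<psi>
      by auto
    ultimately show "S \<inter> U \<subseteq> X" "\<forall>(D, \<psi>)\<in>A. open {z \<in> D. \<psi> z \<in> S \<inter> U}"
      by (auto intro!: open_Int simp del: Int_iff)
  next
    fix \<U> assume *: "\<forall>U\<in>\<U>. U \<subseteq> X \<and> (\<forall>(D, \<psi>)\<in>A. open {z \<in> D. \<psi> z \<in> U})"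
    have "{z \<in> D. \<psi> z \<in> \<Union>\<U>} = (\<Union>U\<in>\<U>. {z \<in> D. \<psi> z \<in> U})" for D :: "(complex^'k) set" and \<psi>
      by auto
    with * show "\<forall>(D, \<psi>)\<in>A. open {z \<in> D. \<psi> z \<in> \<Union>\<U>}"
      by (auto intro!: open_UN simp del: Union_iff)
    from * show "\<Union>\<U> \<subseteq> X"
      by auto
  qed
  then show ?thesis
    by (simp add: manifold_topology_def)
qed

lemma topspace_manifold_topology:
  assumes "complex_atlas X A"
  shows "topspace (manifold_topology X A) = X"
proof -
  have "{z \<in> D. \<psi> z \<in> X} = D" "open D" if "(D, \<psi>) \<in> A" for D \<psi>
    using assms that by (auto simp: complex_atlas_def)
  then have "openin (manifold_topology X A) X"
    by (auto simp: openin_manifold_topology[OF assms])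
  then show ?thesis
    using openin_subset openin_manifold_topology[OF assms] by (metis openin_topspace subset_antisym)
qed

lemma second_countable_top_of_set: "second_countable (top_of_set (S :: 'a::second_countable_topology
  set))"
proof (rule second_countable_subtopology)
  obtain \<B> :: "'a set set" where \<B>: "countable \<B>" "\<And>C. C \<in> \<B> \<Longrightarrow> open C"
    "\<And>S. open S \<Longrightarrow> \<exists>U. U \<subseteq> \<B> \<and> S = \<Union>U"
    using univ_second_countable by blast
  have "\<exists>V\<in>\<B>. x \<in> V \<and> V \<subseteq> U" if "open U" "x \<in> U" for U x
  proof -
    obtain \<C> where "\<C> \<subseteq> \<B>" "U = \<Union>\<C>"
      using \<B>(3)[OF \<open>open U\<close>] by blast
    then show ?thesis
      using \<open>x \<in> U\<close> by blast
  qed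
  then show "second_countable (euclidean :: 'a topology)"
    unfolding second_countable_def using \<B>(1,2) by (intro exI[of _ \<B>]) simp
qed

context lagrangean_bundle
begin

abbreviation bundle_atlas where "bundle_atlas \<equiv> cotangent_atlas TYPE('n) M"

lemma bundle_atlasE:
  assumes "c \<in> bundle_atlas"
  obtains D \<phi> where "(D, \<phi>) \<in> charts" "c = (bchart D \<phi>)"
  using assms by (auto simp: cotangent_atlas_def)

lemma bundle_atlasI: "(D, \<phi>) \<in> charts \<Longrightarrow> (bchart D \<phi>) \<in> bundle_atlas"
  by (force simp: cotangent_atlas_def)

lemma overlap_eq:
  assumes c: "(D, \<phi>) \<in> charts" and c1: "(D1, \<phi>1) \<in> charts"
  shows "overlap (bchart D \<phi>) (bchart D1 \<phi>1)
    = {x. base_coord x \<in> {z \<in> D. \<phi> z \<in> \<phi>1 ` D1}}"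
  unfolding overlap_def fst_conv snd_conv image_param[OF c1]
  by (auto simp: cotangent_param_facts[OF c])

lemma transition_eq:
  assumes c: "(D, \<phi>) \<in> charts" and c1: "(D1, \<phi>1) \<in> charts"
    and x: "base_coord x \<in> D" "\<phi> (base_coord x) \<in> \<phi>1 ` D1"
  shows "transition (bchart D \<phi>) (bchart D1 \<phi>1) x
    = chart_coord D1 \<phi>1 (\<phi> (base_coord x)) (chart_eta \<phi> x)"
  using inv_param[OF c1 cotangent_param_facts(3)[OF c x(1)]] cotangent_param_facts(1,2)[OF c x(1)] x(2)
  by (simp add: transition_def)

lemma open_overlap:
  assumes c: "(D, \<phi>) \<in> charts" and c1: "(D1, \<phi>1) \<in> charts"
  shows "open {x :: complex^('n + 'n). base_coord x \<in> {z \<in> D. \<phi> z \<in> \<phi>1 ` D1}}"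
  using open_vimage[OF chart_transition_holomorphic(1)[OF c c1]
      bounded_linear.continuous_on[OF coord_bounded_linear(1) continuous_on_id]]
  by (simp add: vimage_def)

text \<open>The base part is a transition map of M. The fibre part is the target Jacobian applied to
  \<open>chart_eta\<close>, the bundle function that both charts share.\<close>

lemma holomorphic_chart_coord:
  assumes c: "(D, \<phi>) \<in> charts" and c1: "(D1, \<phi>1) \<in> charts"
  shows "holomorphic_map_on (\<lambda>x. chart_coord D1 \<phi>1 (\<phi> (base_coord x)) (chart_eta \<phi> x))
    {x. base_coord x \<in> {z \<in> D. \<phi> z \<in> \<phi>1 ` D1}}"
  unfolding holomorphic_map_on_def
proof
  fix k
  let ?O = "{x :: complex^('n + 'n). base_coord x \<in> {z \<in> D. \<phi> z \<in> \<phi>1 ` D1}}"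
  let ?h = "\<lambda>x :: complex^('n + 'n). inv_into D1 \<phi>1 (\<phi> (base_coord x))"
  have h: "holomorphic_fun_on (\<lambda>x. ?h x $ i) ?O" for i
    using holomorphic_fun_on_compose[OF
        chart_transition_holomorphic(2)[OF c c1, unfolded holomorphic_map_on_def, rule_format, of i]
        holomorphic_base_coord, of ?O] by simp
  then have hmap: "holomorphic_map_on ?h ?O"
    by (simp add: holomorphic_map_on_def)
  have jac: "holomorphic_fun_on (\<lambda>x. jac \<phi>1 (?h x) $ i $ j) ?O" for i j
    by (rule holomorphic_fun_on_compose[OF holomorphic_jac[OF c1] hmap]) (auto intro: inv_into_into)
  have eta: "holomorphic_fun_on (\<lambda>x. chart_eta \<phi> x $ i) ?O" for i
    by (rule holomorphic_fun_on_subset[OF holomorphic_chart_eta[OF c]]) auto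
  show "holomorphic_fun_on (\<lambda>x. chart_coord D1 \<phi>1 (\<phi> (base_coord x)) (chart_eta \<phi> x) $ k) ?O"
  proof (cases k)
    case (Inl i)
    then show ?thesis
      using h[of i] by (simp add: chart_coord_def bundle_coord_def)
  next
    case (Inr i)
    have "holomorphic_fun_on (\<lambda>x. \<Sum>j\<in>UNIV. jac \<phi>1 (?h x) $ i $ j * chart_eta \<phi> x $ j) ?O"
      by (intro holomorphic_fun_on_sum holomorphic_fun_on_mult jac eta)
    then show ?thesis
      using Inr by (simp add: chart_coord_def bundle_coord_def matrix_vector_mult_def)
  qed
qed

lemma complex_atlas: "complex_atlas (cotangent_bundle M) bundle_atlas"
  unfolding complex_atlas_def
proof (intro conjI ballI)
  fix c assume "c \<in> bundle_atlas"
  then show "case c of (D, \<psi>) \<Rightarrow> open D \<and> inj_on \<psi> D"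
    by (elim bundle_atlasE) (simp add: open_dom inj_on_param)
next
  have "\<exists>c\<in>bundle_atlas. p \<in> snd c ` fst c" if p: "p \<in> cotangent_bundle M" for p
  proof -
    have "fst p \<in> M"
      using p by (simp add: bundle_eq)
    then obtain D z and \<phi> :: "complex^'n \<Rightarrow> complex^'v"
      where c: "(D, \<phi>) \<in> charts" "z \<in> D" "fst p = \<phi> z"
      by (rule submanifold_chart_at[OF submanifold])
    then have "p \<in> cotangent_param M \<phi> ` dom D"
      unfolding image_param[OF c(1)] using p by auto
    then show ?thesis
      using bundle_atlasI[OF c(1)] by force
  qed
  moreover have "snd c ` fst c \<subseteq> cotangent_bundle M" if "c \<in> bundle_atlas" for c
    using that by (elim bundle_atlasE) (auto simp: cotangent_param_facts)
  ultimately show "cotangent_bundle M = (\<Union>(D, \<psi>)\<in>bundle_atlas. \<psi> ` D)"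
    unfolding case_prod_beta by blast
next
  fix c c' assume "c \<in> bundle_atlas" "c' \<in> bundle_atlas"
  then obtain D \<phi> D1 \<phi>1 where c: "(D, \<phi>) \<in> charts" "c = (bchart D \<phi>)"
    and c1: "(D1, \<phi>1) \<in> charts" "c' = (bchart D1 \<phi>1)"
    by (metis bundle_atlasE)
  show "open (overlap c c')"
    unfolding c(2) c1(2) overlap_eq[OF c(1) c1(1)] by (rule open_overlap[OF c(1) c1(1)])
  show "holomorphic_map_on (transition c c') (overlap c c')"
    unfolding holomorphic_map_on_def c(2) c1(2) overlap_eq[OF c(1) c1(1)]
  proof
    fix i
    show "holomorphic_fun_on (\<lambda>x. transition (bchart D \<phi>) (bchart D1 \<phi>1) x $ i)
        {x. base_coord x \<in> {z \<in> D. \<phi> z \<in> \<phi>1 ` D1}}"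
      by (rule holomorphic_fun_on_cong[OF open_overlap[OF c(1) c1(1)] _
            holomorphic_chart_coord[OF c(1) c1(1), unfolded holomorphic_map_on_def, rule_format, of i]])
        (simp add: transition_eq[OF c(1) c1(1)])
  qed
qed

lemma continuous_chart_coord:
  assumes c: "(D, \<phi>) \<in> charts"
  shows "continuous_on (\<phi> ` D \<times> UNIV) (\<lambda>(m, \<eta>). chart_coord D \<phi> m \<eta>)"
proof -
  have inv: "continuous_on (\<phi> ` D \<times> UNIV) (\<lambda>p. inv_into D \<phi> (fst p))"
    by (rule continuous_on_compose2[OF submanifold_chartsD(7)[OF c]]) (auto intro!: continuous_intros)
  have jac: "continuous_on (\<phi> ` D \<times> UNIV) (\<lambda>p. jac \<phi> (inv_into D \<phi> (fst p)) $ i $ j)" for i j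
    by (rule continuous_on_compose2[OF holomorphic_fun_on_continuous[OF holomorphic_jac[OF c]] inv])
      (auto intro: inv_into_into)
  have "continuous_on (\<phi> ` D \<times> UNIV) (\<lambda>p. chart_coord D \<phi> (fst p) (snd p) $ k)" for k
  proof (cases k)
    case (Inl i)
    then show ?thesis
      using bounded_linear.continuous_on[OF bounded_linear_vec_nth inv, of i]
        by (simp add: chart_coord_def bundle_coord_def)
  next
    case (Inr i)
    have "continuous_on (\<phi> ` D \<times> UNIV)
        (\<lambda>p. \<Sum>j\<in>UNIV. jac \<phi> (inv_into D \<phi> (fst p)) $ i $ j * snd p $ j)"
      by (intro continuous_intros jac)
    then show ?thesis
      using Inr by (simp add: chart_coord_def bundle_coord_def matrix_vector_mult_def)
  qed
  then have "continuous_on (\<phi> ` D \<times> UNIV) (\<lambda>p. \<chi> k. chart_coord D \<phi> (fst p) (snd p) $ k)"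
    by (rule continuous_on_vec_lambda)
  then show ?thesis
    by (simp add: case_prod_beta)
qed

text \<open>The cotangent bundle is globally trivial, which yields its topology at once.\<close>

lemma homeomorphic_trivial_bundle:
  "homeomorphic_map (manifold_topology (cotangent_bundle M) bundle_atlas) (top_of_set (M \<times> UNIV))
    (\<lambda>p. (fst p, eta p))"
proof (rule bijective_open_imp_homeomorphic_map)
  let ?X = "manifold_topology (cotangent_bundle M) bundle_atlas" and ?\<Theta> = "\<lambda>p. (fst p, eta p)"
  note openin = openin_manifold_topology[OF complex_atlas]
  note top = topspace_manifold_topology[OF complex_atlas]
  show "inj_on ?\<Theta> (topspace ?X)"
    unfolding top by (rule inj_onI, rule trivialization_inj) simp_all
  show img: "?\<Theta> ` topspace ?X = topspace (top_of_set (M \<times> UNIV))"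
  proof -
    have "(m, \<eta>) \<in> ?\<Theta> ` cotangent_bundle M" if "m \<in> M" for m \<eta>
      using covector_in_bundle[OF that, of \<eta>] eta_covector[OF that, of \<eta>]
      by (metis (no_types, lifting) fst_conv image_eqI)
    then show ?thesis
      unfolding top by (auto simp: bundle_eq)
  qed
  show "continuous_map ?X (top_of_set (M \<times> UNIV)) ?\<Theta>"
    unfolding continuous_map_in_subtopology
  proof (intro conjI)
    show "continuous_map ?X euclidean ?\<Theta>"
      unfolding continuous_map top openin
    proof (intro conjI allI impI ballI)
      fix W :: "((complex^'v) \<times> (complex^'n)) set" and c
      assume W: "openin euclidean W" and c: "c \<in> bundle_atlas"
      then obtain D \<phi> where ch: "(D, \<phi>) \<in> charts" and c: "c = (bchart D \<phi>)"
        by (metis bundle_atlasE)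
      have "continuous_on (dom D) (\<lambda>x. chart_eta \<phi> x $ i)" for i
        by (rule holomorphic_fun_on_continuous[OF holomorphic_chart_eta[OF ch]])
      then have "continuous_on (dom D) (\<lambda>x. \<chi> i. chart_eta \<phi> x $ i)"
        by (rule continuous_on_vec_lambda)
      then have "continuous_on (dom D) (\<lambda>x. (\<phi> (base_coord x), chart_eta \<phi> x))"
        using holomorphic_map_on_continuous[OF holomorphic_chart_base[OF ch]]
        by (intro continuous_intros) auto
      then have "open (dom D \<inter> (\<lambda>x. (\<phi> (base_coord x), chart_eta \<phi> x)) -` W)"
        using W open_dom[OF ch] by (intro continuous_open_preimage) auto
      moreover have "{x \<in> dom D. cotangent_param M \<phi> x \<in> {p \<in> cotangent_bundle M. ?\<Theta> p \<in> W}}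
        = dom D \<inter> (\<lambda>x. (\<phi> (base_coord x), chart_eta \<phi> x)) -` W"
        by (auto simp: cotangent_param_facts[OF ch])
      ultimately show "case c of (D, \<psi>) \<Rightarrow> open {z \<in> D. \<psi> z \<in> {p \<in> cotangent_bundle M. ?\<Theta> p \<in> W}}"
        by (simp add: c)
    qed auto
    show "?\<Theta> \<in> topspace ?X \<rightarrow> M \<times> UNIV"
      unfolding top by (auto simp: bundle_eq)
  qed
  show "open_map ?X (top_of_set (M \<times> UNIV)) ?\<Theta>"
    unfolding open_map_def
  proof (intro allI impI)
    fix U assume U: "openin ?X U"
    then have UX: "U \<subseteq> cotangent_bundle M"
      by (simp add: openin)
    show "openin (top_of_set (M \<times> UNIV)) (?\<Theta> ` U)"
    proof (subst openin_subopen, intro ballI)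
      fix q assume "q \<in> ?\<Theta> ` U"
      then obtain p where p: "p \<in> U" "q = ?\<Theta> p"
        by blast
      then have "fst p \<in> M"
        using UX by (auto simp: bundle_eq)
      then obtain D z and \<phi> :: "complex^'n \<Rightarrow> complex^'v" where
        ch: "(D, \<phi>) \<in> charts" and z: "z \<in> D" "fst p = \<phi> z"
        by (rule submanifold_chart_at[OF submanifold])
      define Ob where "Ob = {x \<in> dom D. cotangent_param M \<phi> x \<in> U}"
      have "open Ob"
        using U bundle_atlasI[OF ch] unfolding Ob_def openin by blast
      \<comment> \<open>Over the chart domain, the image of \<open>U\<close> consists of the pairs
        whose chart coordinates lie in \<open>Ob\<close>, and these coordinates depend continuously
        on the pair.\<close>
      then have "openin (top_of_set (\<phi> ` D \<times> UNIV)) (\<phi> ` D \<times> UNIV \<inter> (\<lambda>(m, \<eta>). chart_coord D \<phi> m \<eta>)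
        -` Ob)"
        by (rule continuous_openin_preimage_gen[OF continuous_chart_coord[OF ch]])
      moreover have "openin (top_of_set (M \<times> UNIV)) (\<phi> ` D \<times> (UNIV :: (complex^'n) set))"
        by (intro openin_Times submanifold_chartsD(4)[OF ch]) simp
      ultimately have W: "openin (top_of_set (M \<times> UNIV))
          (\<phi> ` D \<times> UNIV \<inter> (\<lambda>(m, \<eta>). chart_coord D \<phi> m \<eta>) -` Ob)" (is "openin _ ?W")
        by (rule openin_trans)
      have p': "p \<in> cotangent_bundle M" "fst p \<in> \<phi> ` D"
        using p UX z by auto
      have "q \<in> ?W"
        using param_chart_coord[OF ch p'] p p'(2) by (simp add: Ob_def)
      moreover have "?W \<subseteq> ?\<Theta> ` U"
      proof
        fix r assume r: "r \<in> ?W"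
        obtain m \<eta> where mr: "r = (m, \<eta>)"
          by (cases r)
        let ?p = "(m, covector (TM m) \<eta>)"
        have m: "m \<in> \<phi> ` D" "m \<in> M" "chart_coord D \<phi> m \<eta> \<in> Ob"
          using r mr submanifold_chartsD(8)[OF ch] by auto
        have "cotangent_param M \<phi> (chart_coord D \<phi> m \<eta>) = ?p"
          using param_chart_coord(2)[OF ch covector_in_bundle[OF m(2)], of \<eta>] m(1,2) by simp
        then have "?p \<in> U"
          using m(3) by (simp add: Ob_def)
        then show "r \<in> ?\<Theta> ` U"
          using m(2) mr by (intro image_eqI[of _ _ ?p]) simp_all
      qed
      ultimately show "\<exists>T. openin (top_of_set (M \<times> UNIV)) T \<and> q \<in> T \<and> T \<subseteq> ?\<Theta> ` U"
        using W by blast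
    qed
  qed
qed

text \<open>The topological conditions are inherited by the subset M \<times> complex^'n of a
  Euclidean space and pass to the bundle through the trivialization.\<close>

lemma complex_manifold: "complex_manifold (cotangent_bundle M) bundle_atlas"
  unfolding complex_manifold_def
  using complex_atlas homeomorphic_map_imp_homeomorphic_space[OF homeomorphic_trivial_bundle]
    homeomorphic_Hausdorff_space homeomorphic_space_second_countability second_countable_top_of_set
    Hausdorff_space_subtopology[OF Hausdorff_space_euclidean]
  by metis

end

section \<open>The linear algebra of a hyper Kaehler frame\<close>

definition Omega :: "complex^('n::finite + 'n) \<Rightarrow> complex^('n + 'n) \<Rightarrow> complex" where
  "Omega u v = base_coord u \<odot> fibre_coord v - fibre_coord u \<odot> base_coord v"

lemma standard_symplectic_eq: "standard_symplectic c x u v = Omega u v"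
  by (simp add: standard_symplectic_def Omega_def cdot_def base_coord_def fibre_coord_def sum_subtractf)

lemma Omega_linear:
  "Omega (u + v) w = Omega u w + Omega v w" "Omega (c *s u) w = c * Omega u w"
  "Omega w (u + v) = Omega w u + Omega w v" "Omega w (c *s u) = c * Omega w u"
  by (simp_all add: Omega_def algebra_simps)

lemma coord_cvec: "base_coord (cvec u) = cvec (base_coord u)"
  "fibre_coord (cvec u) = cvec (fibre_coord u)"
  by (simp_all add: base_coord_def fibre_coord_def vec_eq_iff)

lemma cnj_Omega: "cnj (Omega u v) = Omega (cvec u) (cvec v)"
  by (simp add: Omega_def cnj_cdot coord_cvec)

lemma cdot_coord: "u \<odot> v = base_coord u \<odot> base_coord v + fibre_coord u \<odot> fibre_coord v"
  unfolding cdot_def UNIV_sum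
  by (subst sum.union_disjoint) (auto simp: sum.reindex base_coord_def fibre_coord_def)

lemma Omega_eq_cdot: "Omega u v = u \<odot> bundle_coord (fibre_coord v) (- base_coord v)"
  by (simp add: Omega_def cdot_coord)

lemma Omega_rotate:
  "Omega (bundle_coord (fibre_coord u) (- base_coord u)) (bundle_coord (fibre_coord v) (- base_coord
    v)) = Omega u v"
  by (simp add: Omega_def cdot_commute)

lemma Omega_nondegenerate:
  assumes "\<And>v. Omega u v = 0"
  shows "u = 0"
proof (rule cdot_eqI)
  fix c
  have "Omega u (bundle_coord (- fibre_coord c) (base_coord c)) = u \<odot> c"
    by (simp add: Omega_eq_cdot)
  then show "u \<odot> c = 0 \<odot> c"
    by (simp add: assms)
qed

lemma complex_symplectic_Omega: "complex_symplectic_form (Omega :: complex^('n::finite + 'n) \<Rightarrow> _)"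
proof -
  have "Omega u u = 0" for u :: "complex^('n + 'n)"
    by (simp add: Omega_def cdot_commute)
  moreover have "nondegenerate_on UNIV (Omega :: complex^('n + 'n) \<Rightarrow> _)"
    unfolding nondegenerate_on_def by (intro ballI impI Omega_nondegenerate) simp
  ultimately show ?thesis
    by (simp add: complex_symplectic_form_def complex_bilinear_def clinear_iff Omega_linear)
qed

text \<open>The situation at one point of the bundle: \<open>\<alpha>\<close> and
  \<open>\<beta>\<close> stand for the holomorphic derivatives of q and s, and \<open>Y\<close> for
  the Gram matrix of the base.\<close>

locale hyperkaehler_frame =
  fixes \<alpha> \<beta> :: "complex^('n::finite + 'n) \<Rightarrow> complex^'n" and Y :: "complex^'n^'n"
  assumes \<alpha>_add [simp]: "\<alpha> (u + v) = \<alpha> u + \<alpha> v" and \<alpha>_smult [simp]: "\<alpha> (c *s u) = c *s \<alpha> u"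
    and \<beta>_add [simp]: "\<beta> (u + v) = \<beta> u + \<beta> v" and \<beta>_smult [simp]: "\<beta> (c *s u) = c *s \<beta> u"
    and Y_symmetric: "Y $ i $ j = Y $ j $ i" and Y_real: "cnj (Y $ i $ j) = Y $ i $ j"
    and det_Y: "det Y \<noteq> 0"
    and Omega_frame: "Omega u v = \<alpha> u \<odot> (Y *v \<beta> v) - (Y *v \<beta> u) \<odot> \<alpha> v"
begin

definition inner_Y :: "complex^'n \<Rightarrow> complex^'n \<Rightarrow> complex" where
  "inner_Y a b = a \<odot> (Y *v cvec b)"

definition G :: "complex^('n + 'n) \<Rightarrow> complex^('n + 'n) \<Rightarrow> complex" where
  "G u v = inner_Y (\<alpha> u) (\<alpha> v) + 2 * inner_Y (\<beta> u) (\<beta> v)"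

lemma Y_linear [simp]:
  "Y *v (a + b) = Y *v a + Y *v b" "Y *v (a - b) = Y *v a - Y *v b" "Y *v (c *s a) = c *s (Y *v a)"
  "Y *v (- a) = - (Y *v a)" "Y *v 0 = 0"
  by (simp_all add: matrix_vector_mult_def vec_eq_iff algebra_simps sum.distrib sum_subtractf
    sum_distrib_left sum_negf)

lemma cdot_Y: "(Y *v a) \<odot> b = a \<odot> (Y *v b)"
proof -
  have "transpose Y = Y"
    by (simp add: vec_eq_iff transpose_def Y_symmetric)
  then show ?thesis
    using cdot_matrix[of Y] by simp
qed

lemma cvec_Y: "cvec (Y *v a) = Y *v cvec a"
  by (simp add: vec_eq_iff matrix_vector_mult_def Y_real)

lemma inner_Y_linear:
  "inner_Y (a + b) c = inner_Y a c + inner_Y b c" "inner_Y (k *s a) c = k * inner_Y a c"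
  "inner_Y c (a + b) = inner_Y c a + inner_Y c b" "inner_Y c (k *s a) = cnj k * inner_Y c a"
  by (simp_all add: inner_Y_def)

lemma inner_Y_hermitian: "inner_Y b a = cnj (inner_Y a b)"
proof -
  have "cnj (inner_Y a b) = cvec a \<odot> (Y *v b)"
    by (simp add: inner_Y_def cnj_cdot cvec_Y)
  then show ?thesis
    by (simp add: inner_Y_def cdot_commute[of "cvec a"] cdot_Y)
qed

lemma \<alpha>\<beta>_0 [simp]: "\<alpha> 0 = 0" "\<beta> 0 = 0"
  using \<alpha>_smult[of 0 0] \<beta>_smult[of 0 0] by simp_all

lemma \<alpha>\<beta>_diff [simp]: "\<alpha> (u - v) = \<alpha> u - \<alpha> v" "\<beta> (u - v) = \<beta> u - \<beta> v"
  using \<alpha>_add[of "u - v" v] \<beta>_add[of "u - v" v] by simp_all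

lemma \<alpha>\<beta>_minus [simp]: "\<alpha> (- u) = - \<alpha> u" "\<beta> (- u) = - \<beta> u"
  using \<alpha>\<beta>_diff[of 0 u] by simp_all

text \<open>\<open>Omega_frame\<close> expresses \<open>Omega\<close> through
  \<open>\<alpha>\<close> and \<open>\<beta>\<close>, so a common kernel vector would be degenerate
  for \<open>Omega\<close>.\<close>

lemma frame_inj: "\<alpha> u = \<alpha> v \<Longrightarrow> \<beta> u = \<beta> v \<Longrightarrow> u = v"
  using Omega_nondegenerate[of "u - v"] by (simp add: Omega_frame)

lemma frame_surj: "\<exists>u. \<alpha> u = a \<and> \<beta> u = b"
proof -
  let ?f = "\<lambda>u. bundle_coord (\<alpha> u) (\<beta> u)"
  have lin: "Vector_Spaces.linear (*s) (*s) ?f"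
    unfolding clinear_vec_iff by (auto intro!: coord_eqI)
  have "inj ?f"
    by (rule injI) (metis bundle_coord(1,2) frame_inj)
  then have "surj ?f"
    by (rule vec.linear_injective_imp_surjective[OF lin]) (rule refl)
  then obtain u where "bundle_coord a b = ?f u"
    by blast
  then show ?thesis
    by (metis bundle_coord(1,2))
qed

lemma G_linear:
  "G (u + v) w = G u w + G v w" "G (c *s u) w = c * G u w"
  "G w (u + v) = G w u + G w v" "G w (c *s u) = cnj c * G w u"
  by (simp_all add: G_def inner_Y_linear algebra_simps)

lemma G_hermitian: "G v u = cnj (G u v)"
  unfolding G_def using inner_Y_hermitian[of "\<alpha> u" "\<alpha> v"] inner_Y_hermitian[of "\<beta> u" "\<beta> v"] by simp

lemma hermitian_form_G: "hermitian_form G"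
  unfolding hermitian_form_def clinear_iff by (auto simp: G_linear intro: G_hermitian)

text \<open>Up to scale, the antilinear map \<open>J\<close> with \<open>G u (J v) = Omega u v\<close> is the second complex
  structure.\<close>

lemma quaternionic_structure:
  obtains J where "\<And>u v. G u (J v) = Omega u v" "\<And>v. J (J v) = (-1/2) *s v"
    "\<And>u v. Omega (J u) (J v) = cnj (Omega u v) / 2"
proof -
  \<comment> \<open>The values are found by comparing \<open>G u (J v)\<close> with
    \<open>Omega_frame\<close>: conjugation undoes the antilinearity of \<open>G\<close>, and 1/2
    cancels the weight of the second block.\<close>
  have "\<forall>v. \<exists>w. \<alpha> w = cvec (\<beta> v) \<and> \<beta> w = (-1/2) *s cvec (\<alpha> v)"
    using frame_surj by blast
  then obtain J where J [simp]: "\<alpha> (J v) = cvec (\<beta> v)" "\<beta> (J v) = (-1/2) *s cvec (\<alpha> v)" for v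
    by metis
  show thesis
  proof
    show "G u (J v) = Omega u v" for u v
      by (simp add: G_def inner_Y_def Omega_frame cdot_Y)
    show "J (J v) = (-1/2) *s v" for v
      by (rule frame_inj) (simp_all add: vec_eq_iff)
    show "Omega (J u) (J v) = cnj (Omega u v) / 2" for u v
      by (simp add: Omega_frame cnj_cdot cvec_Y cdot_Y algebra_simps)
  qed
qed

lemma nondegenerate_G: "nondegenerate_on UNIV G"
proof -
  obtain J where J: "\<And>u v. G u (J v) = Omega u v" "\<And>v. J (J v) = (-1/2) *s v"
    "\<And>u v. Omega (J u) (J v) = cnj (Omega u v) / 2"
    using quaternionic_structure by metis
  have "u = 0" if "\<And>v. G u v = 0" for u
    by (rule Omega_nondegenerate) (simp add: that flip: J(1))
  then show ?thesis
    by (auto simp: nondegenerate_on_def)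
qed

text \<open>The matrix of \<open>G\<close> as a linear map of the coordinate space, so that
  derivatives of the metric become derivatives of vector valued functions.\<close>

definition flat :: "complex^('n + 'n) \<Rightarrow> complex^('n + 'n)" where
  "flat u = (\<chi> k. G u (axis k 1))"

lemma G_eq_flat: "G u v = flat u \<odot> cvec v"
proof -
  have *: "G u (\<Sum>k\<in>I. f k) = (\<Sum>k\<in>I. G u (f k))" for f :: "'n + 'n \<Rightarrow> _" and I
    using G_linear(4)[of u 0 0] by (induction I rule: infinite_finite_induct) (simp_all add: G_linear)
  have "G u v = (\<Sum>k\<in>UNIV. cnj (v $ k) * G u (axis k 1))"
    using arg_cong[OF basis_expansion[of v, symmetric], of "G u"] by (simp add: * G_linear)
  then show ?thesis
    by (simp add: flat_def cdot_def mult.commute)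
qed

lemma flat_linear: "flat (u + v) = flat u + flat v" "flat (c *s u) = c *s flat u"
  by (simp_all add: flat_def vec_eq_iff G_linear)

lemma flat_bij: "bij flat"
proof -
  have lin: "Vector_Spaces.linear (*s) (*s) flat"
    by (simp add: clinear_vec_iff flat_linear)
  have "flat u = flat v \<Longrightarrow> u = v" for u v
  proof -
    assume "flat u = flat v"
    then have "G (u + (-1) *s v) w = 0" for w
      unfolding G_linear by (simp add: G_eq_flat)
    then have "u + (-1) *s v = 0"
      using nondegenerate_G by (metis UNIV_I nondegenerate_on_def)
    then show "u = v"
      by (simp add: vec_eq_iff)
  qed
  then have "inj flat"
    by (rule injI)
  moreover from this have "surj flat"
    by (rule vec.linear_injective_imp_surjective[OF lin]) (rule refl)
  ultimately show ?thesis
    by (simp add: bij_def)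
qed

text \<open>The matrix of \<open>G\<close> is symplectic up to the factor \<open>2\<close>.  This is the algebraic reason why
  \<open>Omega\<close> is parallel.\<close>

lemma Omega_flat: "Omega (flat u) (flat v) = 2 * Omega u v"
proof -
  obtain J where J: "\<And>u v. G u (J v) = Omega u v" "\<And>v. J (J v) = (-1/2) *s v"
    "\<And>u v. Omega (J u) (J v) = cnj (Omega u v) / 2"
    using quaternionic_structure by metis
  let ?R = "\<lambda>u. bundle_coord (fibre_coord u) (- base_coord u)"
  \<comment> \<open>Lowering an index with \<open>G\<close> after \<open>J\<close> amounts to
    lowering it with \<open>Omega\<close>, up to conjugation, and that is a constant rotation
    \<open>?R\<close>.\<close>
  have flat_J: "flat (J u) = ?R (cvec u)" for u
  proof (rule cdot_eqI)
    fix c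
    have "flat (J u) \<odot> c = G (J u) (cvec c)"
      by (simp add: G_eq_flat)
    also have "\<dots> = cnj (Omega (cvec c) u)"
      using G_hermitian[of "J u" "cvec c"] J(1) by simp
    also have "\<dots> = ?R (cvec u) \<odot> c"
      by (simp only: cnj_Omega cvec_linear(6)) (simp only: Omega_eq_cdot cdot_commute)
    finally show "flat (J u) \<odot> c = ?R (cvec u) \<odot> c" .
  qed
  \<comment> \<open>From u = -2 J (J u). In the final identity the square 4 of this factor meets the
    1/2 by which \<open>J\<close> scales \<open>Omega\<close>.\<close>
  have "flat u = (-2) *s ?R (cvec (J u))" for u
  proof -
    have "flat u = flat ((-2) *s J (J u))"
      unfolding J(2) by simp
    then show ?thesis
      unfolding flat_linear flat_J .
  qed
  then have "Omega (flat u) (flat v) = 4 * Omega (cvec (J u)) (cvec (J v))"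
    by (simp only: Omega_linear Omega_rotate) simp
  also have "\<dots> = 4 * cnj (Omega (J u) (J v))"
    by (simp add: cnj_Omega)
  also have "\<dots> = 2 * Omega u v"
    by (simp add: J(3))
  finally show ?thesis .
qed

lemma positive_definite_G:
  assumes "positive_definite_on UNIV inner_Y"
  shows "positive_definite_on UNIV G"
  unfolding positive_definite_on_def
proof (intro ballI impI)
  fix u :: "complex^('n + 'n)" assume "u \<noteq> 0"
  then have ne: "\<alpha> u \<noteq> 0 \<or> \<beta> u \<noteq> 0"
    using frame_inj[of u 0] by auto
  have pos: "inner_Y a a \<in> \<real>" "0 \<le> Re (inner_Y a a)" "a \<noteq> 0 \<Longrightarrow> 0 < Re (inner_Y a a)" for a
    using assms by (cases "a = 0"; force simp: positive_definite_on_def inner_Y_def)+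
  show "G u u \<in> \<real> \<and> 0 < Re (G u u)"
    using ne pos[of "\<alpha> u"] pos[of "\<beta> u"] unfolding G_def by (auto simp: add_pos_nonneg add_nonneg_pos)
qed

text \<open>The pair of \<open>\<alpha>\<close> and \<open>\<beta>\<close> identifies the space with
  two copies of complex^'n, and the set in question with two copies of \<open>S\<close>.\<close>

lemma frame_subspace:
  assumes "vec.subspace S"
  shows "vec.subspace {u. \<alpha> u \<in> S \<and> \<beta> u \<in> S}" "vec.dim {u. \<alpha> u \<in> S \<and> \<beta> u \<in> S} = 2 * vec.dim S"
proof -
  let ?A = "{u. \<alpha> u \<in> S \<and> \<beta> u = 0}" and ?B = "{u. \<alpha> u = 0 \<and> \<beta> u \<in> S}"
  have sub: "0 \<in> S" "\<And>x y. x \<in> S \<Longrightarrow> y \<in> S \<Longrightarrow> x + y \<in> S" "\<And>c x. x \<in> S \<Longrightarrow> c *s x \<in> S"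
    using assms vec.subspace_0 vec.subspace_add vec.subspace_scale by blast+
  show "vec.subspace {u. \<alpha> u \<in> S \<and> \<beta> u \<in> S}"
    unfolding vec.subspace_def by (auto simp: sub)
  have A: "vec.subspace ?A" and B: "vec.subspace ?B"
    unfolding vec.subspace_def by (auto simp: sub)
  have "vec.dim ?A = vec.dim (\<alpha> ` ?A)" "vec.dim ?B = vec.dim (\<beta> ` ?B)"
    using A B by (auto intro!: vec.dim_image_eq[symmetric] inj_onI frame_inj
        simp: clinear_vec_iff vec.span_eq_iff[THEN iffD2])
  moreover have "\<alpha> ` ?A = S" "\<beta> ` ?B = S"
    using frame_surj sub(1) by (auto simp: image_iff) metis+
  ultimately have dims: "vec.dim ?A = vec.dim S" "vec.dim ?B = vec.dim S"
    by simp_all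
  have "{u. \<alpha> u \<in> S \<and> \<beta> u \<in> S} = {x + y |x y. x \<in> ?A \<and> y \<in> ?B}"
  proof (intro set_eqI iffI)
    fix u assume u: "u \<in> {u. \<alpha> u \<in> S \<and> \<beta> u \<in> S}"
    obtain x where x: "\<alpha> x = \<alpha> u" "\<beta> x = 0"
      using frame_surj by blast
    obtain y where y: "\<alpha> y = 0" "\<beta> y = \<beta> u"
      using frame_surj by blast
    have "u = x + y"
      by (rule frame_inj) (simp_all add: x y)
    moreover have "x \<in> ?A" "y \<in> ?B"
      using x y u by simp_all
    ultimately show "u \<in> {x + y |x y. x \<in> ?A \<and> y \<in> ?B}"
      by blast
  qed auto
  moreover have "?A \<inter> ?B = {0}"
    by (auto intro: frame_inj simp: sub)
  ultimately show "vec.dim {u. \<alpha> u \<in> S \<and> \<beta> u \<in> S} = 2 * vec.dim S"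
    using vec.dim_sums_Int[OF A B] dims by simp
qed

text \<open>In this identification \<open>G\<close> is the orthogonal sum of \<open>inner_Y\<close>
  and its double, so a splitting into definite parts is used in both copies.\<close>

lemma signature_G:
  assumes "has_signature UNIV inner_Y k l"
  shows "has_signature UNIV G (2 * k) (2 * l)"
proof -
  obtain P N where PN: "vec.subspace P" "vec.subspace N" "UNIV = {u + v |u v. u \<in> P \<and> v \<in> N}"
    "P \<inter> N = {0}"
    "\<forall>u\<in>P. \<forall>v\<in>N. inner_Y u v = 0" "positive_definite_on P inner_Y"
    "positive_definite_on N (\<lambda>u v. - inner_Y u v)" "vec.dim P = k" "vec.dim N = l"
    using assms by (auto simp: has_signature_def)
  let ?P = "{u. \<alpha> u \<in> P \<and> \<beta> u \<in> P}" and ?N = "{u. \<alpha> u \<in> N \<and> \<beta> u \<in> N}"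
  have sum: "\<exists>p\<in>?P. \<exists>n\<in>?N. w = p + n" for w
  proof -
    obtain a a' where a: "\<alpha> w = a + a'" "a \<in> P" "a' \<in> N"
      using PN(3) by blast
    obtain b b' where b: "\<beta> w = b + b'" "b \<in> P" "b' \<in> N"
      using PN(3) by blast
    obtain p where p: "\<alpha> p = a" "\<beta> p = b"
      using frame_surj by blast
    obtain n where n: "\<alpha> n = a'" "\<beta> n = b'"
      using frame_surj by blast
    have "w = p + n"
      by (rule frame_inj) (simp_all add: a b p n)
    then show ?thesis
      using a b p n by auto
  qed
  have int: "?P \<inter> ?N = {0}"
  proof (intro set_eqI iffI)
    fix u assume "u \<in> ?P \<inter> ?N"
    then have "\<alpha> u \<in> {0}" "\<beta> u \<in> {0}"
      unfolding PN(4)[symmetric] by auto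
    then show "u \<in> {0}"
      using frame_inj[of u 0] by simp
  qed (use PN vec.subspace_0 in auto)
  have orth: "\<forall>u\<in>?P. \<forall>v\<in>?N. G u v = 0"
    using PN(5) by (simp add: G_def)
  have pos: "G u u \<in> \<real> \<and> 0 < Re (G u u)" if "u \<in> ?P" "u \<noteq> 0" for u
  proof -
    have pos: "inner_Y a a \<in> \<real>" "0 \<le> Re (inner_Y a a)" "a \<noteq> 0 \<Longrightarrow> 0 < Re (inner_Y a a)" if "a \<in> P" for a
      using PN(6) that by (cases "a = 0"; force simp: positive_definite_on_def inner_Y_def)+
    have "\<alpha> u \<noteq> 0 \<or> \<beta> u \<noteq> 0"
      using frame_inj[of u 0] that by auto
    then show ?thesis
      using that(1) pos[of "\<alpha> u"] pos[of "\<beta> u"] unfolding G_def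
        by (auto simp: add_pos_nonneg add_nonneg_pos)
  qed
  have neg: "- G u u \<in> \<real> \<and> 0 < Re (- G u u)" if "u \<in> ?N" "u \<noteq> 0" for u
  proof -
    have neg: "inner_Y a a \<in> \<real>" "Re (inner_Y a a) \<le> 0" "a \<noteq> 0 \<Longrightarrow> Re (inner_Y a a) < 0" if "a \<in> N" for a
      using PN(7) that by (cases "a = 0"; force simp: positive_definite_on_def inner_Y_def)+
    have "\<alpha> u \<noteq> 0 \<or> \<beta> u \<noteq> 0"
      using frame_inj[of u 0] that by auto
    then show ?thesis
      using that(1) neg[of "\<alpha> u"] neg[of "\<beta> u"] unfolding G_def
        by (auto simp: add_neg_nonpos add_nonpos_neg)
  qed
  show ?thesis
    unfolding has_signature_def
  proof (rule exI[of _ ?P], rule exI[of _ ?N], intro conjI frame_subspace(1) PN(1,2) int orth)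
    show "UNIV = {u + v |u v. u \<in> ?P \<and> v \<in> ?N}"
    proof (intro set_eqI iffI UNIV_I CollectI)
      fix w
      obtain p n where "p \<in> ?P" "n \<in> ?N" "w = p + n"
        using sum[of w] by blast
      then show "\<exists>u v. w = u + v \<and> u \<in> ?P \<and> v \<in> ?N"
        by (intro exI[of _ p] exI[of _ n] conjI)
    qed
    show "positive_definite_on ?P G" "positive_definite_on ?N (\<lambda>u v. - G u v)"
      unfolding positive_definite_on_def using pos neg by (intro ballI impI; simp)+
    show "vec.dim ?P = 2 * k" "vec.dim ?N = 2 * l"
      using frame_subspace(2)[OF PN(1)] frame_subspace(2)[OF PN(2)] PN(8,9) by simp_all
  qed
qed

end

lemma has_signature_image:
  fixes f :: "complex^'v \<Rightarrow> complex^'w"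
  assumes sig: "has_signature S h k l" and lin: "Vector_Spaces.linear (*s) (*s) f" and inj: "inj_on f S"
    and h: "\<And>u v. u \<in> S \<Longrightarrow> v \<in> S \<Longrightarrow> h' (f u) (f v) = h u v"
  shows "has_signature (f ` S) h' k l"
proof -
  obtain P N where PN: "vec.subspace P" "vec.subspace N" "S = {u + v |u v. u \<in> P \<and> v \<in> N}" "P \<inter> N = {0}"
    "\<forall>u\<in>P. \<forall>v\<in>N. h u v = 0" "positive_definite_on P h"
    "positive_definite_on N (\<lambda>u v. - h u v)" "vec.dim P = k" "vec.dim N = l"
    using sig by (auto simp: has_signature_def)
  have f: "f (u + v) = f u + f v" "f (c *s u) = c *s f u" for u v c
    using lin by (auto simp: clinear_vec_iff)
  have f0: "f 0 = 0"
    using f(2)[of 0 0] by simp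
  have sub: "P \<subseteq> S" "N \<subseteq> S"
  proof -
    show "P \<subseteq> S"
      using PN(3) vec.subspace_0[OF PN(2)] by force
    show "N \<subseteq> S"
      using PN(3) vec.subspace_0[OF PN(1)] by force
  qed
  have "f ` S = {u + v |u v. u \<in> f ` P \<and> v \<in> f ` N}"
  proof (intro set_eqI iffI)
    fix w assume "w \<in> f ` S"
    then obtain u v where "u \<in> P" "v \<in> N" "w = f u + f v"
      unfolding PN(3) using f(1) by auto
    then show "w \<in> {u + v |u v. u \<in> f ` P \<and> v \<in> f ` N}"
      by blast
  next
    fix w assume "w \<in> {u + v |u v. u \<in> f ` P \<and> v \<in> f ` N}"
    then obtain u v where "u \<in> P" "v \<in> N" "w = f (u + v)"
      using f(1) by auto
    then show "w \<in> f ` S"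
      unfolding PN(3) by blast
  qed
  moreover have "f ` P \<inter> f ` N = {0}"
    using sub PN(4) inj f0 inj_on_image_Int[OF inj sub] by simp
  moreover have "vec.dim (f ` P) = k" "vec.dim (f ` N) = l"
    using PN(8,9) sub inj PN(1,2)
    by (metis vec.dim_image_eq[OF lin] inj_on_subset vec.span_eq_iff)+
  moreover have "\<forall>u\<in>f ` P. \<forall>v\<in>f ` N. h' u v = 0"
    using PN(5) h sub by (auto simp: subset_iff)
  moreover have "positive_definite_on (f ` P) h'" "positive_definite_on (f ` N) (\<lambda>u v. - h' u v)"
    using PN(6,7) h sub f0 unfolding positive_definite_on_def by (fastforce simp: subset_iff)+
  ultimately show ?thesis
    unfolding has_signature_def
    using vec.linear_subspace_image[OF lin PN(1)] vec.linear_subspace_image[OF lin PN(2)]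
    by (intro exI[of _ "f ` P"] exI[of _ "f ` N"]) simp
qed

section \<open>The potential in special coordinates\<close>

definition wvec :: "(complex^'k \<Rightarrow> complex^'m) \<Rightarrow> complex^'k \<Rightarrow> complex^'k \<Rightarrow> complex^'m" where
  "wvec a x u = (\<chi> i. wirt (\<lambda>x. a x $ i) x u)"

definition wvec_bar :: "(complex^'k \<Rightarrow> complex^'m) \<Rightarrow> complex^'k \<Rightarrow> complex^'k \<Rightarrow> complex^'m" where
  "wvec_bar a x u = (\<chi> i. wirt_bar (\<lambda>x. a x $ i) x u)"

definition wmat :: "(complex^'k \<Rightarrow> complex^'m^'n) \<Rightarrow> complex^'k \<Rightarrow> complex^'k \<Rightarrow> complex^'m^'n" where
  "wmat A x u = (\<chi> i j. wirt (\<lambda>x. A x $ i $ j) x u)"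

definition wmat_bar :: "(complex^'k \<Rightarrow> complex^'m^'n) \<Rightarrow> complex^'k \<Rightarrow> complex^'k \<Rightarrow> complex^'m^'n" where
  "wmat_bar A x u = (\<chi> i j. wirt_bar (\<lambda>x. A x $ i $ j) x u)"

definition cmat :: "complex^'m^'n \<Rightarrow> complex^'m^'n" where
  "cmat A = (\<chi> i j. cnj (A $ i $ j))"

lemma cmat_mult_cvec: "cmat A *v cvec b = cvec (A *v b)"
  by (simp add: cmat_def vec_eq_iff matrix_vector_mult_def)

lemma wvec_cong:
  assumes "open D" "x \<in> D" "\<And>y. y \<in> D \<Longrightarrow> a y = b y"
  shows "wvec a x = wvec b x" "wvec_bar a x = wvec_bar b x"
proof -
  have "wirt (\<lambda>y. a y $ i) x = wirt (\<lambda>y. b y $ i) x"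
    "wirt_bar (\<lambda>y. a y $ i) x = wirt_bar (\<lambda>y. b y $ i) x" for i
    by (rule wirt_cong[OF assms(1,2)] wirt_bar_cong[OF assms(1,2)]; simp add: assms(3))+
  then show "wvec a x = wvec b x" "wvec_bar a x = wvec_bar b x"
    by (simp_all add: wvec_def wvec_bar_def fun_eq_iff)
qed

lemma wirt_cdot:
  assumes "\<And>i. (\<lambda>x. a x $ i) differentiable (at x)" "\<And>i. (\<lambda>x. b x $ i) differentiable (at x)"
  shows "wirt (\<lambda>x. a x \<odot> b x) x u = a x \<odot> wvec b x u + wvec a x u \<odot> b x"
    and "wirt_bar (\<lambda>x. a x \<odot> b x) x u = a x \<odot> wvec_bar b x u + wvec_bar a x u \<odot> b x"
  using assms
  by (simp_all add: cdot_def wirt_sum wirt_mult wvec_def wvec_bar_def sum.distrib)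

lemma wvec_matrix:
  fixes A :: "complex^'k \<Rightarrow> complex^'m^'n"
  assumes "\<And>i j. (\<lambda>x. A x $ i $ j) differentiable (at x)" "\<And>i. (\<lambda>x. b x $ i) differentiable (at x)"
  shows "wvec (\<lambda>x. A x *v b x) x u = A x *v wvec b x u + wmat A x u *v b x"
    and "wvec_bar (\<lambda>x. A x *v b x) x u = A x *v wvec_bar b x u + wmat_bar A x u *v b x"
  using assms
  by (simp_all add: vec_eq_iff matrix_vector_mult_def wirt_sum wirt_mult wvec_def wvec_bar_def
      wmat_def wmat_bar_def sum.distrib)

lemma wvec_cvec:
  assumes "\<And>i. (\<lambda>x. a x $ i) differentiable (at x)"
  shows "wvec (\<lambda>x. cvec (a x)) x u = cvec (wvec_bar a x u)"
    "wvec_bar (\<lambda>x. cvec (a x)) x u = cvec (wvec a x u)"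
  using assms by (simp_all add: vec_eq_iff wvec_def wvec_bar_def wirt_cnj)

lemma wvec_add:
  assumes "\<And>i. (\<lambda>x. a x $ i) differentiable (at x)" "\<And>i. (\<lambda>x. b x $ i) differentiable (at x)"
  shows "wvec (\<lambda>x. a x + b x) x u = wvec a x u + wvec b x u"
    and "wvec_bar (\<lambda>x. a x + b x) x u = wvec_bar a x u + wvec_bar b x u"
  using assms by (simp_all add: vec_eq_iff wvec_def wvec_bar_def wirt_add)

lemma wvec_linear:
  assumes "\<And>i. (\<lambda>x. a x $ i) differentiable (at x)"
  shows "wvec a x (u + v) = wvec a x u + wvec a x v" "wvec a x (c *s u) = c *s wvec a x u"
  using assms by (simp_all add: vec_eq_iff wvec_def wirt_linear)

lemma wvec_holomorphic:
  assumes "\<And>i. holomorphic_fun_on (\<lambda>x. a x $ i) D" "x \<in> D"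
  shows "wvec_bar a x u = 0"
  using wirt_holomorphic(2)[OF assms] by (simp add: vec_eq_iff wvec_bar_def)

text \<open>What remains of special coordinates in an arbitrary bundle chart: q and \<eta> are
  holomorphic functions of the chart coordinates for which \<open>Omega\<close> has its standard
  shape, and \<open>S\<close> is the slope relating dp to dq.\<close>

locale special_coordinates =
  fixes X :: "(complex^('n::finite + 'n)) set" and q p \<eta> :: "complex^('n + 'n) \<Rightarrow> complex^'n"
    and S :: "complex^('n + 'n) \<Rightarrow> complex^'n^'n" and K :: "complex^('n + 'n) \<Rightarrow> complex"
  assumes open_X: "open X"
    and hol_q: "holomorphic_fun_on (\<lambda>x. q x $ i) X" and hol_p: "holomorphic_fun_on (\<lambda>x. p x $ i) X"
    and hol_\<eta>: "holomorphic_fun_on (\<lambda>x. \<eta> x $ i) X" and hol_S: "holomorphic_fun_on (\<lambda>x. S x $ i $ j) X"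
    and S_symmetric: "x \<in> X \<Longrightarrow> S x $ i $ j = S x $ j $ i"
    and dp_eq: "x \<in> X \<Longrightarrow> wvec p x u = S x *v wvec q x u"
    and det_Y: "x \<in> X \<Longrightarrow> det (imaginary_part (S x)) \<noteq> 0"
    and Omega_eq: "x \<in> X \<Longrightarrow> Omega u v = wvec q x u \<odot> wvec \<eta> x v - wvec \<eta> x u \<odot> wvec q x v"
    and K_eq: "x \<in> X \<Longrightarrow> K x = \<i> * (q x \<odot> cvec (p x) - p x \<odot> cvec (q x))
      + (\<eta> x + cvec (\<eta> x)) \<odot> linear_solve (imaginary_part (S x)) (\<eta> x + cvec (\<eta> x))"
begin

abbreviation Y where "Y x \<equiv> imaginary_part (S x)"
abbreviation t where "t x \<equiv> \<eta> x + cvec (\<eta> x)"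

definition s :: "complex^('n + 'n) \<Rightarrow> complex^'n" where
  "s x = linear_solve (Y x) (t x)"

lemmas smooth_hol = holomorphic_fun_on_smooth[OF open_X]

lemma smooth_q: "smooth_on (\<lambda>x. q x $ i) X" and smooth_p: "smooth_on (\<lambda>x. p x $ i) X"
  and smooth_\<eta>: "smooth_on (\<lambda>x. \<eta> x $ i) X" and smooth_S: "smooth_on (\<lambda>x. S x $ i $ j) X"
  by (rule smooth_hol, rule hol_q hol_p hol_\<eta> hol_S)+

lemma smooth_t: "smooth_on (\<lambda>x. t x $ i) X"
  using smooth_on_add[OF open_X smooth_\<eta> smooth_on_cnj[OF open_X smooth_\<eta>]] by simp

lemma smooth_Y: "smooth_on (\<lambda>x. Y x $ i $ j) X"
proof -
  have "smooth_on (\<lambda>x. \<i> * (cnj (S x $ i $ j) - S x $ i $ j)) X"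
    by (intro smooth_on_mult smooth_on_diff smooth_on_cnj smooth_on_const smooth_S open_X)
  then show ?thesis
    by (simp add: imaginary_part_def)
qed

lemma smooth_s: "smooth_on (\<lambda>x. s x $ i) X"
  unfolding s_def by (intro smooth_on_linear_solve open_X smooth_Y smooth_t det_Y)

lemma smooth_cdot:
  assumes "\<And>i. smooth_on (\<lambda>x. a x $ i) X" "\<And>i. smooth_on (\<lambda>x. b x $ i) X"
  shows "smooth_on (\<lambda>x. a x \<odot> b x) X"
  unfolding cdot_def by (intro smooth_on_sum smooth_on_mult assms open_X)

lemma smooth_cvec: "(\<And>i. smooth_on (\<lambda>x. a x $ i) X) \<Longrightarrow> smooth_on (\<lambda>x. cvec (a x) $ i) X"
  using smooth_on_cnj[OF open_X] by simp

lemma smooth_K: "smooth_on K X"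
proof -
  have "smooth_on (\<lambda>x. \<i> * (q x \<odot> cvec (p x) - p x \<odot> cvec (q x)) + t x \<odot> s x) X"
    by (intro smooth_on_add smooth_on_mult smooth_on_diff smooth_on_const smooth_cdot smooth_cvec
        smooth_q smooth_p smooth_t smooth_s open_X)
  then show ?thesis
    by (rule smooth_on_cong[OF open_X, rotated]) (simp add: K_eq s_def)
qed

context
  fixes x assumes x: "x \<in> X"
begin

lemma diff_q: "(\<lambda>x. q x $ i) differentiable (at x)" and diff_p: "(\<lambda>x. p x $ i) differentiable (at x)"
  and diff_\<eta>: "(\<lambda>x. \<eta> x $ i) differentiable (at x)" and diff_S: "(\<lambda>x. S x $ i $ j) differentiable (at x)"
  and diff_s: "(\<lambda>x. s x $ i) differentiable (at x)" and diff_t: "(\<lambda>x. t x $ i) differentiable (at x)"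
  and diff_Y: "(\<lambda>x. Y x $ i $ j) differentiable (at x)"
  using smooth_on_differentiable[OF _ x] smooth_q smooth_p smooth_\<eta> smooth_S smooth_s smooth_t smooth_Y
  by blast+

lemma diff_cvec:
  "(\<And>i. (\<lambda>x. a x $ i) differentiable (at x)) \<Longrightarrow> (\<lambda>x. cvec (a x) $ i) differentiable (at x)"
  by (simp add: differentiable_cnj)

lemma Ys: "Y x *v s x = t x"
  unfolding s_def using linear_solve[OF det_Y[OF x]] by blast

lemma Y_sym: "Y x $ i $ j = Y x $ j $ i" and Y_re: "cnj (Y x $ i $ j) = Y x $ i $ j"
  using S_symmetric[OF x] by (simp_all add: imaginary_part_def algebra_simps)

lemma Y_cdot: "(Y x *v a) \<odot> b = a \<odot> (Y x *v b)"
proof -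
  have "transpose (Y x) = Y x"
    by (simp add: vec_eq_iff transpose_def Y_sym)
  then show ?thesis
    using cdot_matrix[of "Y x"] by simp
qed

lemma s_real: "cvec (s x) = s x"
proof -
  have "Y x *v cvec (s x) = cvec (Y x *v s x)"
    by (simp add: vec_eq_iff matrix_vector_mult_def Y_re)
  also have "\<dots> = t x"
    by (simp add: Ys add.commute)
  finally show ?thesis
    using linear_solve[OF det_Y[OF x]] unfolding s_def by metis
qed

text \<open>\<open>S\<close> is holomorphic, so each type of derivative sees just one of the two
  summands of \<open>Y\<close>.\<close>

lemma wmat_Y: "wmat Y x u *v b = (- \<i>) *s (wmat S x u *v b)"
  "wmat_bar Y x u *v b = \<i> *s (cmat (wmat S x u) *v b)"
proof -
  have "wirt (\<lambda>x. Y x $ i $ j) x u = - \<i> * wirt (\<lambda>x. S x $ i $ j) x u"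
    "wirt_bar (\<lambda>x. Y x $ i $ j) x u = \<i> * cnj (wirt (\<lambda>x. S x $ i $ j) x u)" for i j
    using diff_S differentiable_cnj[OF diff_S] wirt_holomorphic(2)[OF hol_S x]
    by (simp_all add: imaginary_part_def wirt_cmult wirt_diff wirt_cnj)
  then show "wmat Y x u *v b = (- \<i>) *s (wmat S x u *v b)"
    "wmat_bar Y x u *v b = \<i> *s (cmat (wmat S x u) *v b)"
    by (simp_all add: vec_eq_iff wmat_def wmat_bar_def cmat_def matrix_vector_mult_def
      sum_distrib_left mult.assoc sum_negf)
qed

lemma wvec_t: "wvec t x u = wvec \<eta> x u" "wvec_bar t x u = cvec (wvec \<eta> x u)"
  using wvec_holomorphic[OF hol_\<eta> x]
  by (simp_all add: wvec_add wvec_cvec diff_\<eta> differentiable_cnj)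

text \<open>Differentiating \<open>Y s = t\<close> gives the derivatives of \<open>s\<close>
  implicitly; the inverse matrix never has to be differentiated.\<close>

lemma Y_wvec_s: "Y x *v wvec s x u = wvec \<eta> x u + \<i> *s (wmat S x u *v s x)"
  and Y_wvec_bar_s: "Y x *v wvec_bar s x u = cvec (wvec \<eta> x u) - \<i> *s (cmat (wmat S x u) *v s x)"
proof -
  have "wvec (\<lambda>x. Y x *v s x) x = wvec t x" "wvec_bar (\<lambda>x. Y x *v s x) x = wvec_bar t x"
    using wvec_cong[OF open_X x, of "\<lambda>x. Y x *v s x" t] by (simp_all add: s_def linear_solve det_Y)
  then have "wvec (\<lambda>x. Y x *v s x) x u = wvec \<eta> x u" "wvec_bar (\<lambda>x. Y x *v s x) x u = cvec (wvec \<eta> x u)"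
    by (simp_all only: wvec_t)
  then have "Y x *v wvec s x u + wmat Y x u *v s x = wvec \<eta> x u"
    "Y x *v wvec_bar s x u + wmat_bar Y x u *v s x = cvec (wvec \<eta> x u)"
    by (simp_all only: wvec_matrix diff_Y diff_s)
  then show "Y x *v wvec s x u = wvec \<eta> x u + \<i> *s (wmat S x u *v s x)"
    "Y x *v wvec_bar s x u = cvec (wvec \<eta> x u) - \<i> *s (cmat (wmat S x u) *v s x)"
    unfolding wmat_Y by (simp_all add: algebra_simps vec_eq_iff)
qed

text \<open>The symmetry of the third derivatives \<open>F\<^sub>i\<^sub>j\<^sub>k\<close>.\<close>

lemma wmat_S_commute: "wmat S x u *v wvec q x v = wmat S x v *v wvec q x u"
proof -
  have *: "wvec (\<lambda>y. wvec p y v) x u = S x *v wvec (\<lambda>y. wvec q y v) x u + wmat S x u *v wvec q x v"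
    for u v
  proof -
    have "wvec (\<lambda>y. wvec p y v) x = wvec (\<lambda>y. S y *v wvec q y v) x"
      by (rule wvec_cong(1)[OF open_X x]) (rule dp_eq)
    moreover have "(\<lambda>y. wvec q y v $ i) differentiable (at x)" for i
      using smooth_on_differentiable[OF smooth_on_wirt(1)[OF open_X smooth_q] x] by (simp add: wvec_def)
    ultimately show ?thesis
      by (simp add: wvec_matrix diff_S)
  qed
  have "wvec (\<lambda>y. wvec q y v) x u = wvec (\<lambda>y. wvec q y u) x v"
    "wvec (\<lambda>y. wvec p y v) x u = wvec (\<lambda>y. wvec p y u) x v"
    using wirt_commute[OF open_X smooth_q x] wirt_commute[OF open_X smooth_p x]
    by (simp_all add: wvec_def)
  then show ?thesis
    using *[of v u] *[of u v] by simp
qed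

lemma wmat_S_cdot: "(wmat S x u *v a) \<odot> b = a \<odot> (wmat S x u *v b)"
proof -
  have "wirt (\<lambda>y. S y $ i $ j) x = wirt (\<lambda>y. S y $ j $ i) x" for i j
    by (rule wirt_cong[OF open_X x]) (rule S_symmetric)
  then have "transpose (wmat S x u) = wmat S x u"
    by (simp add: vec_eq_iff transpose_def wmat_def)
  then show ?thesis
    using cdot_matrix[of "wmat S x u"] by simp
qed

text \<open>Replacing \<partial>\<eta> by Y \<partial>s in \<open>Omega_eq\<close> introduces the
  terms \<partial>S(\<partial>q, s). They are symmetric in \<open>u\<close> and \<open>v\<close> by
  the symmetry of third derivatives and cancel in the skew form.\<close>

lemma frame: "hyperkaehler_frame (wvec q x) (wvec s x) (Y x)"
proof
  show "Omega u v = wvec q x u \<odot> (Y x *v wvec s x v) - (Y x *v wvec s x u) \<odot> wvec q x v" for u v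
  proof -
    have "wvec q x u \<odot> (wmat S x v *v s x) = (wmat S x v *v wvec q x u) \<odot> s x"
      by (rule wmat_S_cdot[symmetric])
    also have "\<dots> = wvec q x v \<odot> (wmat S x u *v s x)"
      unfolding wmat_S_commute[of v u] by (rule wmat_S_cdot)
    also have "\<dots> = (wmat S x u *v s x) \<odot> wvec q x v"
      by (rule cdot_commute)
    finally show ?thesis
      by (simp add: Y_wvec_s Omega_eq[OF x])
  qed
qed (simp_all add: wvec_linear diff_q diff_s det_Y x, simp_all add: Y_sym[symmetric] Y_re)

text \<open>All derivatives that occur here are antiholomorphic, so the next holomorphic derivative
  falls on q, p and \<open>s\<close> only.\<close>

lemma wirt_bar_K:
  "wirt_bar K x v = \<i> * (q x \<odot> cvec (wvec p x v) - p x \<odot> cvec (wvec q x v))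
    + 2 * (s x \<odot> cvec (wvec \<eta> x v)) - \<i> * (s x \<odot> (cmat (wmat S x v) *v s x))"
proof -
  have "wirt_bar K x = wirt_bar (\<lambda>x. \<i> * (q x \<odot> cvec (p x) - p x \<odot> cvec (q x)) + t x \<odot> s x) x"
    by (rule wirt_bar_cong[OF open_X x]) (simp add: K_eq s_def)
  moreover have d: "(\<lambda>x. a x \<odot> b x) differentiable (at x)"
    if "\<And>i. smooth_on (\<lambda>x. a x $ i) X" "\<And>i. smooth_on (\<lambda>x. b x $ i) X"
      for a b :: "complex^('n + 'n) \<Rightarrow> complex^'n"
    by (rule smooth_on_differentiable[OF smooth_cdot[OF that] x])
  note d = this[OF smooth_q smooth_cvec[OF smooth_p]] this[OF smooth_p smooth_cvec[OF smooth_q]]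
    this[OF smooth_t smooth_s]
  ultimately have "wirt_bar K x v = \<i> * (wirt_bar (\<lambda>x. q x \<odot> cvec (p x)) x v
    - wirt_bar (\<lambda>x. p x \<odot> cvec (q x)) x v)
      + wirt_bar (\<lambda>x. t x \<odot> s x) x v"
    by (simp only: wirt_add(2) wirt_cmult(2) wirt_diff(2) differentiable_mult differentiable_const
      differentiable_diff)
  also have "wirt_bar (\<lambda>x. q x \<odot> cvec (p x)) x v = q x \<odot> cvec (wvec p x v)"
    using wvec_holomorphic[OF hol_q x] by (simp only: wirt_cdot(2) diff_q diff_p diff_cvec
      wvec_cvec) simp
  also have "wirt_bar (\<lambda>x. p x \<odot> cvec (q x)) x v = p x \<odot> cvec (wvec q x v)"
    using wvec_holomorphic[OF hol_p x] by (simp only: wirt_cdot(2) diff_q diff_p diff_cvec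
      wvec_cvec) simp
  also have "wirt_bar (\<lambda>x. t x \<odot> s x) x v = t x \<odot> wvec_bar s x v + cvec (wvec \<eta> x v) \<odot> s x"
    by (simp only: wirt_cdot(2) diff_t diff_s wvec_t)
  \<comment> \<open>With t = Y s and \<open>Y\<close> symmetric, the derivative of \<open>s\<close>
    enters only through \<open>Y\<close>, where \<open>Y_wvec_bar_s\<close> eliminates it.\<close>
  also have "t x \<odot> wvec_bar s x v = s x \<odot> (cvec (wvec \<eta> x v) - \<i> *s (cmat (wmat S x v) *v s x))"
    by (simp only: Ys[symmetric] Y_cdot Y_wvec_bar_s)
  finally show ?thesis
    by (simp add: cdot_commute[of "cvec _"] algebra_simps)
qed

end

text \<open>The base part is the Gram form in the frame q. In the fibre part the terms combine into
  2 \<partial>s paired with the conjugate of \<partial>\<eta> + \<i> (\<partial>S) s, which is Y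
  \<partial>s by \<open>Y_wvec_s\<close>.\<close>

lemma wirt_wirt_bar_K:
  assumes x: "x \<in> X"
  shows "wirt (\<lambda>y. wirt_bar K y v) x u = hyperkaehler_frame.G (wvec q x) (wvec s x) (Y x) u v"
proof -
  interpret hyperkaehler_frame "wvec q x" "wvec s x" "Y x"
    by (rule frame[OF x])
  let ?C = "\<lambda>y. cmat (wmat S y v)"
  have hol: "holomorphic_fun_on (\<lambda>y. wvec p y v $ i) X" "holomorphic_fun_on (\<lambda>y. wvec q y v $ i) X"
    "holomorphic_fun_on (\<lambda>y. wvec \<eta> y v $ i) X" "holomorphic_fun_on (\<lambda>y. wmat S y v $ i $ j) X" for i j
  proof -
    have "holomorphic_fun_on (\<lambda>y. wirt f y v) X" if "holomorphic_fun_on f X" for f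
      by (rule holomorphic_fun_on_cong[OF open_X _ holomorphic_fun_on_deriv_at[OF open_X that]])
        (simp add: wirt_holomorphic(1)[OF that])
    then show "holomorphic_fun_on (\<lambda>y. wvec p y v $ i) X" "holomorphic_fun_on (\<lambda>y. wvec q y v $ i) X"
      "holomorphic_fun_on (\<lambda>y. wvec \<eta> y v $ i) X" "holomorphic_fun_on (\<lambda>y. wmat S y v $ i $ j) X"
      using hol_p hol_q hol_\<eta> hol_S by (simp_all add: wvec_def wmat_def)
  qed
  note sm = smooth_hol[OF hol(1)] smooth_hol[OF hol(2)] smooth_hol[OF hol(3)] smooth_hol[OF hol(4)]
  note df = sm[THEN smooth_on_differentiable[OF _ x]]
  have C: "smooth_on (\<lambda>y. ?C y $ i $ j) X" "(\<lambda>y. ?C y $ i $ j) differentiable (at x)" for i j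
    using smooth_on_cnj[OF open_X sm(4)] differentiable_cnj[OF df(4)] by (simp_all add: cmat_def)
  have "wirt (\<lambda>y. ?C y $ i $ j) x u = 0" for i j
    using wirt_cnj(1)[OF df(4)] wirt_holomorphic(2)[OF hol(4) x] by (simp add: cmat_def)
  then have wC: "wmat ?C x u = 0"
    by (simp add: wmat_def[of ?C] vec_eq_iff)
  have Cs: "smooth_on (\<lambda>y. (?C y *v s y) $ i) X" for i
    unfolding matrix_vector_mult_def vec_lambda_beta
    by (intro smooth_on_sum smooth_on_mult C(1) smooth_s open_X)
  have d: "(\<lambda>x. a x \<odot> b x) differentiable (at x)"
    if "\<And>i. smooth_on (\<lambda>x. a x $ i) X" "\<And>i. smooth_on (\<lambda>x. b x $ i) X"
      for a b :: "complex^('n + 'n) \<Rightarrow> complex^'n"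
    by (rule smooth_on_differentiable[OF smooth_cdot[OF that] x])
  note d = d[OF smooth_q smooth_cvec[OF sm(1)]] d[OF smooth_p smooth_cvec[OF sm(2)]]
    d[OF smooth_s smooth_cvec[OF sm(3)]] d[OF smooth_s Cs]
  have cv: "(\<lambda>y. cvec (wvec p y v) $ i) differentiable (at x)"
    "(\<lambda>y. cvec (wvec q y v) $ i) differentiable (at x)"
    "(\<lambda>y. cvec (wvec \<eta> y v) $ i) differentiable (at x)"
      "(\<lambda>y. (?C y *v s y) $ i) differentiable (at x)" for i
    using df smooth_on_differentiable[OF Cs x] by (simp_all add: differentiable_cnj)
  have antihol: "wvec (\<lambda>y. cvec (wvec p y v)) x u = 0" "wvec (\<lambda>y. cvec (wvec q y v)) x u = 0"
    "wvec (\<lambda>y. cvec (wvec \<eta> y v)) x u = 0"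
    using hol by (simp_all add: wvec_cvec df wvec_holomorphic[OF _ x])
  have "wirt (\<lambda>y. wirt_bar K y v) x = wirt (\<lambda>y. \<i> * (q y \<odot> cvec (wvec p y v) - p y \<odot> cvec (wvec q y v))
    + 2 * (s y \<odot> cvec (wvec \<eta> y v)) - \<i> * (s y \<odot> (?C y *v s y))) x"
    by (rule wirt_cong[OF open_X x]) (rule wirt_bar_K)
  then have "wirt (\<lambda>y. wirt_bar K y v) x u
      = \<i> * (wirt (\<lambda>y. q y \<odot> cvec (wvec p y v)) x u - wirt (\<lambda>y. p y \<odot> cvec (wvec q y v)) x u)
        + 2 * wirt (\<lambda>y. s y \<odot> cvec (wvec \<eta> y v)) x u - \<i> * wirt (\<lambda>y. s y \<odot> (?C y *v s y)) x u"
    by (simp only: wirt_add(1) wirt_cmult(1) wirt_diff(1) differentiable_mult differentiable_const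
        differentiable_diff differentiable_add d)
  also have "wirt (\<lambda>y. q y \<odot> cvec (wvec p y v)) x u = wvec q x u \<odot> cvec (wvec p x v)"
    by (simp only: wirt_cdot(1) diff_q[OF x] cv antihol) simp
  also have "wirt (\<lambda>y. p y \<odot> cvec (wvec q y v)) x u = wvec p x u \<odot> cvec (wvec q x v)"
    by (simp only: wirt_cdot(1) diff_p[OF x] cv antihol) simp
  also have "wirt (\<lambda>y. s y \<odot> cvec (wvec \<eta> y v)) x u = wvec s x u \<odot> cvec (wvec \<eta> x v)"
    by (simp only: wirt_cdot(1) diff_s[OF x] cv antihol) simp
  also have "wirt (\<lambda>y. s y \<odot> (?C y *v s y)) x u = s x \<odot> (?C x *v wvec s x u)
    + wvec s x u \<odot> (?C x *v s x)"
    by (simp only: wirt_cdot(1) diff_s[OF x] cv wvec_matrix(1) C(2) wC) simp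
  \<comment> \<open>The expression is quadratic in \<open>s\<close> with a symmetric matrix, so its
    two derivative terms agree. Conjugating reduces this to the symmetry of \<partial>S, as
    \<open>s\<close> is real.\<close>
  also have "s x \<odot> (?C x *v wvec s x u) = wvec s x u \<odot> (?C x *v s x)"
  proof -
    have "cnj (s x \<odot> (?C x *v wvec s x u)) = s x \<odot> (wmat S x v *v cvec (wvec s x u))"
      using cmat_mult_cvec[of "wmat S x v" "cvec (wvec s x u)"] by (simp add: cnj_cdot s_real[OF x])
    also have "\<dots> = cvec (wvec s x u) \<odot> (wmat S x v *v s x)"
      by (rule trans[OF wmat_S_cdot[OF x, symmetric] cdot_commute])
    also have "\<dots> = cnj (wvec s x u \<odot> (?C x *v s x))"
      using cmat_mult_cvec[of "wmat S x v" "s x"] by (simp add: cnj_cdot s_real[OF x])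
    finally show ?thesis
      by simp
  qed
  also have "?C x *v s x = cvec (wmat S x v *v s x)"
    using cmat_mult_cvec[of "wmat S x v" "s x"] by (simp add: s_real[OF x])
  also have "\<i> * (wvec q x u \<odot> cvec (wvec p x v) - wvec p x u \<odot> cvec (wvec q x v))
    = inner_Y (wvec q x u) (wvec q x v)"
    unfolding dp_eq[OF x] inner_Y_def by (rule imaginary_part_apply[OF S_symmetric[OF x]])
  finally have "wirt (\<lambda>y. wirt_bar K y v) x u = inner_Y (wvec q x u) (wvec q x v)
      + 2 * (wvec s x u \<odot> cvec (wvec \<eta> x v + \<i> *s (wmat S x v *v s x)))"
    by (simp add: algebra_simps)
  then show ?thesis
    by (simp only: Y_wvec_s[OF x, symmetric] cvec_Y inner_Y_def G_def)
qed

end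

section \<open>The connection of the Hessian metric\<close>

context special_coordinates
begin

definition H :: "complex^('n + 'n) \<Rightarrow> complex^('n + 'n) \<Rightarrow> complex^('n + 'n) \<Rightarrow> complex" where
  "H x u v = wirt (\<lambda>y. wirt_bar K y v) x u"

definition flat_H :: "complex^('n + 'n) \<Rightarrow> complex^('n + 'n) \<Rightarrow> complex^('n + 'n)" where
  "flat_H x u = (\<chi> k. H x u (axis k 1))"

text \<open>The Chern connection of \<open>H\<close>. It needs only holomorphic derivatives, and
  below it turns out to be the Levi-Civita connection of the real part.\<close>

definition christoffel :: "complex^('n + 'n) \<Rightarrow> complex^('n + 'n) \<Rightarrow> complex^('n + 'n) \<Rightarrow> complex^('n
  + 'n)" where
  "christoffel x w u = inv (flat_H x) (wvec (\<lambda>y. flat_H y u) x w)"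

lemma H_eq: "x \<in> X \<Longrightarrow> H x = hyperkaehler_frame.G (wvec q x) (wvec s x) (Y x)"
  by (simp add: H_def fun_eq_iff wirt_wirt_bar_K)

lemma flat_H_eq: "x \<in> X \<Longrightarrow> flat_H x = hyperkaehler_frame.flat (wvec q x) (wvec s x) (Y x)"
  unfolding flat_H_def fun_eq_iff by (simp add: H_eq hyperkaehler_frame.flat_def[OF frame])

lemma smooth_wirt_bar_K: "smooth_on (\<lambda>x. wirt_bar K x v) X"
  by (rule smooth_on_wirt(2)[OF open_X smooth_K])

lemma smooth_H: "smooth_on (\<lambda>x. H x u v) X"
  unfolding H_def by (rule smooth_on_wirt(1)[OF open_X smooth_wirt_bar_K])

lemmas differentiable_H = smooth_on_differentiable[OF smooth_H]

text \<open>The Kaehler condition in the form supplied by a potential: both sides are third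
  derivatives of \<open>K\<close>. It is the source of the symmetry of
  \<open>christoffel\<close>.\<close>

lemma wirt_H_commute: "x \<in> X \<Longrightarrow> wirt (\<lambda>y. H y u v) x w = wirt (\<lambda>y. H y w v) x u"
  unfolding H_def by (rule wirt_commute[OF open_X smooth_wirt_bar_K])

context
  fixes x assumes x: "x \<in> X"
begin

interpretation frame: hyperkaehler_frame "wvec q x" "wvec s x" "Y x"
  by (rule frame[OF x])

lemma H_linear:
  "H x (u + v) w = H x u w + H x v w" "H x (c *s u) w = c * H x u w"
  "H x w (u + v) = H x w u + H x w v" "H x w (c *s u) = cnj c * H x w u"
  unfolding H_eq[OF x] by (rule frame.G_linear)+

lemma hermitian_H: "H x v u = cnj (H x u v)"
  unfolding H_eq[OF x] by (rule frame.G_hermitian)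

lemma differentiable_flat_H: "(\<lambda>y. flat_H y u $ k) differentiable (at x)"
  using differentiable_H[OF x] by (simp add: flat_H_def)

lemma wirt_H: "wirt (\<lambda>y. H y u v) x w = wvec (\<lambda>y. flat_H y u) x w \<odot> cvec v"
proof -
  have "H y u v = flat_H y u \<odot> cvec v" if "y \<in> X" for y
    unfolding H_eq[OF that] flat_H_eq[OF that] by (rule hyperkaehler_frame.G_eq_flat[OF frame[OF that]])
  then have "wirt (\<lambda>y. H y u v) x = wirt (\<lambda>y. flat_H y u \<odot> cvec v) x"
    by (rule wirt_cong[OF open_X x])
  moreover have "wvec (\<lambda>y. cvec v) x w = 0"
    by (simp add: vec_eq_iff wvec_def wirt_const)
  ultimately show ?thesis
    by (simp add: wirt_cdot(1) differentiable_flat_H)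
qed

lemma flat_christoffel: "flat_H x (christoffel x w u) = wvec (\<lambda>y. flat_H y u) x w"
  unfolding christoffel_def flat_H_eq[OF x] by (rule surj_f_inv_f[OF bij_is_surj[OF frame.flat_bij]])

lemma H_christoffel: "H x (christoffel x w u) v = wirt (\<lambda>y. H y u v) x w"
  unfolding wirt_H flat_christoffel[symmetric] unfolding H_eq[OF x] flat_H_eq[OF x]
  by (rule frame.G_eq_flat)

lemma H_inj:
  assumes "\<And>v. H x a v = H x b v"
  shows "a = b"
proof (rule injD[OF bij_is_inj[OF frame.flat_bij]])
  show "frame.flat a = frame.flat b"
    using assms by (simp add: flat_H_def flip: flat_H_eq[OF x])
qed

lemma christoffel_symmetric: "christoffel x w u = christoffel x u w"
  by (rule H_inj) (simp add: H_christoffel wirt_H_commute[OF x, of u])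

text \<open>Commutation turns the second argument into a direction of differentiation, in which
  \<open>wirt\<close> is complex linear.\<close>

lemma christoffel_linear:
  "christoffel x w (u + v) = christoffel x w u + christoffel x w v"
  "christoffel x w (c *s u) = c *s christoffel x w u"
proof -
  have "wirt (\<lambda>y. H y u v) x (w + w') = wirt (\<lambda>y. H y u v) x w + wirt (\<lambda>y. H y u v) x w'"
    "wirt (\<lambda>y. H y u v) x (c *s w) = c * wirt (\<lambda>y. H y u v) x w" for u v w w' c
    using wirt_linear[OF differentiable_H[OF x]] by auto
  then show "christoffel x w (u + v) = christoffel x w u + christoffel x w v"
    "christoffel x w (c *s u) = c *s christoffel x w u"
    by (rule_tac H_inj, simp add: H_linear H_christoffel wirt_H_commute[OF x, of _ _ w])+
qed

lemma bilinear_christoffel: "bilinear (christoffel x)"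
proof -
  have "linear (christoffel x w)" for w
    by (rule linearI) (simp_all add: christoffel_linear scaleR_eq_smult)
  then show ?thesis
    unfolding bilinear_def using christoffel_symmetric by (simp add: fun_eq_iff)
qed

text \<open>The holomorphic part of the derivative acts on the first argument by construction;
  Hermitian symmetry turns the antiholomorphic part into an action on the second.\<close>

lemma deriv_H: "deriv_at (\<lambda>y. H y u v) x w = H x (christoffel x w u) v + H x u (christoffel x w v)"
proof -
  have "wirt_bar (\<lambda>y. H y u v) x = wirt_bar (\<lambda>y. cnj (H y v u)) x"
    by (rule wirt_bar_cong[OF open_X x])
      (simp add: H_eq, rule hyperkaehler_frame.G_hermitian[OF frame])
  then have "wirt_bar (\<lambda>y. H y u v) x w = cnj (H x (christoffel x w v) u)"
    by (simp add: wirt_cnj differentiable_H[OF x] H_christoffel)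
  then show ?thesis
    using hermitian_H[of "christoffel x w v" u]
    by (simp add: deriv_at_eq_wirt H_christoffel)
qed

text \<open>\<open>Omega (flat_H y u) (flat_H y v)\<close> is constant in \<open>y\<close> by
  \<open>Omega_flat\<close>. Its holomorphic derivative brings in \<open>flat_H\<close> of the
  Christoffel vectors, and a second use of \<open>Omega_flat\<close> removes
  \<open>flat_H\<close>.\<close>

lemma Omega_christoffel: "Omega (christoffel x w u) v + Omega u (christoffel x w v) = 0"
proof -
  have bilin: "wirt (\<lambda>y. Omega (a y) (b y)) x w = Omega (wvec a x w) (b x) + Omega (a x) (wvec b x w)"
    if "\<And>k. (\<lambda>y. a y $ k) differentiable (at x)" "\<And>k. (\<lambda>y. b y $ k) differentiable (at x)" for a b
  proof -
    have comp: "(\<lambda>y. base_coord (a y) $ i) differentiable (at x)"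
      "(\<lambda>y. fibre_coord (a y) $ i) differentiable (at x)"
      "wvec (\<lambda>y. base_coord (a y)) x w = base_coord (wvec a x w)"
      "wvec (\<lambda>y. fibre_coord (a y)) x w = fibre_coord (wvec a x w)"
      if "\<And>k. (\<lambda>y. a y $ k) differentiable (at x)" for a i
      using that by (simp_all add: base_coord_def fibre_coord_def wvec_def)
    have "(\<lambda>y. base_coord (a y) \<odot> fibre_coord (b y)) differentiable (at x)"
      "(\<lambda>y. fibre_coord (a y) \<odot> base_coord (b y)) differentiable (at x)"
      unfolding cdot_def using that by (auto intro!: differentiable_sum differentiable_mult comp)
    then show ?thesis
      unfolding Omega_def
      by (simp add: wirt_diff(1) wirt_cdot(1) comp that)
  qed
  have "Omega (flat_H y u) (flat_H y v) = 2 * Omega u v" if "y \<in> X" for y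
    unfolding flat_H_eq[OF that] by (rule hyperkaehler_frame.Omega_flat[OF frame[OF that]])
  then have "wirt (\<lambda>y. Omega (flat_H y u) (flat_H y v)) x w = wirt (\<lambda>y. 2 * Omega u v) x w"
    by (subst wirt_cong[OF open_X x]) auto
  then have "Omega (flat_H x (christoffel x w u)) (flat_H x v)
    + Omega (flat_H x u) (flat_H x (christoffel x w v)) = 0"
    by (simp add: bilin differentiable_flat_H flat_christoffel wirt_const)
  then have "2 * Omega (christoffel x w u) v + 2 * Omega u (christoffel x w v) = 0"
    unfolding flat_H_eq[OF x] frame.Omega_flat .
  then show ?thesis
    by (metis distrib_left mult_eq_0_iff zero_neq_numeral)
qed

text \<open>Metric compatibility yields six terms; they cancel in pairs because the fundamental form
  is skew and \<open>christoffel\<close> is symmetric.\<close>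

lemma closed_H:
  "deriv_at (\<lambda>y. Re (H y (\<i> *s v) w)) x u + deriv_at (\<lambda>y. Re (H y (\<i> *s w) u)) x v
    + deriv_at (\<lambda>y. Re (H y (\<i> *s u) v)) x w = 0"
proof -
  have 1: "deriv_at (\<lambda>y. Re (H y a b)) x c = Re (H x (christoffel x c a) b
    + H x a (christoffel x c b))" for a b c
    unfolding deriv_at_bounded_linear[OF bounded_linear_Re differentiable_H[OF x]] deriv_H ..
  have 2: "Re (H x (\<i> *s a) b) = - Re (H x (\<i> *s b) a)" for a b
    using hermitian_H[of b a] by (simp add: H_linear)
  show ?thesis
    unfolding 1 christoffel_linear(2)
    using 2[of v "christoffel x u w"] 2[of w "christoffel x v u"] 2[of u "christoffel x w v"]
    by (simp add: christoffel_symmetric[of v u] christoffel_symmetric[of w u]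
      christoffel_symmetric[of w v])
qed

end

lemma levi_civita_christoffel: "levi_civita X (\<lambda>x u v. Re (H x u v)) christoffel"
  unfolding levi_civita_def
proof (intro ballI conjI allI)
  fix x w u v assume x: "x \<in> X"
  show "bilinear (christoffel x)"
    by (rule bilinear_christoffel[OF x])
  show "christoffel x u v = christoffel x v u"
    by (rule christoffel_symmetric[OF x])
  show "deriv_at (\<lambda>x. Re (H x u v)) x w = Re (H x (christoffel x w u) v)
    + Re (H x u (christoffel x w v))"
    using deriv_at_bounded_linear[OF bounded_linear_Re differentiable_H[OF x]]
      by (simp add: deriv_H[OF x])
qed

text \<open>\<open>Omega\<close> has constant coefficients in the induced coordinates, so its
  covariant derivative consists of the Christoffel terms alone.\<close>

lemma parallel_Omega: "parallel_on X christoffel (\<lambda>x. Omega)"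
  unfolding parallel_on_def using Omega_christoffel by simp

end

section \<open>Wirtinger derivatives under holomorphic coordinate changes\<close>

lemma has_derivative_transition:
  assumes "holomorphic_map_on T D" "x \<in> D" "f differentiable (at (T x))"
  shows "((\<lambda>x. f (T x)) has_derivative (\<lambda>u. deriv_at f (T x) (deriv_at T x u))) (at x)"
  by (rule has_derivative_compose[OF holomorphic_map_on_deriv(1)[OF assms(1,2)]
    has_derivative_deriv_at[OF assms(3)]])

lemma wirt_compose:
  assumes "holomorphic_map_on T D" "x \<in> D" "f differentiable (at (T x))"
  shows "wirt (\<lambda>x. f (T x)) x u = wirt f (T x) (deriv_at T x u)"
  unfolding wirt_def deriv_at_eqI[OF has_derivative_transition[OF assms]]
  by (simp add: holomorphic_map_on_deriv(2)[OF assms(1,2)])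

lemma wvec_compose:
  assumes "holomorphic_map_on T D" "x \<in> D" "\<And>i. (\<lambda>x. a x $ i) differentiable (at (T x))"
  shows "wvec (\<lambda>x. a (T x)) x u = wvec a (T x) (deriv_at T x u)"
  using wirt_compose[OF assms(1,2) assms(3)] by (simp add: wvec_def)

section \<open>The hyper Kaehler structure of the cotangent bundle\<close>

context lagrangean_bundle
begin

abbreviation potential where "potential \<equiv> cotangent_potential \<omega> \<tau> L\<^sub>0 L\<^sub>0' M"

text \<open>The complex Hessian of the potential in each chart; that these expressions form one
  tensor field is established by \<open>bundle_tensor\<close>.\<close>

definition bundle_metric :: "('n + 'n, 'v covector) form_field" where
  "bundle_metric c x u v = wirt (\<lambda>y. wirt_bar (potential \<circ> snd c) y v) x u"

abbreviation chart_q where "chart_q \<phi> x \<equiv> Q (\<phi> (base_coord x))"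
abbreviation chart_p where "chart_p \<phi> x \<equiv> P (\<phi> (base_coord x))"
abbreviation chart_slope where "chart_slope \<phi> x \<equiv> slope (TM (\<phi> (base_coord x)))"

lemma QP_nth_linear: "bounded_linear (\<lambda>v. Q v $ i)" "bounded_linear (\<lambda>v. P v $ i)"
  by (rule bounded_linear_compose[OF bounded_linear_vec_nth QP_bounded_linear(1)]
      bounded_linear_compose[OF bounded_linear_vec_nth QP_bounded_linear(2)])+

context
  fixes D \<phi>
  assumes chart: "(D, \<phi>) \<in> charts"
begin

lemma hol_chart_qp:
  "holomorphic_fun_on (\<lambda>x. chart_q \<phi> x $ i) (dom D)" "holomorphic_fun_on (\<lambda>x. chart_p \<phi> x $ i) (dom D)"
  by (rule holomorphic_fun_on_linear[OF holomorphic_chart_base[OF chart] QP_nth_linear(1)]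
      holomorphic_fun_on_linear[OF holomorphic_chart_base[OF chart] QP_nth_linear(2)]; simp)+

text \<open>\<open>slope\<close> is defined through an inverse of \<open>Q\<close>, from which
  holomorphy cannot be read off. Here its rows solve a linear system with holomorphic
  coefficients.\<close>

lemma slope_chart:
  assumes z: "z \<in> D"
  shows "slope (TM (\<phi> z)) $ i
    = linear_solve (jac \<phi> z) (\<chi> k. P (deriv_at \<phi> z (axis k 1)) $ i)"
proof -
  let ?S = "slope (TM (\<phi> z))"
  have "(jac \<phi> z *v (?S $ i)) $ k = P (deriv_at \<phi> z (axis k 1)) $ i" for k
    unfolding jac_apply[OF chart]
      P_eq_slope[OF transverse_tangent[OF chart_in_M[OF chart z]] deriv_in_tangent[OF chart z]]
    by (simp add: matrix_vector_mult_def cdot_def)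
  then have "jac \<phi> z *v (?S $ i) = (\<chi> k. P (deriv_at \<phi> z (axis k 1)) $ i)"
    by (simp add: vec_eq_iff)
  then show ?thesis
    using linear_solve[OF det_jac[OF chart z]] by blast
qed

lemma hol_chart_slope: "holomorphic_fun_on (\<lambda>x. chart_slope \<phi> x $ i $ j) (dom D)"
proof -
  have "holomorphic_fun_on (\<lambda>z. linear_solve (jac \<phi> z) (\<chi> k. P (deriv_at \<phi> z (axis k 1)) $ i) $ j) D"
  proof (rule holomorphic_fun_on_linear_solve[OF holomorphic_jac[OF chart]])
    fix k
    show "holomorphic_fun_on (\<lambda>z. (\<chi> k. P (deriv_at \<phi> z (axis k 1)) $ i) $ k) D"
      using holomorphic_fun_on_linear[OF holomorphic_map_on_deriv_at[OF submanifold_chartsD(1,2)[OF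
        chart]]
          QP_nth_linear(2)] by simp
  qed (rule det_jac[OF chart])
  then have "holomorphic_fun_on (\<lambda>z. slope (TM (\<phi> z)) $ i $ j) D"
    by (rule holomorphic_fun_on_cong[OF submanifold_chartsD(1)[OF chart], rotated])
      (simp add: slope_chart)
  then show ?thesis
    by (rule holomorphic_fun_on_compose[OF _ holomorphic_base_coord]) simp
qed

lemma wvec_chart_qp:
  assumes x: "x \<in> dom D"
  shows "wvec (chart_q \<phi>) x u = Q (deriv_at \<phi> (base_coord x) (base_coord u))"
    "wvec (chart_p \<phi>) x u = P (deriv_at \<phi> (base_coord x) (base_coord u))"
proof -
  have d: "((\<lambda>x. \<phi> (base_coord x)) has_derivative (\<lambda>u. deriv_at \<phi> (base_coord x) (base_coord u))) (at x)"
    by (rule has_derivative_compose[OF bounded_linear_imp_has_derivative[OF coord_bounded_linear(1)]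
          chart_deriv(1)[OF chart]]) (use x in simp)
  have "deriv_at (\<lambda>x. chart_q \<phi> x $ i) x u = Q (deriv_at \<phi> (base_coord x) (base_coord u)) $ i"
    "deriv_at (\<lambda>x. chart_p \<phi> x $ i) x u = P (deriv_at \<phi> (base_coord x) (base_coord u)) $ i" for i
    using deriv_at_eqI[OF bounded_linear.has_derivative[OF QP_nth_linear(1) d]]
      deriv_at_eqI[OF bounded_linear.has_derivative[OF QP_nth_linear(2) d]] by simp_all
  then show "wvec (chart_q \<phi>) x u = Q (deriv_at \<phi> (base_coord x) (base_coord u))"
    "wvec (chart_p \<phi>) x u = P (deriv_at \<phi> (base_coord x) (base_coord u))"
    by (simp_all add: wvec_def vec_eq_iff wirt_holomorphic(1)[OF hol_chart_qp(1) x]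
      wirt_holomorphic(1)[OF hol_chart_qp(2) x])
qed

text \<open>Both sides are the canonical 1-form of the cotangent bundle.\<close>

lemma canonical_form:
  assumes x: "x \<in> dom D"
  shows "chart_eta \<phi> x \<odot> wvec (chart_q \<phi>) x v = fibre_coord x \<odot> base_coord v"
proof -
  let ?A = "deriv_at \<phi> (base_coord x)"
  have z: "base_coord x \<in> D"
    using x by simp
  have sums: "Q (\<Sum>i\<in>I. f i) = (\<Sum>i\<in>I. Q (f i))" "a \<odot> (\<Sum>i\<in>I. g i) = (\<Sum>i\<in>I. a \<odot> g i)"
    for f :: "'n \<Rightarrow> complex^'v" and g :: "'n \<Rightarrow> complex^'n" and a I
    by (induction I rule: infinite_finite_induct) simp_all
  have "chart_eta \<phi> x \<odot> Q (?A (base_coord v))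
      = (\<Sum>i\<in>UNIV. base_coord v $ i * (chart_eta \<phi> x \<odot> Q (?A (axis i 1))))"
    unfolding deriv_expansion[OF chart z, of "base_coord v"] by (simp add: sums)
  also have "\<dots> = (\<Sum>i\<in>UNIV. base_coord v $ i * fibre_coord x $ i)"
    unfolding fibre_coord_chart_eta[OF chart z] jac_apply[OF chart] ..
  finally show ?thesis
    unfolding wvec_chart_qp(1)[OF x] by (simp add: cdot_def mult.commute)
qed

text \<open>Up to sign this is the exterior derivative of the two expressions in
  \<open>canonical_form\<close>: differentiate along \<open>u\<close> and antisymmetrize; the second
  derivatives of q drop out.\<close>

lemma Omega_chart:
  assumes x: "x \<in> dom D"
  shows "Omega u v = wvec (chart_q \<phi>) x u \<odot> wvec (chart_eta \<phi>) x v
    - wvec (chart_eta \<phi>) x u \<odot> wvec (chart_q \<phi>) x v"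
proof -
  note open_D = open_dom[OF chart]
  note sm = holomorphic_fun_on_smooth[OF open_D hol_chart_qp(1)]
  have dq: "(\<lambda>y. wvec (chart_q \<phi>) y v $ i) differentiable (at x)" for v i
    using smooth_on_differentiable[OF smooth_on_wirt(1)[OF open_D sm] x] by (simp add: wvec_def)
  have d\<eta>: "(\<lambda>y. chart_eta \<phi> y $ i) differentiable (at x)" for i
    by (rule holomorphic_fun_on_differentiable[OF holomorphic_chart_eta[OF chart] x])
  have fib: "holomorphic_fun_on (\<lambda>y. fibre_coord y $ i) (dom D)" for i
    by (simp add: holomorphic_fibre_coord[unfolded holomorphic_map_on_def])
  have "wvec fibre_coord x u = fibre_coord u" for u
  proof -
    have "deriv_at (\<lambda>y. fibre_coord y $ i) x u = fibre_coord u $ i" for i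
      by (rule fun_cong[OF deriv_at_eqI[OF bounded_linear_imp_has_derivative]])
        (rule bounded_linear_compose[OF bounded_linear_vec_nth coord_bounded_linear(2)])
    then show ?thesis
      by (simp add: vec_eq_iff wvec_def wirt_holomorphic(1)[OF fib x])
  qed
  moreover have "wvec (\<lambda>y. base_coord v) x u = 0" for u v :: "complex^('n + 'n)"
    by (simp add: vec_eq_iff wvec_def wirt_const)
  ultimately have fibre: "wirt (\<lambda>y. fibre_coord y \<odot> base_coord v) x u = fibre_coord u \<odot> base_coord v"
    for u v :: "complex^('n + 'n)"
    using holomorphic_fun_on_differentiable[OF fib x] by (simp add: wirt_cdot(1))
  have canonical: "wirt (\<lambda>y. chart_eta \<phi> y \<odot> wvec (chart_q \<phi>) y v) x
    = wirt (\<lambda>y. fibre_coord y \<odot> base_coord v) x"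
    for v :: "complex^('n + 'n)"
    by (rule wirt_cong[OF open_D x]) (rule canonical_form)
  have *: "fibre_coord u \<odot> base_coord v = chart_eta \<phi> x \<odot> wvec (\<lambda>y. wvec (chart_q \<phi>) y v) x u
      + wvec (chart_eta \<phi>) x u \<odot> wvec (chart_q \<phi>) x v" for u v
    by (rule trans[OF fibre[symmetric] trans[OF fun_cong[OF canonical[symmetric]] wirt_cdot(1)[OF d\<eta>
      dq]]])
  have "wvec (\<lambda>y. wvec (chart_q \<phi>) y v) x u = wvec (\<lambda>y. wvec (chart_q \<phi>) y u) x v"
    using wirt_commute[OF open_D sm x] by (simp add: wvec_def)
  then show ?thesis
    using *[of u v] *[of v u] unfolding Omega_def
    by (simp add: cdot_commute[of "base_coord u"] cdot_commute[of "wvec (chart_q \<phi>) x u"])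
qed

lemma special_chart:
  "special_coordinates (dom D) (chart_q \<phi>) (chart_p \<phi>) (chart_eta \<phi>) (chart_slope \<phi>)
    (potential \<circ> cotangent_param M \<phi>)"
proof
  fix x assume x: "x \<in> dom D"
  then have z: "base_coord x \<in> D"
    by simp
  note T = transverse_tangent[OF chart_in_M[OF chart z]]
  show "chart_slope \<phi> x $ i $ j = chart_slope \<phi> x $ j $ i" for i j
    by (rule slope_symmetric[OF T])
  show "wvec (chart_p \<phi>) x u = chart_slope \<phi> x *v wvec (chart_q \<phi>) x u" for u
    unfolding wvec_chart_qp[OF x] by (rule P_eq_slope[OF T deriv_in_tangent[OF chart z]])
  show "det (imaginary_part (chart_slope \<phi> x)) \<noteq> 0"
    using det_gram[OF T] by (simp add: gram_def)
  show "Omega u v = wvec (chart_q \<phi>) x u \<odot> wvec (chart_eta \<phi>) x v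
    - wvec (chart_eta \<phi>) x u \<odot> wvec (chart_q \<phi>) x v"
    for u v
    by (rule Omega_chart[OF x])
  show "(potential \<circ> cotangent_param M \<phi>) x
    = \<i> * (chart_q \<phi> x \<odot> cvec (chart_p \<phi> x) - chart_p \<phi> x \<odot> cvec (chart_q \<phi> x))
      + (chart_eta \<phi> x + cvec (chart_eta \<phi> x))
        \<odot> linear_solve (imaginary_part (chart_slope \<phi> x)) (chart_eta \<phi> x + cvec (chart_eta \<phi> x))"
    unfolding o_def cotangent_param_eq[OF chart z]
    using cotangent_potential_eq[OF T, of "covector (TM (\<phi> (base_coord x))) (chart_eta \<phi> x)"]
    by (simp add: cotangent_space_eq covector_in[OF T] momentum_covector[OF T] gamma_eq gram_def)
qed (rule open_dom[OF chart] hol_chart_qp holomorphic_chart_eta[OF chart] hol_chart_slope)+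

interpretation special_coordinates "dom D" "chart_q \<phi>" "chart_p \<phi>" "chart_eta \<phi>" "chart_slope \<phi>"
  "potential \<circ> cotangent_param M \<phi>"
  by (rule special_chart)

lemma bundle_metric_eq: "bundle_metric (bchart D \<phi>) x u v = H x u v"
  by (simp add: bundle_metric_def H_def)

lemma smooth_potential: "smooth_on (potential \<circ> cotangent_param M \<phi>) (dom D)"
  by (rule smooth_K)

lemma bundle_metric_hermitian:
  assumes "x \<in> dom D"
  shows "hermitian_form (bundle_metric (bchart D \<phi>) x)"
    "nondegenerate_on UNIV (bundle_metric (bchart D \<phi>) x)"
  unfolding bundle_metric_eq[abs_def] H_eq[OF assms]
  using hyperkaehler_frame.hermitian_form_G[OF frame[OF assms]]
    hyperkaehler_frame.nondegenerate_G[OF frame[OF assms]] by simp_all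

lemma smooth_bundle_metric: "smooth_on (\<lambda>x. bundle_metric (bchart D \<phi>) x u v) (dom D)"
  unfolding bundle_metric_eq by (rule smooth_H)

lemma bundle_metric_closed:
  "closed_2form_on (dom D) (\<lambda>x u v. Re (bundle_metric (bchart D \<phi>) x (\<i> *s u) v))"
  unfolding bundle_metric_eq closed_2form_on_def using closed_H by blast

lemma bundle_parallel:
  "\<exists>\<Gamma>. levi_civita (dom D) (\<lambda>x u v. Re (bundle_metric (bchart D \<phi>) x u v)) \<Gamma>
    \<and> parallel_on (dom D) \<Gamma> (\<lambda>x. Omega)"
  unfolding bundle_metric_eq using levi_civita_christoffel parallel_Omega by blast

lemma inner_Y_chart:
  assumes x: "x \<in> dom D"
    and a: "a \<in> TM (\<phi> (base_coord x))" "b \<in> TM (\<phi> (base_coord x))"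
  shows "hyperkaehler_frame.inner_Y (Y x) (Q a) (Q b) = \<gamma> a b"
  using gamma_gram[OF transverse_tangent[OF chart_in_M[OF chart]] a] x
  by (simp add: hyperkaehler_frame.inner_Y_def[OF frame[OF x]] gram_def)

lemma bundle_metric_positive:
  assumes x: "x \<in> dom D" and pos: "positive_definite_on (TM (\<phi> (base_coord x))) \<gamma>"
  shows "positive_definite_on UNIV (bundle_metric (bchart D \<phi>) x)"
proof -
  let ?T = "TM (\<phi> (base_coord x))"
  have T: "transverse ?T"
    using transverse_tangent[OF chart_in_M[OF chart]] x by simp
  have "positive_definite_on UNIV (hyperkaehler_frame.inner_Y (Y x))"
    unfolding positive_definite_on_def
  proof (intro ballI impI)
    fix a :: "complex^'n" assume "a \<noteq> 0"
    then have "lift ?T a \<noteq> 0"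
      using lift(2)[OF T, of a] by auto
    then show "hyperkaehler_frame.inner_Y (Y x) a a \<in> \<real> \<and> 0 < Re (hyperkaehler_frame.inner_Y (Y x) a a)"
      using pos inner_Y_chart[OF x lift(1)[OF T, of a] lift(1)[OF T, of a]] lift[OF T, of a]
      by (simp add: positive_definite_on_def)
  qed
  then show ?thesis
    unfolding bundle_metric_eq[abs_def] H_eq[OF x]
    using hyperkaehler_frame.positive_definite_G[OF frame[OF x]] by simp
qed

lemma bundle_metric_signature:
  assumes x: "x \<in> dom D" and sig: "has_signature (TM (\<phi> (base_coord x))) \<gamma> k l"
  shows "has_signature UNIV (bundle_metric (bchart D \<phi>) x) (2 * k) (2 * l)"
proof -
  let ?T = "TM (\<phi> (base_coord x))"
  have T: "transverse ?T"
    using transverse_tangent[OF chart_in_M[OF chart]] x by simp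
  have "has_signature (Q ` ?T) (hyperkaehler_frame.inner_Y (Y x)) k l"
    by (rule has_signature_image[OF sig])
      (use T inner_Y_chart[OF x] in \<open>simp_all add: clinear_vec_iff transverse_def bij_betw_def\<close>)
  then have "has_signature UNIV (hyperkaehler_frame.inner_Y (Y x)) k l"
    using T by (simp add: transverse_def bij_betw_def)
  then show ?thesis
    unfolding bundle_metric_eq[abs_def] H_eq[OF x]
    using hyperkaehler_frame.signature_G[OF frame[OF x]] by simp
qed

text \<open>Expresses the Hessian by first derivatives of bundle functions, so that comparing charts
  takes the chain rule for q and s alone.\<close>

lemma bundle_metric_frame:
  assumes x: "x \<in> dom D"
  shows "bundle_metric (bchart D \<phi>) x u v
    = wvec (chart_q \<phi>) x u \<odot> (Y x *v cvec (wvec (chart_q \<phi>) x v))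
      + 2 * (wvec s x u \<odot> (Y x *v cvec (wvec s x v)))"
  unfolding bundle_metric_eq H_eq[OF x] hyperkaehler_frame.G_def[OF frame[OF x]]
    hyperkaehler_frame.inner_Y_def[OF frame[OF x]] ..

lemma differentiable_chart:
  assumes "x \<in> dom D"
  shows "(\<lambda>x. chart_q \<phi> x $ i) differentiable (at x)" "(\<lambda>x. chart_eta \<phi> x $ i) differentiable (at x)"
    "(\<lambda>x. s x $ i) differentiable (at x)"
  using diff_q[OF assms] diff_\<eta>[OF assms] diff_s[OF assms] by blast+

end

text \<open>The functions \<open>q\<close>, \<open>\<eta>\<close> and \<open>s\<close> are defined on the bundle, independently of the chart.\<close>

lemma bundle_tensor:
  assumes "c \<in> bundle_atlas" "c' \<in> bundle_atlas" and x: "x \<in> overlap c c'"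
  defines "T \<equiv> transition c c'"
  shows "bundle_metric c x u v = bundle_metric c' (T x) (deriv_at T x u) (deriv_at T x v)"
    and "Omega u v = Omega (deriv_at T x u) (deriv_at T x v)"
proof -
  obtain D \<phi> where ch: "(D, \<phi>) \<in> charts" and c: "c = (bchart D \<phi>)"
    by (rule bundle_atlasE[OF assms(1)])
  obtain D' \<phi>' where ch': "(D', \<phi>') \<in> charts" and c': "c' = (bchart D' \<phi>')"
    by (rule bundle_atlasE[OF assms(2)])
  have hol: "holomorphic_map_on T (overlap c c')" and op: "open (overlap c c')"
    using complex_atlas assms(1,2) by (auto simp: complex_atlas_def T_def)
  let ?s = "special_coordinates.s (chart_eta \<phi>) (chart_slope \<phi>)"
  let ?s' = "special_coordinates.s (chart_eta \<phi>') (chart_slope \<phi>')"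
  have T: "y \<in> dom D" "T y \<in> dom D'" "\<phi>' (base_coord (T y)) = \<phi> (base_coord y)"
    "chart_eta \<phi>' (T y) = chart_eta \<phi> y" if y: "y \<in> overlap c c'" for y
  proof -
    have "cotangent_param M \<phi> y \<in> cotangent_param M \<phi>' ` dom D'"
      using y by (simp add: overlap_def c c')
    then have 1: "T y \<in> dom D'" "cotangent_param M \<phi>' (T y) = cotangent_param M \<phi> y"
      by (simp_all add: T_def transition_def c c' inv_into_into f_inv_into_f del: mem_Collect_eq)
    show 2: "y \<in> dom D" "T y \<in> dom D'"
      using y 1 by (simp_all add: overlap_def c)
    show "\<phi>' (base_coord (T y)) = \<phi> (base_coord y)" "chart_eta \<phi>' (T y) = chart_eta \<phi> y"
      using cotangent_param_facts[OF ch, of y] cotangent_param_facts[OF ch', of "T y"] 1(2) 2 by simp_all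
  qed
  note sd = special_coordinates.s_def[OF special_chart[OF ch]] special_coordinates.s_def[OF
    special_chart[OF ch']]
  \<comment> \<open>The transition map preserves the point of the bundle, so the two chart
    expressions of q, \<eta> and s are related by composition with \<open>T\<close>.\<close>
  have "wvec (chart_q \<phi>) x = wvec (\<lambda>y. chart_q \<phi>' (T y)) x"
    "wvec (chart_eta \<phi>) x = wvec (\<lambda>y. chart_eta \<phi>' (T y)) x"
    "wvec ?s x = wvec (\<lambda>y. ?s' (T y)) x"
    by (rule wvec_cong(1)[OF op x]; simp add: T sd)+
  then have w: "wvec (chart_q \<phi>) x u = wvec (chart_q \<phi>') (T x) (deriv_at T x u)"
    "wvec (chart_eta \<phi>) x u = wvec (chart_eta \<phi>') (T x) (deriv_at T x u)"
    "wvec ?s x u = wvec ?s' (T x) (deriv_at T x u)" for u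
    using wvec_compose[OF hol x differentiable_chart(1)[OF ch' T(2)[OF x]]]
      wvec_compose[OF hol x differentiable_chart(2)[OF ch' T(2)[OF x]]]
      wvec_compose[OF hol x differentiable_chart(3)[OF ch' T(2)[OF x]]] by simp_all
  show "Omega u v = Omega (deriv_at T x u) (deriv_at T x v)"
    unfolding Omega_chart[OF ch T(1)[OF x], of u v]
      Omega_chart[OF ch' T(2)[OF x], of "deriv_at T x u" "deriv_at T x v"] w ..
  show "bundle_metric c x u v = bundle_metric c' (T x) (deriv_at T x u) (deriv_at T x v)"
    unfolding c c' bundle_metric_frame[OF ch T(1)[OF x]] bundle_metric_frame[OF ch' T(2)[OF x]] w
      T(3)[OF x] ..
qed

lemma bundle_pseudo_kaehler:
  "pseudo_kaehler_metric (cotangent_bundle M) bundle_atlas bundle_metric"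
  unfolding pseudo_kaehler_metric_def pseudo_hermitian_metric_def tensor_field_def
proof (intro conjI ballI allI complex_manifold)
  fix c assume "c \<in> bundle_atlas"
  then obtain D \<phi> where ch: "(D, \<phi>) \<in> charts" and c: "c = (bchart D \<phi>)"
    by (rule bundle_atlasE)
  show "smooth_on (\<lambda>z. bundle_metric c z u v) (fst c)" for u v
    unfolding c fst_conv by (rule smooth_bundle_metric[OF ch])
  show "closed_2form_on (fst c) (\<lambda>z u v. Re (bundle_metric c z (\<i> *s u) v))"
    unfolding c fst_conv by (rule bundle_metric_closed[OF ch])
  show "hermitian_form (bundle_metric c z)" "nondegenerate_on UNIV (bundle_metric c z)"
    if "z \<in> fst c" for z
    using that unfolding c fst_conv by (rule bundle_metric_hermitian[OF ch])+
qed (rule bundle_tensor(1))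

lemma bundle_potential: "kaehler_potential (cotangent_bundle M) bundle_atlas potential bundle_metric"
  unfolding kaehler_potential_def
proof (intro conjI ballI)
  fix p assume "p \<in> cotangent_bundle M"
  then obtain m \<sigma> where p: "p = (m, \<sigma>)" "m \<in> M" "\<sigma> \<in> cotangent_space M m"
    by (auto simp: cotangent_bundle_def)
  let ?T = "TM m"
  note T = transverse_tangent[OF p(2)]
  let ?t = "momentum ?T \<sigma> + cvec (momentum ?T \<sigma>)"
  have "cvec ?t = ?t"
    by (simp add: add.commute)
  then have "cnj (?t \<odot> linear_solve (gram ?T) ?t) = ?t \<odot> linear_solve (gram ?T) ?t"
    unfolding cnj_cdot using real_solve[OF T, of ?t] by simp
  moreover have "cnj (\<gamma> m m) = \<gamma> m m"
    by (rule gamma_hermitian[symmetric])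
  ultimately show "potential p \<in> \<real>"
    unfolding p(1) cotangent_potential_eq[OF T p(3)] Reals_cnj_iff complex_cnj_add by simp
next
  fix c assume "c \<in> bundle_atlas"
  then obtain D \<phi> where ch: "(D, \<phi>) \<in> charts" and c: "c = (bchart D \<phi>)"
    by (rule bundle_atlasE)
  show "case c of (D, \<psi>) \<Rightarrow> smooth_on (potential \<circ> \<psi>) D \<and>
      (\<forall>z\<in>D. \<forall>I J. bundle_metric (D, \<psi>) z (axis I 1) (axis J 1)
        = wirtinger I (wirtinger_bar J (potential \<circ> \<psi>)) z)"
    unfolding c prod.case wirtinger_eq_wirt wirtinger_bar_eq_wirt_bar[abs_def] bundle_metric_def snd_conv
    using smooth_potential[OF ch] by simp
qed

lemma bundle_symplectic: "complex_symplectic_structure bundle_atlas standard_symplectic"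
  unfolding complex_symplectic_structure_def tensor_field_def closed_2form_on_def
    standard_symplectic_eq[abs_def]
  by (auto simp: complex_symplectic_Omega holomorphic_fun_on_const intro: bundle_tensor(2))

lemma bundle_parallel_symplectic: "parallel bundle_atlas bundle_metric standard_symplectic"
  unfolding parallel_def
proof
  fix c assume "c \<in> bundle_atlas"
  then obtain D \<phi> where ch: "(D, \<phi>) \<in> charts" and c: "c = (bchart D \<phi>)"
    by (rule bundle_atlasE)
  show "\<exists>\<Gamma>. levi_civita (fst c) (\<lambda>z u v. Re (bundle_metric c z u v)) \<Gamma>
    \<and> parallel_on (fst c) \<Gamma> (standard_symplectic c)"
    unfolding c fst_conv standard_symplectic_eq[abs_def] by (rule bundle_parallel[OF ch])
qed

end

theorem theorem1p5:
  fixes \<omega> :: "complex^'v \<Rightarrow> complex^'v \<Rightarrow> complex"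
    and \<tau> :: "complex^'v \<Rightarrow> complex^'v"
    and L\<^sub>0 L\<^sub>0' M :: "(complex^'v) set"
    and k l :: nat
  assumes "CARD('v) = 2 * CARD('n::finite)"
    and "fundamental_data \<omega> \<tau>"
    and "lagrangean_splitting \<omega> \<tau> L\<^sub>0 L\<^sub>0'"
    and "lagrangean_submanifold TYPE('n) \<omega> M"
  shows
    "(kaehler_submanifold TYPE('n) (gamma_form \<omega> \<tau>) M \<longrightarrow>
       (\<exists>G. kaehler_potential (cotangent_bundle M) (cotangent_atlas TYPE('n) M)
               (cotangent_potential \<omega> \<tau> L\<^sub>0 L\<^sub>0' M) G \<and>
            hyper_kaehler_metric (cotangent_bundle M) (cotangent_atlas TYPE('n) M) G \<and>
            complex_symplectic_structure (cotangent_atlas TYPE('n) M) standard_symplectic \<and>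
            parallel (cotangent_atlas TYPE('n) M) G standard_symplectic)) \<and>
     (pseudo_kaehler_submanifold TYPE('n) (gamma_form \<omega> \<tau>) M k l \<and>
      general_position TYPE('n) (vec.span L\<^sub>0) (vec.span L\<^sub>0') M \<longrightarrow>
       (\<exists>G. kaehler_potential (cotangent_bundle M) (cotangent_atlas TYPE('n) M)
               (cotangent_potential \<omega> \<tau> L\<^sub>0 L\<^sub>0' M) G \<and>
            pseudo_hyper_kaehler_metric (cotangent_bundle M) (cotangent_atlas TYPE('n) M) G \<and>
            metric_signature (cotangent_atlas TYPE('n) M) G (2 * k) (2 * l) \<and>
            complex_symplectic_structure (cotangent_atlas TYPE('n) M) standard_symplectic \<and>
            parallel (cotangent_atlas TYPE('n) M) G standard_symplectic))"
proof -
  obtain Q P :: "complex^'v \<Rightarrow> complex^'n" where "darboux \<omega> \<tau> L\<^sub>0 L\<^sub>0' Q P"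
    using darboux_exists[OF assms(2,1,3)] by blast
  then interpret darboux \<omega> \<tau> L\<^sub>0 L\<^sub>0' Q P .
  have sub: "complex_submanifold TYPE('n) M"
    using assms(4) by (simp add: lagrangean_submanifold_def)
  show ?thesis
  proof (intro conjI impI)
    assume K: "kaehler_submanifold TYPE('n) \<gamma> M"
    \<comment> \<open>Positivity on the tangent spaces supplies the transversality here, general
      position in the other case; \<open>bundle_metric\<close> is the witness for the metric in
      both.\<close>
    interpret lagrangean_bundle \<omega> \<tau> L\<^sub>0 L\<^sub>0' Q P M
      by unfold_locales (use sub kaehler_transverse[OF assms(4) K] in auto)
    have "positive_definite_on UNIV (bundle_metric c x)" if cx: "c \<in> bundle_atlas" "x \<in> fst c" for c x
    proof -
      obtain D \<phi> where ch: "(D, \<phi>) \<in> charts" and c: "c = (bchart D \<phi>)"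
        by (rule bundle_atlasE[OF cx(1)])
      have "x \<in> dom D"
        using cx(2) c by simp
      then show ?thesis
        unfolding c using K chart_in_M[OF ch]
        by (intro bundle_metric_positive[OF ch]) (auto simp: kaehler_submanifold_def)
    qed
    then have "hyper_kaehler_metric (cotangent_bundle M) bundle_atlas bundle_metric"
      unfolding hyper_kaehler_metric_def kaehler_metric_def
      using bundle_pseudo_kaehler bundle_symplectic bundle_parallel_symplectic by blast
    then show "\<exists>G. kaehler_potential (cotangent_bundle M) bundle_atlas potential G \<and>
        hyper_kaehler_metric (cotangent_bundle M) bundle_atlas G \<and>
        complex_symplectic_structure bundle_atlas standard_symplectic \<and>
        parallel bundle_atlas G standard_symplectic"
      using bundle_potential bundle_symplectic bundle_parallel_symplectic by blast
  next
    assume A: "pseudo_kaehler_submanifold TYPE('n) \<gamma> M k l \<and>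
      general_position TYPE('n) (vec.span L\<^sub>0) (vec.span L\<^sub>0') M"
    interpret lagrangean_bundle \<omega> \<tau> L\<^sub>0 L\<^sub>0' Q P M
      by unfold_locales (use sub general_position_transverse[OF assms(4)] A in auto)
    have "has_signature UNIV (bundle_metric c x) (2 * k) (2 * l)" if cx: "c \<in> bundle_atlas"
      "x \<in> fst c" for c x
    proof -
      obtain D \<phi> where ch: "(D, \<phi>) \<in> charts" and c: "c = (bchart D \<phi>)"
        by (rule bundle_atlasE[OF cx(1)])
      have "x \<in> dom D"
        using cx(2) c by simp
      then show ?thesis
        unfolding c using A chart_in_M[OF ch]
        by (intro bundle_metric_signature[OF ch]) (auto simp: pseudo_kaehler_submanifold_def)
    qed
    then have "metric_signature bundle_atlas bundle_metric (2 * k) (2 * l)"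
      by (simp add: metric_signature_def)
    moreover have "pseudo_hyper_kaehler_metric (cotangent_bundle M) bundle_atlas bundle_metric"
      unfolding pseudo_hyper_kaehler_metric_def
      using bundle_pseudo_kaehler bundle_symplectic bundle_parallel_symplectic by blast
    ultimately show "\<exists>G. kaehler_potential (cotangent_bundle M) bundle_atlas potential G \<and>
        pseudo_hyper_kaehler_metric (cotangent_bundle M) bundle_atlas G \<and>
        metric_signature bundle_atlas G (2 * k) (2 * l) \<and>
        complex_symplectic_structure bundle_atlas standard_symplectic \<and>
        parallel bundle_atlas G standard_symplectic"
      using bundle_potential bundle_symplectic bundle_parallel_symplectic by blast
  qed
qed

end
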